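(* Let $s\in C^2(\mathbb{R}^{B},\mathbb{R})$ satisfy (S1)-(S3), assume that $( *_0)$ and $( *_1)$ hold, and let $\rho_1,\dots,\rho_4\in(0,\bar\rho)$ be chosen as in the context. Then for each sufficiently large $l\in\mathbb{N}$ and each $\mathbf{m}=(\mathbf{m}_1,\mathbf{m}_2,\mathbf{m}_3,\mathbf{m}_4)\in\mathbb{Z}^4$ with $\mathbf{m}_1<\mathbf{m}_2<\mathbf{m}_2+2l<\mathbf{m}_3<\mathbf{m}_4$, there is a $U=U_{\mathbf{m},l}\in Y_{\mathbf{m},l}$ such that $J_1(U)=b_{\mathbf{m},l}$. Moreover, $U$ is a solution of (EL) provided that $\mathbf{m}_2-\mathbf{m}_1$ and $\mathbf{m}_4-\mathbf{m}_3$ are large enough.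
   Context: Model. Fix integers $n\ge 2$, $r\ge 1$. For $\mathbf{i}=(\mathbf{i}_1,\dots,\mathbf{i}_n)\in\mathbb{Z}^n$ let $\|\mathbf{i}\|=\sum_k|\mathbf{i}_k|$, and let $B=\{\mathbf{k}\in\mathbb{Z}^n:\|\mathbf{k}\|\le r\}$. A configuration is a function $u:\mathbb{Z}^n\to\mathbb{R}$; inequalities between configurations are pointwise ($u<v$ means $u(\mathbf{j})<v(\mathbf{j})$ for all $\mathbf{j}$). A function $s\in C^2(\mathbb{R}^{B},\mathbb{R})$ satisfies: (S1) $s(u+1_B)=s(u)$ for all $u\in\mathbb{R}^B$, where $1_B$ is the constant function $1$; (S2) $s$ is bounded from below, and $s(u)\to\infty$ as $|u(\mathbf{k})-u(\mathbf{j})|\to\infty$ for $\mathbf{k},\mathbf{j}\in B$ with $\|\mathbf{k}-\mathbf{j}\|=1$; (S3) the second partial derivatives satisfy $\partial_{\mathbf{k},\mathbf{j}}s\le 0$ for all $\mathbf{k}\ne\mathbf{j}$ in $B$, and $\partial_{\mathbf{0},\mathbf{j}}s<0$ whenever $\|\mathbf{j}\|=1$. For a configuration $u$ and $\mathbf{j}\in\mathbb{Z}^n$ put $S_{\mathbf{j}}(u)=s\big((u(\mathbf{j}+\mathbf{k}))_{\mathbf{k}\in B}\big)$. The Euler-Lagrange equation is (EL): $\sum_{\mathbf{j}:\|\mathbf{j}-\mathbf{i}\|\le r}\partial_{\mathbf{i}}S_{\mathbf{j}}(u)=0$ for all $\mathbf{i}\in\mathbb{Z}^n$, where $\partial_{\mathbf{i}}$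 is the derivative with respect to $u(\mathbf{i})$. A solution is a configuration satisfying (EL). Periodic minimizers. A configuration is $1$-periodic in $\mathbf{i}_j$ if $u(\mathbf{i}+\mathbf{e}_j)=u(\mathbf{i})$ for all $\mathbf{i}$, $\mathbf{e}_j$ being the $j$th unit vector. Let $c_0=\inf S_{\mathbf{0}}(u)$ over configurations $u$ that are $1$-periodic in all directions, and let $\mathcal{M}_0$ be the set of such $u$ with $S_{\mathbf{0}}(u)=c_0$. In an ordered set $A$ of configurations, $v<w$ in $A$ are adjacent if no $u\in A$ satisfies $v<u<w$. Gap condition $( *_0)$: there are adjacent $v_0,w_0\in\mathcal{M}_0$ with $v_0<w_0$. Basic heteroclinics. For $v<w$ in $\mathcal{M}_0$ let $\hat\Gamma_1(v,w)$ be the set of configurations $u$ that are $1$-periodic in $\mathbf{i}_2,\dots,\mathbf{i}_n$ with $v\le u\le w$. With $\mathbf{T}_i=i\mathbf{e}_1$ and $\|u\|_{\mathbf{T}_i}=|u(\mathbf{T}_i)|$, let $\Gamma_1(v_0,w_0)$ (resp. $\Gamma_1(w_0,v_0)$) be the set of $u\in\hat\Gamma_1(v_0,w_0)$ with $\|u-v_0\|_{\mathbf{T}_i}\to0$ as $i\to-\infty$ and $\|u-w_0\|_{\mathbf{T}_i}\to0$ as $i\to\infty$ (resp. with $v_0$ and $w_0$ interchanged in these limits). Put $J_{1,p}(u)=S_{\mathbf{T}_p}(u)-c_0$, $J_{1;p,q}(u)=\sum_{j=p}^qJ_{1,j}(u)$, $J_1(u)=\liminf_{p\to-\infty,\,q\to\infty}J_{1;p,q}(u)$.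 Let $c_1(v_0,w_0)=\inf_{\Gamma_1(v_0,w_0)}J_1$ and $\mathcal{M}_1(v_0,w_0)=\{u\in\Gamma_1(v_0,w_0):J_1(u)=c_1(v_0,w_0)\}$; $c_1(w_0,v_0)$ and $\mathcal{M}_1(w_0,v_0)$ are defined in the same way from $\Gamma_1(w_0,v_0)$. Gap condition $( *_1)$: there are adjacent $v_1<w_1$ in $\mathcal{M}_1(v_0,w_0)$ and adjacent $\tilde v_1<\tilde w_1$ in $\mathcal{M}_1(w_0,v_0)$. Constrained problem. Let $\rho_-(u)=\|u-v_0\|_{\mathbf{T}_0}$, $\rho_+(u)=\|u-w_0\|_{\mathbf{T}_0}$, $\bar\rho=\|w_0-v_0\|_{\mathbf{T}_0}$, and $(\tau^1_{-i}u)(\mathbf{j})=u(\mathbf{j}+i\mathbf{e}_1)$. Under $( *_1)$ one can and does fix $\rho_1,\dots,\rho_4\in(0,\bar\rho)$ with $\rho_1\notin\rho_-(\mathcal{M}_1(v_0,w_0))$, $\rho_2\notin\rho_+(\mathcal{M}_1(v_0,w_0))$, $\rho_3\notin\rho_+(\mathcal{M}_1(w_0,v_0))$, $\rho_4\notin\rho_-(\mathcal{M}_1(w_0,v_0))$. For $l\in\mathbb{N}$ and $\mathbf{m}\in\mathbb{Z}^4$ as in the claim, $Y_{\mathbf{m},l}$ is the set of $u\in\hat\Gamma_1(v_0,w_0)$ with $\|u-v_0\|_{\mathbf{T}_i}\to0$ as $|i|\to\infty$ and (a) $\rho_-(\tau^1_{-i}u)\le\rho_1$ for $\mathbf{m}_1-l\le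 i\le\mathbf{m}_1-1$; (b) $\rho_+(\tau^1_{-i}u)\le\rho_2$ for $\mathbf{m}_2\le i\le\mathbf{m}_2+l-1$; (c) $\rho_+(\tau^1_{-i}u)\le\rho_3$ for $\mathbf{m}_3-l\le i\le\mathbf{m}_3-1$; (d) $\rho_-(\tau^1_{-i}u)\le\rho_4$ for $\mathbf{m}_4\le i\le\mathbf{m}_4+l-1$. Put $b_{\mathbf{m},l}=\inf_{u\in Y_{\mathbf{m},l}}J_1(u)$. "Large enough" for $\mathbf{m}_2-\mathbf{m}_1,\ \mathbf{m}_4-\mathbf{m}_3$ means: for the given $l$ there is $N$ such that the conclusion holds whenever both differences are at least $N$. *)

theory Defs
  imports "HOL-Analysis.Analysis"
begin

text \<open>
  The lattice Z^n is \<open>int ^ 'n\<close> with n = CARD('n). The index type carries no canonical first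
  element, so the first coordinate direction is an explicit parameter \<open>d :: 'n\<close>. All hypotheses on
  the local potential are invariant under permuting coordinates.
\<close>

type_synonym 'n config = "int ^ 'n \<Rightarrow> real"

definition l1norm :: "int ^ 'n \<Rightarrow> int" where
  "l1norm i = (\<Sum>k\<in>UNIV. \<bar>i $ k\<bar>)"

definition l1ball :: "nat \<Rightarrow> (int ^ 'n) set" where
  "l1ball r = {k. l1norm k \<le> int r}"

lemma finite_l1ball: "finite (l1ball r :: (int ^ 'n) set)"
proof -
  let ?F = "PiE (UNIV :: 'n set) (\<lambda>_. {- int r..int r})"
  have "l1ball r \<subseteq> vec_lambda ` ?F"
  proof
    fix i :: "int ^ 'n"
    assume "i \<in> l1ball r"
    then have le: "(\<Sum>k\<in>UNIV. \<bar>i $ k\<bar>) \<le> int r"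
      by (simp add: l1ball_def l1norm_def)
    have "\<bar>i $ k\<bar> \<le> int r" for k
      using member_le_sum[of k UNIV "\<lambda>k. \<bar>i $ k\<bar>"] le by simp
    then have "vec_nth i \<in> ?F"
      by (auto simp: abs_le_iff minus_le_iff)
    then show "i \<in> vec_lambda ` ?F"
      by (metis image_eqI vec_nth_inverse)
  qed
  moreover have "finite ?F"
    by (intro finite_PiE) auto
  ultimately show ?thesis
    by (meson finite_imageI finite_subset)
qed

text \<open>
  R^B is the set \<open>B \<rightarrow>\<^sub>E UNIV\<close> of functions that are \<open>undefined\<close> off B. For finite B its subspace
  topology from the product topology is the Euclidean one. A function on R^B is a HOL function of
  which only the values on this set matter.
\<close>

abbreviation RB :: "'a set \<Rightarrow> ('a \<Rightarrow> real) set" where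
  "RB B \<equiv> B \<rightarrow>\<^sub>E UNIV"

definition partial_deriv :: "'a \<Rightarrow> (('a \<Rightarrow> real) \<Rightarrow> real) \<Rightarrow> ('a \<Rightarrow> real) \<Rightarrow> real" where
  "partial_deriv k f u = deriv (\<lambda>t. f (u(k := t))) (u k)"

definition C1_RB :: "'a set \<Rightarrow> (('a \<Rightarrow> real) \<Rightarrow> real) \<Rightarrow> bool" where
  "C1_RB B f \<longleftrightarrow> continuous_on (RB B) f \<and>
     (\<forall>k\<in>B. (\<forall>u\<in>RB B. (\<lambda>t. f (u(k := t))) field_differentiable at (u k)) \<and>
            continuous_on (RB B) (partial_deriv k f))"

definition C2_RB :: "'a set \<Rightarrow> (('a \<Rightarrow> real) \<Rightarrow> real) \<Rightarrow> bool" where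
  "C2_RB B f \<longleftrightarrow> C1_RB B f \<and> (\<forall>k\<in>B. C1_RB B (partial_deriv k f))"

definition S1 :: "nat \<Rightarrow> ('n::finite config \<Rightarrow> real) \<Rightarrow> bool" where
  "S1 r s \<longleftrightarrow> (\<forall>u\<in>RB (l1ball r). s (\<lambda>k\<in>l1ball r. u k + 1) = s u)"

definition S2 :: "nat \<Rightarrow> ('n::finite config \<Rightarrow> real) \<Rightarrow> bool" where
  "S2 r s \<longleftrightarrow> bdd_below (s ` RB (l1ball r)) \<and>
     (\<forall>k\<in>l1ball r. \<forall>j\<in>l1ball r. l1norm (k - j) = 1 \<longrightarrow>
        filterlim s at_top
          (inf (filtercomap (\<lambda>u. \<bar>u k - u j\<bar>) at_top) (principal (RB (l1ball r)))))"

definition S3 :: "nat \<Rightarrow> ('n::finite config \<Rightarrow> real) \<Rightarrow> bool" where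
  "S3 r s \<longleftrightarrow> (\<forall>u\<in>RB (l1ball r).
     (\<forall>k\<in>l1ball r. \<forall>j\<in>l1ball r. k \<noteq> j \<longrightarrow> partial_deriv k (partial_deriv j s) u \<le> 0) \<and>
     (\<forall>j. l1norm j = 1 \<longrightarrow> partial_deriv 0 (partial_deriv j s) u < 0))"

definition S_loc :: "nat \<Rightarrow> ('n::finite config \<Rightarrow> real) \<Rightarrow> int ^ 'n \<Rightarrow> 'n config \<Rightarrow> real" where
  "S_loc r s j u = s (\<lambda>k\<in>l1ball r. u (j + k))"

definition EL_solution :: "nat \<Rightarrow> ('n::finite config \<Rightarrow> real) \<Rightarrow> 'n config \<Rightarrow> bool" where
  "EL_solution r s u \<longleftrightarrow>
     (\<forall>i. (\<Sum>j | l1norm (j - i) \<le> int r. partial_deriv i (S_loc r s j) u) = 0)"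

text \<open>The order \<open><\<close> of the function type is not strict at every site, so the strict pointwise
  order is defined separately; the pointwise \<open>\<le>\<close> is the library one.\<close>

definition pless :: "'n::finite config \<Rightarrow> 'n config \<Rightarrow> bool" where
  "pless u v \<longleftrightarrow> (\<forall>j. u j < v j)"

definition adjacent :: "'n::finite config set \<Rightarrow> 'n config \<Rightarrow> 'n config \<Rightarrow> bool" where
  "adjacent A v w \<longleftrightarrow> v \<in> A \<and> w \<in> A \<and> pless v w \<and> \<not> (\<exists>u\<in>A. pless v u \<and> pless u w)"

definition periodic_in :: "'n::finite \<Rightarrow> 'n config \<Rightarrow> bool" where
  "periodic_in j u \<longleftrightarrow> (\<forall>i. u (i + axis j 1) = u i)"

definition c0 :: "nat \<Rightarrow> ('n::finite config \<Rightarrow> real) \<Rightarrow> real" where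
  "c0 r s = (INF u\<in>{u. \<forall>j. periodic_in j u}. S_loc r s 0 u)"

definition M0 :: "nat \<Rightarrow> ('n::finite config \<Rightarrow> real) \<Rightarrow> 'n config set" where
  "M0 r s = {u. (\<forall>j. periodic_in j u) \<and> S_loc r s 0 u = c0 r s}"

definition Gamma1_hat :: "'n::finite \<Rightarrow> 'n config \<Rightarrow> 'n config \<Rightarrow> 'n config set" where
  "Gamma1_hat d v w = {u. (\<forall>j. j \<noteq> d \<longrightarrow> periodic_in j u) \<and> v \<le> u \<and> u \<le> w}"

definition T :: "'n \<Rightarrow> int \<Rightarrow> int ^ 'n" where
  "T d i = axis d i"

definition dist_T :: "'n::finite \<Rightarrow> int \<Rightarrow> 'n config \<Rightarrow> 'n config \<Rightarrow> real" where
  "dist_T d i u v = \<bar>u (T d i) - v (T d i)\<bar>"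

text \<open>Configurations between \<open>v0\<close> and \<open>w0\<close> asymptotic to \<open>a\<close> at minus infinity and to \<open>b\<close> at
  infinity. The lower and upper bounds stay \<open>v0\<close> and \<open>w0\<close> when \<open>(a, b) = (w0, v0)\<close>; the choice
  \<open>a = b = v0\<close> gives the homoclinic class of the constrained problem.\<close>

definition Gamma1 ::
  "'n::finite \<Rightarrow> 'n config \<Rightarrow> 'n config \<Rightarrow> 'n config \<Rightarrow> 'n config \<Rightarrow> 'n config set" where
  "Gamma1 d v0 w0 a b = {u \<in> Gamma1_hat d v0 w0.
     ((\<lambda>i. dist_T d i u a) \<longlongrightarrow> 0) at_bot \<and> ((\<lambda>i. dist_T d i u b) \<longlongrightarrow> 0) at_top}"

definition J1_part :: "nat \<Rightarrow> 'n::finite \<Rightarrow> ('n config \<Rightarrow> real) \<Rightarrow> int \<Rightarrow> int \<Rightarrow> 'n config \<Rightarrow> real" where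
  "J1_part r d s p q u = (\<Sum>j=p..q. S_loc r s (T d j) u - c0 r s)"

text \<open>Extended real, since the lower limit is infinite for some configurations.\<close>

definition J1 :: "nat \<Rightarrow> 'n::finite \<Rightarrow> ('n config \<Rightarrow> real) \<Rightarrow> 'n config \<Rightarrow> ereal" where
  "J1 r d s u = Liminf (at_bot \<times>\<^sub>F at_top) (\<lambda>(p, q). ereal (J1_part r d s p q u))"

definition c1 :: "nat \<Rightarrow> 'n::finite \<Rightarrow> ('n config \<Rightarrow> real) \<Rightarrow>
    'n config \<Rightarrow> 'n config \<Rightarrow> 'n config \<Rightarrow> 'n config \<Rightarrow> ereal" where
  "c1 r d s v0 w0 a b = (INF u\<in>Gamma1 d v0 w0 a b. J1 r d s u)"

definition M1 :: "nat \<Rightarrow> 'n::finite \<Rightarrow> ('n config \<Rightarrow> real) \<Rightarrow>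
    'n config \<Rightarrow> 'n config \<Rightarrow> 'n config \<Rightarrow> 'n config \<Rightarrow> 'n config set" where
  "M1 r d s v0 w0 a b = {u \<in> Gamma1 d v0 w0 a b. J1 r d s u = c1 r d s v0 w0 a b}"

definition rho_minus :: "'n::finite \<Rightarrow> 'n config \<Rightarrow> 'n config \<Rightarrow> real" where
  "rho_minus d v0 u = dist_T d 0 u v0"

definition rho_plus :: "'n::finite \<Rightarrow> 'n config \<Rightarrow> 'n config \<Rightarrow> real" where
  "rho_plus d w0 u = dist_T d 0 u w0"

definition rho_bar :: "'n::finite \<Rightarrow> 'n config \<Rightarrow> 'n config \<Rightarrow> real" where
  "rho_bar d v0 w0 = dist_T d 0 w0 v0"

text \<open>\<open>shift1 d i\<close> is the translation usually written tau with upper index 1 and lower index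
  \<open>- i\<close>.\<close>

definition shift1 :: "'n::finite \<Rightarrow> int \<Rightarrow> 'n config \<Rightarrow> 'n config" where
  "shift1 d i u = (\<lambda>j. u (j + axis d i))"

definition Y :: "'n::finite \<Rightarrow> 'n config \<Rightarrow> 'n config \<Rightarrow> real \<Rightarrow> real \<Rightarrow> real \<Rightarrow> real \<Rightarrow>
    int \<Rightarrow> int \<Rightarrow> int \<Rightarrow> int \<Rightarrow> nat \<Rightarrow> 'n config set" where
  "Y d v0 w0 \<rho>1 \<rho>2 \<rho>3 \<rho>4 m1 m2 m3 m4 l = {u \<in> Gamma1 d v0 w0 v0 v0.
     (\<forall>i\<in>{m1 - int l..m1 - 1}. rho_minus d v0 (shift1 d i u) \<le> \<rho>1) \<and>
     (\<forall>i\<in>{m2..m2 + int l - 1}. rho_plus d w0 (shift1 d i u) \<le> \<rho>2) \<and>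
     (\<forall>i\<in>{m3 - int l..m3 - 1}. rho_plus d w0 (shift1 d i u) \<le> \<rho>3) \<and>
     (\<forall>i\<in>{m4..m4 + int l - 1}. rho_minus d v0 (shift1 d i u) \<le> \<rho>4)}"

end

theory Submission imports Defs begin

text \<open>
  The elements of \<open>M0\<close> are constant and all competitors depend on one coordinate only, so the problem
  is one for sequences with values in \<open>[a, b]\<close> and a finite-range energy that is submodular on the
  lattice of sequences, strictly so for crossing neighbours. Sorting all translates of a periodic
  sequence pointwise turns them into constants without raising the energy; hence the energy of a
  stretch that is close to \<open>a\<close> (or to \<open>b\<close>) at both ends is almost nonnegative, and is bounded
  away from 0 if the sequence deviates from \<open>a\<close> (from \<open>b\<close>) in between.

  If \<open>l\<close> is large, a configuration of bounded energy is close to \<open>a\<close> or \<open>b\<close> on a long window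
  inside each of the four constrained blocks, and at such a window configurations can be cut and glued
  at little cost. This gives compactness of minimizing sequences. A minimizer that touches a constraint
  would contain either a deviating stretch, which can be replaced by \<open>b\<close>, or a heteroclinic
  transition through a forbidden level, which by compactness costs a definite amount more than the
  infimum and can be replaced by a nearly minimal one if there is enough room. With all constraints
  inactive, the one-sided variations give the Euler-Lagrange equation; where the minimizer touches
  \<open>a\<close> or \<open>b\<close> the missing variation is supplied by comparison with the constant solution.
\<close>

section \<open>Sequences and chains of finite range\<close>

text \<open>Only finite sums are compared. A sequence that is exactly constant near both ends has a
  finite total energy, and truncating a sequence where it is within \<delta> of its end states costs
  at most \<open>C * \<delta>\<close>; infima are therefore taken over eventually constant
  sequences, and \<open>Liminf\<close> appears only when the result is carried back to
  configurations. The obstacle is the behaviour at infinity: a pointwise limit of minimizing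
  sequences keeps the constraints but may tend to the wrong end states. The constants come in a
  definite order: the price \<beta> of an excursion and the excess \<eta> at a forbidden level; then
  \<delta>, so small that all gluing errors together stay below the gain; then the block length at
  which a window of precision \<delta> must occur, and the room for one nearly minimal transition. A
  competitor of energy at most \<open>K\<close>, whatever the blocks are, makes the block length
  uniform.\<close>

definition inbox :: "real \<Rightarrow> real \<Rightarrow> (int \<Rightarrow> real) \<Rightarrow> bool" where
  "inbox a b x \<longleftrightarrow> (\<forall>i. a \<le> x i \<and> x i \<le> b)"

definition sh :: "int \<Rightarrow> (int \<Rightarrow> real) \<Rightarrow> int \<Rightarrow> real" where
  "sh j x = (\<lambda>i. x (i + j))"

definition J :: "((int \<Rightarrow> real) \<Rightarrow> real) \<Rightarrow> int \<Rightarrow> int \<Rightarrow> (int \<Rightarrow> real) \<Rightarrow> real" where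
  "J f p q x = (\<Sum>j=p..q. f (sh j x))"

definition tr :: "int \<Rightarrow> int \<Rightarrow> real \<Rightarrow> real \<Rightarrow> (int \<Rightarrow> real) \<Rightarrow> int \<Rightarrow> real" where
  "tr p q \<alpha> \<beta> x = (\<lambda>i. if i < p then \<alpha> else if q < i then \<beta> else x i)"

definition between :: "(int \<Rightarrow> real) \<Rightarrow> (int \<Rightarrow> real) \<Rightarrow> (int \<Rightarrow> real) \<Rightarrow> bool" where
  "between lo hi x \<longleftrightarrow> (\<forall>i. lo i \<le> x i \<and> x i \<le> hi i)"

definition flat :: "real \<Rightarrow> real \<Rightarrow> int \<Rightarrow> int \<Rightarrow> (int \<Rightarrow> real) \<Rightarrow> bool" where
  "flat \<alpha> \<beta> p q z \<longleftrightarrow> p \<le> q \<and> (\<forall>i\<le>p. z i = \<alpha>) \<and> (\<forall>i\<ge>q. z i = \<beta>)"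

definition close :: "real \<Rightarrow> real \<Rightarrow> int \<Rightarrow> int \<Rightarrow> (int \<Rightarrow> real) \<Rightarrow> bool" where
  "close t \<delta> p q x \<longleftrightarrow> (\<forall>i\<in>{p..q}. \<bar>x i - t\<bar> \<le> \<delta>)"

lemma closeD: "close t \<delta> p q x \<Longrightarrow> p \<le> i \<Longrightarrow> i \<le> q \<Longrightarrow> \<bar>x i - t\<bar> \<le> \<delta>"
  by (auto simp: close_def)

lemma inboxD: "inbox a b x \<Longrightarrow> a \<le> x i" "inbox a b x \<Longrightarrow> x i \<le> b"
  by (auto simp: inbox_def)

lemma inbox_sh: "inbox a b x \<Longrightarrow> inbox a b (sh j x)"
  by (auto simp: inbox_def sh_def)

lemma inbox_const: "a \<le> t \<Longrightarrow> t \<le> b \<Longrightarrow> inbox a b (\<lambda>_. t)"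
  by (auto simp: inbox_def)

lemma inbox_tr:
  "inbox a b x \<Longrightarrow> \<alpha> \<in> {a..b} \<Longrightarrow> \<beta> \<in> {a..b} \<Longrightarrow> inbox a b (tr p q \<alpha> \<beta> x)"
  by (auto simp: inbox_def tr_def)

lemma inbox_min_max:
  assumes "inbox a b x" "inbox a b y"
  shows "inbox a b (\<lambda>i. min (x i) (y i))" "inbox a b (\<lambda>i. max (x i) (y i))"
  using assms by (auto simp: inbox_def min_le_iff_disj le_max_iff_disj)

lemma flat_tr: "p \<le> q \<Longrightarrow> flat \<alpha> \<beta> (p - 1) (q + 1) (tr p q \<alpha> \<beta> x)"
  by (auto simp: flat_def tr_def)

lemma flat_mono: "flat \<alpha> \<beta> p q z \<Longrightarrow> p' \<le> p \<Longrightarrow> q \<le> q' \<Longrightarrow> flat \<alpha> \<beta> p' q' z"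
  by (auto simp: flat_def)

lemma sh_sh: "sh j (sh k x) = sh (j + k) x"
  by (simp add: sh_def algebra_simps)

lemma J_split:
  assumes "p \<le> w + 1" "w \<le> q"
  shows "J f p q x = J f p w x + J f (w + 1) q x"
proof -
  have "{p..q} = {p..w} \<union> {w + 1..q}" "{p..w} \<inter> {w + 1..q} = {}"
    using assms by auto
  then show ?thesis
    unfolding J_def by (metis finite_atLeastAtMost_int sum.union_disjoint)
qed

lemma J_sh: "J f p q (sh k x) = J f (p + k) (q + k) x"
  unfolding J_def sh_sh
  by (rule sum.reindex_bij_witness[of _ "\<lambda>j. j - k" "\<lambda>j. j + k"]) auto

section \<open>Pointwise sorting of finitely many sequences\<close>

fun insl :: "(int \<Rightarrow> real) \<Rightarrow> (int \<Rightarrow> real) list \<Rightarrow> (int \<Rightarrow> real) list" where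
  "insl y [] = [y]"
| "insl y (z # zs) = (\<lambda>i. min (y i) (z i)) # insl (\<lambda>i. max (y i) (z i)) zs"

text \<open>Sorts the values at all sites simultaneously, using only the lattice operations.\<close>

fun sortl :: "(int \<Rightarrow> real) list \<Rightarrow> (int \<Rightarrow> real) list" where
  "sortl [] = []"
| "sortl (y # ys) = insl y (sortl ys)"

text \<open>Handing the maximum on along a sorted list is insertion. The only operation is the
  exchange of a pair for its minimum and maximum, which is what submodularity controls.\<close>

lemma map_insl:
  "sorted (map (\<lambda>z. z i) zs) \<Longrightarrow> map (\<lambda>z. z i) (insl y zs) = insort (y i) (map (\<lambda>z. z i) zs)"
proof (induction zs arbitrary: y)
  case (Cons z zs)
  let ?m = "map (\<lambda>z. z i) zs"
  have s: "sorted ?m" and z: "\<forall>t\<in>set ?m. z i \<le> t"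
    using Cons.prems by auto
  have i: "insort (z i) ?m = z i # ?m"
    using z s by (cases zs) (auto)
  show ?case
  proof (cases "y i \<le> z i")
    case True
    then show ?thesis
      using Cons.IH[OF s, of "\<lambda>i. max (y i) (z i)"] i by (simp add: max_def min_def)
  next
    case False
    then show ?thesis
      using Cons.IH[OF s, of "\<lambda>i. max (y i) (z i)"] by (simp add: max_def min_def)
  qed
qed auto

lemma map_sortl: "map (\<lambda>z. z i) (sortl ys) = sort (map (\<lambda>z. z i) ys)"
proof (induction ys)
  case (Cons y ys)
  have "sorted (map (\<lambda>z. z i) (sortl ys))"
    using Cons by simp
  from map_insl[OF this] Cons show ?case by simp
qed auto

text \<open>\<open>f\<close> is the energy seen from site 0, normalized to vanish at the two ground
  states. \<open>lip\<close> also encodes the finite range: sequences that agree on [-r, r] have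
  equal energy. \<open>strict\<close> quantifies the gain from a crossing of neighbours, in both
  directions, so that the assumptions survive reflection.\<close>

locale chain =
  fixes f :: "(int \<Rightarrow> real) \<Rightarrow> real" and r :: nat and a b \<Lambda> \<kappa> :: real
  assumes ab: "a < b" and \<Lambda>: "0 \<le> \<Lambda>" and \<kappa>: "0 < \<kappa>"
    and lip: "inbox a b x \<Longrightarrow> inbox a b y \<Longrightarrow>
      \<bar>f x - f y\<bar> \<le> \<Lambda> * (\<Sum>i=-int r..int r. \<bar>x i - y i\<bar>)"
    and f_a: "f (\<lambda>_. a) = 0" and f_b: "f (\<lambda>_. b) = 0"
    and f_pos: "a < t \<Longrightarrow> t < b \<Longrightarrow> 0 < f (\<lambda>_. t)"
    and submod: "inbox a b x \<Longrightarrow> inbox a b y \<Longrightarrow>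
      f (\<lambda>i. min (x i) (y i)) + f (\<lambda>i. max (x i) (y i)) \<le> f x + f y"
    and strict: "inbox a b x \<Longrightarrow> inbox a b y \<Longrightarrow> \<sigma> \<in> {1, -1} \<Longrightarrow> x 0 \<le> y 0 \<Longrightarrow> y \<sigma> \<le> x \<sigma> \<Longrightarrow>
      f (\<lambda>i. min (x i) (y i)) + f (\<lambda>i. max (x i) (y i)) + \<kappa> * (y 0 - x 0) * (x \<sigma> - y \<sigma>)
        \<le> f x + f y"
begin

abbreviation "g \<equiv> (\<lambda>t. f (\<lambda>_. t))"

text \<open>For a sequence that equals \<open>a\<close> or \<open>b\<close> on each side of [p, q],
  the margin \<open>r\<close> collects every site whose energy can be nonzero.\<close>

abbreviation "En p q \<equiv> J f (p - int r) (q + int r)"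

lemma g_nonneg: "a \<le> t \<Longrightarrow> t \<le> b \<Longrightarrow> 0 \<le> g t"
  using f_pos[of t] f_a f_b by (cases "t = a"; cases "t = b") auto

definition "L \<equiv> \<Lambda> * (2 * real r + 1)"

lemma L_nonneg: "0 \<le> L"
  using \<Lambda> by (simp add: L_def)

text \<open>Every position is read by at most 2r + 1 sites; this is the factor in
  \<open>L\<close>.\<close>

lemma J_Lip:
  assumes "inbox a b x" "inbox a b y"
  shows "\<bar>J f p q x - J f p q y\<bar> \<le> L * (\<Sum>i=p - int r..q + int r. \<bar>x i - y i\<bar>)"
proof -
  let ?S = "\<Sum>i=p - int r..q + int r. \<bar>x i - y i\<bar>"
  have "\<bar>J f p q x - J f p q y\<bar> \<le> (\<Sum>j=p..q. \<bar>f (sh j x) - f (sh j y)\<bar>)"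
    unfolding J_def by (simp add: sum_subtractf[symmetric] sum_abs)
  also have "\<dots> \<le> (\<Sum>j=p..q. \<Lambda> * (\<Sum>i=-int r..int r. \<bar>x (i + j) - y (i + j)\<bar>))"
    by (intro sum_mono) (use lip[OF inbox_sh inbox_sh] assms in \<open>simp add: sh_def\<close>)
  also have "\<dots> = \<Lambda> * (\<Sum>i=-int r..int r. \<Sum>j=p..q. \<bar>x (i + j) - y (i + j)\<bar>)"
    by (subst sum.swap) (simp add: sum_distrib_left)
  also have "\<dots> \<le> \<Lambda> * (\<Sum>i=-int r..int r. ?S)"
  proof (intro mult_left_mono sum_mono \<Lambda>)
    fix i assume i: "i \<in> {-int r..int r}"
    have "(\<Sum>j=p..q. \<bar>x (i + j) - y (i + j)\<bar>) = (\<Sum>j\<in>(+) i ` {p..q}. \<bar>x j - y j\<bar>)"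
      by (subst sum.reindex) (auto simp: o_def)
    also have "\<dots> \<le> ?S"
      using i by (intro sum_mono2) auto
    finally show "(\<Sum>j=p..q. \<bar>x (i + j) - y (i + j)\<bar>) \<le> ?S" .
  qed
  also have "\<dots> = L * ?S"
    by (simp add: L_def algebra_simps)
  finally show ?thesis .
qed

text \<open>The form in which all gluing errors are estimated: \<open>F\<close> is the set of sites
  near a cut where the two sequences may differ.\<close>

lemma J_close:
  assumes "inbox a b x" "inbox a b y" "finite F"
    and eq: "\<And>i. p - int r \<le> i \<Longrightarrow> i \<le> q + int r \<Longrightarrow> i \<notin> F \<Longrightarrow> x i = y i"
    and F: "\<And>i. i \<in> F \<Longrightarrow> p - int r \<le> i \<Longrightarrow> i \<le> q + int r \<Longrightarrow> \<bar>x i - y i\<bar> \<le> \<delta>" and "0 \<le> (\<delta>::real)"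
  shows "\<bar>J f p q x - J f p q y\<bar> \<le> L * (real (card F) * \<delta>)"
proof -
  have "(\<Sum>i=p - int r..q + int r. \<bar>x i - y i\<bar>) = (\<Sum>i\<in>{p - int r..q + int r} \<inter> F. \<bar>x i - y i\<bar>)"
    by (rule sum.mono_neutral_right) (use eq in auto)
  also have "\<dots> \<le> (\<Sum>i\<in>{p - int r..q + int r} \<inter> F. \<delta>)"
    by (intro sum_mono) (use F in auto)
  also have "\<dots> \<le> real (card F) * \<delta>"
    using assms by (simp add: card_mono mult_right_mono)
  finally show ?thesis
    using J_Lip[OF assms(1,2), of p q] L_nonneg mult_left_mono order_trans by blast
qed

lemma J_eq:
  assumes "inbox a b x" "inbox a b y"
    and "\<And>i. p - int r \<le> i \<Longrightarrow> i \<le> q + int r \<Longrightarrow> x i = y i"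
  shows "J f p q x = J f p q y"
  using J_close[OF assms(1,2), of "{}" p q 0] assms(3) by auto

lemma J_const: "t \<in> {a, b} \<Longrightarrow> J f p q (\<lambda>_. t) = 0"
  using f_a f_b by (auto simp: J_def sh_def)

lemma insl_le:
  assumes "inbox a b y" "\<forall>z\<in>set zs. inbox a b z"
  shows "sum_list (map f (insl y zs)) \<le> f y + sum_list (map f zs) \<and> (\<forall>z\<in>set (insl y zs). inbox a b z)"
  using assms
proof (induction zs arbitrary: y)
  case (Cons z zs)
  then have w: "inbox a b (\<lambda>i. min (y i) (z i))" "inbox a b (\<lambda>i. max (y i) (z i))"
    by (auto intro: inbox_min_max)
  have y: "inbox a b y" and z: "inbox a b z" and zs: "\<forall>z\<in>set zs. inbox a b z"
    using Cons.prems by auto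
  show ?case
    using Cons.IH[OF w(2) zs] submod[OF y z] w(1) by simp
qed simp

lemma sortl_le:
  "\<forall>z\<in>set zs. inbox a b z \<Longrightarrow>
    sum_list (map f (sortl zs)) \<le> sum_list (map f zs) \<and> (\<forall>z\<in>set (sortl zs). inbox a b z)"
proof (induction zs)
  case (Cons y ys)
  then have IH: "sum_list (map f (sortl ys)) \<le> sum_list (map f ys)"
      "\<forall>z\<in>set (sortl ys). inbox a b z" and y: "inbox a b y"
    by simp_all
  show ?case
    using insl_le[OF y IH(2)] IH(1) by simp
qed simp

text \<open>If the values at each site form the same multiset, sorting makes every configuration
  constant.\<close>

lemma sum_const_le:
  assumes w: "\<forall>z\<in>set zs. inbox a b z" and m: "\<And>i. mset (map (\<lambda>z. z i) zs) = mset ts"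
  shows "sum_list (map g ts) \<le> sum_list (map f zs)"
proof -
  have s: "map (\<lambda>z. z i) (sortl zs) = sort ts" for i
    unfolding map_sortl by (rule properties_for_sort) (simp_all only: m mset_sort sorted_sort)
  have len: "length (sortl zs) = length (sort ts)"
    using arg_cong[OF s[of 0], of length] by simp
  have "sortl zs = map (\<lambda>t _. t) (sort ts)"
  proof (rule nth_equalityI)
    fix k assume k: "k < length (sortl zs)"
    have "(sortl zs ! k) i = sort ts ! k" for i
      using arg_cong[OF s[of i], of "\<lambda>l. l ! k"] k by simp
    then have "sortl zs ! k = (\<lambda>_. sort ts ! k)"
      by (rule ext)
    then show "sortl zs ! k = map (\<lambda>t _. t) (sort ts) ! k"
      using k len by simp
  qed (use len in simp)
  then have "sum_list (map f (sortl zs)) = sum_list (map g (sort ts))"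
    by (simp add: o_def)
  also have "\<dots> = sum_list (map g ts)"
    by (simp flip: sum_mset_sum_list)
  finally show ?thesis
    using sortl_le[OF w] by simp
qed

end

section \<open>Energy of periodic sequences\<close>

lemma int_crossing:
  fixes i j :: int
  assumes "P i" "\<not> P j" "i < j"
  obtains k where "i \<le> k" "k < j" "P k" "\<not> P (k + 1)"
proof -
  have "\<exists>k. i \<le> k \<and> k < j \<and> P k \<and> \<not> P (k + 1)"
  proof (rule ccontr)
    assume no: "\<not> ?thesis"
    have "k \<le> j \<longrightarrow> P k" if "i \<le> k" for k
      using that by (induction rule: int_ge_induct) (use assms no in auto)
    then show False
      using assms by auto
  qed
  then show ?thesis
    using that by blast
qed

text \<open>Moves a site into the period block starting at \<open>p\<close>; the offset
  \<open>m\<close> carries its right neighbour along, so that jumps are moved too.\<close>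

lemma periodic_mod:
  fixes y :: "int \<Rightarrow> real"
  assumes "\<And>i. y (i + N) = y i" "N > 0"
  shows "y (p + (i - p) mod N + m) = y (i + m)"
proof -
  have "y (i + k * N) = y i" for i k
  proof (induction k rule: int_induct[where k = 0])
    case (step1 k)
    then show ?case using assms(1)[of "i + k * N"] by (simp add: algebra_simps)
  next
    case (step2 k)
    then show ?case using assms(1)[of "i + (k - 1) * N"] by (simp add: algebra_simps)
  qed auto
  from this[of "p + (i - p) mod N + m" "(i - p) div N"] show ?thesis
    by (simp add: algebra_simps minus_mod_eq_mult_div[symmetric])
qed

lemma periodic_mset:
  fixes y :: "int \<Rightarrow> real"
  assumes per: "\<And>i. y (i + N) = y i" and "N > 0"
  shows "mset (map (\<lambda>j. y (i + j)) [p..p + N - 1]) = mset (map y [p..p + N - 1])"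
proof (induction i rule: int_induct[where k = 0])
  case base
  then show ?case by simp
next
  have step: "mset (map (\<lambda>j. y (i + 1 + j)) [p..p + N - 1]) = mset (map (\<lambda>j. y (i + j)) [p..p + N - 1])"
    for i
  proof -
    have l: "[p..p + N - 1] = p # [p + 1..p + N - 1]"
      using \<open>N > 0\<close> by (simp add: upto_rec1)
    have r: "[p..p + N - 1] = [p..p + N - 2] @ [p + N - 1]"
      using \<open>N > 0\<close> upto_rec2[of p "p + N - 1"] by simp
    have m: "map (\<lambda>j. y (i + j)) [p + 1..p + N - 1] = map (\<lambda>j. y (i + 1 + j)) [p..p + N - 2]"
      by (rule nth_equalityI) (auto simp: algebra_simps)
    have "y (i + 1 + (p + N - 1)) = y (i + p)"
      using per[of "i + p"] by (simp add: algebra_simps)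
    then have "mset (map (\<lambda>j. y (i + 1 + j)) [p..p + N - 1])
        = add_mset (y (i + p)) (mset (map (\<lambda>j. y (i + 1 + j)) [p..p + N - 2]))"
      by (subst r) simp
    also have "\<dots> = mset (map (\<lambda>j. y (i + j)) [p..p + N - 1])"
      by (subst l) (simp only: m[symmetric] list.map mset.simps)
    finally show ?thesis .
  qed
  {
    case (step1 i)
    then show ?case using step[of i] by simp
  next
    case (step2 i)
    then show ?case using step[of "i - 1"] by simp
  }
qed

lemma sum_list_upto: "sum_list (map h [p..q]) = (\<Sum>j=p..q. h j)"
  for h :: "int \<Rightarrow> real"
  by (simp add: sum_list_distinct_conv_sum_set)

context chain begin

text \<open>At each site the N translates over one period show the values of one period in rotated
  order, so sorting them produces the constants \<open>y j\<close>.\<close>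

lemma periodic_ge:
  assumes y: "inbox a b y" and per: "\<And>i. y (i + N) = y i" and "N > 0"
  shows "(\<Sum>j=p..p + N - 1. g (y j)) \<le> J f p (p + N - 1) y"
proof -
  let ?zs = "map (\<lambda>j. sh j y) [p..p + N - 1]"
  have "sum_list (map g (map y [p..p + N - 1])) \<le> sum_list (map f ?zs)"
  proof (rule sum_const_le)
    show "mset (map (\<lambda>z. z i) ?zs) = mset (map y [p..p + N - 1])" for i
      using periodic_mset[of y N i p] per \<open>N > 0\<close> by (simp add: sh_def o_def del: mset_map)
  qed (use y inbox_sh in auto)
  then show ?thesis
    by (simp add: J_def o_def sum_list_upto)
qed

text \<open>Exchanging one crossing pair of translates for its minimum and maximum releases the gain
  from \<open>strict\<close> and does not change the values at any site, so the energy left over is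
  still bounded below by constants, hence nonnegative.\<close>

lemma periodic_gain:
  assumes y: "inbox a b y" and per: "\<And>i. y (i + N) = y i" and "N > 0"
    and j: "j1 \<in> {p..p + N - 1}" "j2 \<in> {p..p + N - 1}" "j1 \<noteq> j2"
    and le: "y j1 \<le> y j2" "y (j2 + 1) \<le> y (j1 + 1)"
  shows "\<kappa> * (y j2 - y j1) * (y (j1 + 1) - y (j2 + 1)) \<le> J f p (p + N - 1) y"
proof -
  let ?xs = "[p..p + N - 1]" and ?u = "sh j1 y" and ?v = "sh j2 y"
  define rest where "rest = remove1 j2 (remove1 j1 ?xs)"
  have m: "mset ?xs = add_mset j1 (add_mset j2 (mset rest))"
  proof -
    have split: "mset xs = add_mset x (mset (remove1 x xs))" if "x \<in> set xs" for x :: int and xs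
      using that by simp
    have "mset ?xs = add_mset j1 (mset (remove1 j1 ?xs))"
      by (rule split) (use j in auto)
    moreover have "mset (remove1 j1 ?xs) = add_mset j2 (mset rest)"
      unfolding rest_def by (rule split) (use j in \<open>auto simp: set_remove1_eq\<close>)
    ultimately show ?thesis by simp
  qed
  let ?mi = "\<lambda>i. min (?u i) (?v i)" and ?ma = "\<lambda>i. max (?u i) (?v i)"
  let ?zs = "?mi # ?ma # map (\<lambda>j. sh j y) rest"
  have uv: "inbox a b ?u" "inbox a b ?v"
    using y by (auto intro: inbox_sh)
  have "0 \<le> sum_list (map g (map y ?xs))"
    using y g_nonneg by (intro sum_list_nonneg) (auto simp: inbox_def)
  also have "\<dots> \<le> sum_list (map f ?zs)"
  proof (rule sum_const_le)
    show "\<forall>z\<in>set ?zs. inbox a b z"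
      using uv inbox_min_max[OF uv] y inbox_sh by auto
    fix i
    have "mset (map (\<lambda>z. z i) ?zs) = image_mset (\<lambda>j. y (i + j)) (mset ?xs)"
      by (simp add: m sh_def min_def max_def o_def image_mset.compositionality)
    also have "\<dots> = mset (map (\<lambda>j. y (i + j)) ?xs)"
      by simp
    also have "\<dots> = mset (map y ?xs)"
      by (rule periodic_mset) (use per \<open>N > 0\<close> in auto)
    finally show "mset (map (\<lambda>z. z i) ?zs) = mset (map y ?xs)" .
  qed
  also have "\<dots> = f ?mi + f ?ma + sum_list (map (\<lambda>j. f (sh j y)) rest)"
    by (simp add: o_def)
  also have "\<dots> \<le> f ?u + f ?v - \<kappa> * (y j2 - y j1) * (y (j1 + 1) - y (j2 + 1))
      + sum_list (map (\<lambda>j. f (sh j y)) rest)"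
    using strict[OF uv, of 1] le by (simp add: sh_def add.commute)
  also have "f ?u + f ?v - \<kappa> * (y j2 - y j1) * (y (j1 + 1) - y (j2 + 1))
      + sum_list (map (\<lambda>j. f (sh j y)) rest)
      = J f p (p + N - 1) y - \<kappa> * (y j2 - y j1) * (y (j1 + 1) - y (j2 + 1))"
  proof -
    have "J f p (p + N - 1) y = sum_list (map (\<lambda>j. f (sh j y)) ?xs)"
      by (simp add: J_def sum_list_upto)
    also have "\<dots> = sum_mset (image_mset (\<lambda>j. f (sh j y)) (mset ?xs))"
      by (simp flip: sum_mset_sum_list)
    also have "\<dots> = f ?u + f ?v + sum_list (map (\<lambda>j. f (sh j y)) rest)"
      unfolding m by (simp flip: sum_mset_sum_list)
    finally show ?thesis by simp
  qed
  finally show ?thesis by simp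
qed

lemma g_lip: "u \<in> {a..b} \<Longrightarrow> v \<in> {a..b} \<Longrightarrow> \<bar>g u - g v\<bar> \<le> L * \<bar>u - v\<bar>"
  using lip[OF inbox_const[of a u b] inbox_const[of a v b]] by (simp add: L_def algebra_simps)

lemma g_continuous: "continuous_on {a..b} g"
proof -
  have "L-lipschitz_on {a..b} g"
    by (rule lipschitz_onI) (use g_lip L_nonneg in \<open>auto simp: dist_real_def\<close>)
  then show ?thesis
    by (rule lipschitz_on_continuous_on)
qed

lemma g_bound:
  assumes "0 < \<theta>"
  obtains \<mu> where "0 < \<mu>" "\<And>u. a + \<theta> \<le> u \<Longrightarrow> u \<le> b - \<theta> \<Longrightarrow> \<mu> \<le> g u"
proof (cases "{a + \<theta>..b - \<theta>} = {}")
  case True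
  then show ?thesis
    using that[of 1] by auto
next
  case False
  have "continuous_on {a + \<theta>..b - \<theta>} g"
    by (rule continuous_on_subset[OF g_continuous]) (use assms in auto)
  from continuous_attains_inf[OF compact_Icc False this]
  obtain u where "u \<in> {a + \<theta>..b - \<theta>}" "\<forall>v\<in>{a + \<theta>..b - \<theta>}. g u \<le> g v"
    by blast
  then show ?thesis
    using that[of "g u"] f_pos[of u] assms by auto
qed

text \<open>Either some value is intermediate, and its constant already has positive energy, or the
  sequence takes values near both \<open>a\<close> and \<open>b\<close> only. In the second case
  periodicity yields a rise and a fall, and the translates that align them cross.\<close>

lemma periodic_beta:
  assumes "0 < \<theta>"
  obtains \<beta> where "0 < \<beta>"
    "\<And>y N p t i0 i1. inbox a b y \<Longrightarrow> (\<And>i. y (i + N) = y i) \<Longrightarrow> N > 0 \<Longrightarrow> t \<in> {a, b} \<Longrightarrow>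
       y i1 = t \<Longrightarrow> \<theta> \<le> \<bar>y i0 - t\<bar> \<Longrightarrow> \<beta> \<le> J f p (p + N - 1) y"
proof -
  \<comment> \<open>A quarter of the gap, so that low and high values differ by at least the half
    gap \<open>h\<close>.\<close>
  define \<theta>' where "\<theta>' = min \<theta> ((b - a) / 4)"
  have \<theta>': "0 < \<theta>'" "\<theta>' \<le> \<theta>" "\<theta>' \<le> (b - a) / 4"
    using assms ab by (simp_all only: \<theta>'_def min.cobounded1 min.cobounded2) simp
  obtain \<mu> where \<mu>: "0 < \<mu>" "\<And>u. a + \<theta>' \<le> u \<Longrightarrow> u \<le> b - \<theta>' \<Longrightarrow> \<mu> \<le> g u"
    using g_bound[OF \<theta>'(1)] by blast
  define h where "h = (b - a) / 2"
  have h: "0 < h" using ab by (simp add: h_def)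
  have "min \<mu> (\<kappa> * h * h) \<le> J f p (p + N - 1) y"
    if y: "inbox a b y" and per: "\<And>i. y (i + N) = y i" and N: "N > 0" and t: "t \<in> {a, b}"
      and i1: "y i1 = t" and i0: "\<theta> \<le> \<bar>y i0 - t\<bar>" for y N p t i0 i1
  proof (cases "\<exists>i. a + \<theta>' \<le> y i \<and> y i \<le> b - \<theta>'")
    case True
    then obtain i where i: "a + \<theta>' \<le> y i" "y i \<le> b - \<theta>'" by blast
    define j where "j = p + (i - p) mod N"
    have j: "j \<in> {p..p + N - 1}" "y j = y i"
      using N periodic_mod[of y N p i 0] per
      by (auto simp: j_def)
    have "\<mu> \<le> g (y j)"
      using \<mu> i j by simp
    also have "\<dots> \<le> (\<Sum>j=p..p + N - 1. g (y j))"
      by (rule member_le_sum) (use j y g_nonneg in \<open>auto simp: inbox_def\<close>)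
    also have "\<dots> \<le> J f p (p + N - 1) y"
      by (rule periodic_ge) fact+
    finally show ?thesis by simp
  next
    case False
    then have side: "y i < a + \<theta>' \<or> b - \<theta>' < y i" for i
      by (meson not_le)
    let ?P = "\<lambda>i. y i < a + \<theta>'"
    have "\<exists>i i'. ?P i \<and> \<not> ?P i'"
    proof (cases "t = a")
      case True
      then have "?P i1" "\<not> ?P i0"
        using i1 i0 \<theta>' inboxD[OF y, of i0] ab by (auto simp: abs_if split: if_splits)
      then show ?thesis by blast
    next
      case False
      then have "t = b" using t by simp
      then have "\<not> ?P i1" "\<not> b - \<theta>' < y i0"
        using i1 i0 \<theta>' inboxD[OF y, of i0] ab by (auto simp: abs_if split: if_splits)
      then show ?thesis using side[of i0] by blast
    qed
    then obtain i i' where i: "?P i" "\<not> ?P i'" by blast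
    have shift: "y (k + m * N) = y k" for k m
      using periodic_mod[of y N 0 "k + m * N" 0] periodic_mod[of y N 0 k 0] per N by simp
    have far: "\<exists>m. k < k' + m * N" for k k' :: int
    proof -
      have "k - k' < (\<bar>k - k'\<bar> + 1) * N"
        using N by (smt (verit) mult_le_cancel_left1)
      then show ?thesis by (intro exI[of _ "\<bar>k - k'\<bar> + 1"]) linarith
    qed
    \<comment> \<open>Moving by whole periods puts a high site after a low one and then a low site
      after a high one; the first order yields the rise \<open>k1\<close>, the second the fall
      \<open>k2\<close>.\<close>
    obtain m where m: "i < i' + m * N" using far by blast
    obtain k1 where k1: "?P k1" "\<not> ?P (k1 + 1)"
      by (rule int_crossing[of ?P i "i' + m * N"]) (use i m shift in auto)
    obtain m' where m': "i' < i + m' * N" using far by blast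
    obtain k2 where k2: "\<not> ?P k2" "\<not> \<not> ?P (k2 + 1)"
      by (rule int_crossing[of "\<lambda>i. \<not> ?P i" i' "i + m' * N"]) (use i m' shift in auto)
    define j1 j2 where "j1 = p + (k1 - p) mod N" and "j2 = p + (k2 - p) mod N"
    have j: "j1 \<in> {p..p + N - 1}" "j2 \<in> {p..p + N - 1}"
      using N by (auto simp: j1_def j2_def)
    have yj: "y j1 = y k1" "y j2 = y k2" "y (j1 + 1) = y (k1 + 1)" "y (j2 + 1) = y (k2 + 1)"
      using periodic_mod[of y N p k1 0] periodic_mod[of y N p k1 1]
        periodic_mod[of y N p k2 0] periodic_mod[of y N p k2 1] per N
      by (simp_all add: j1_def j2_def)
    have d: "h \<le> y j2 - y j1" "h \<le> y (j1 + 1) - y (j2 + 1)"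
      using k1 k2 side[of k2] side[of "k1 + 1"] \<theta>' unfolding yj h_def by auto
    then have "j1 \<noteq> j2"
      using h by auto
    then have "\<kappa> * (y j2 - y j1) * (y (j1 + 1) - y (j2 + 1)) \<le> J f p (p + N - 1) y"
      by (intro periodic_gain) (use y per N j d h in auto)
    moreover have "\<kappa> * h * h \<le> \<kappa> * (y j2 - y j1) * (y (j1 + 1) - y (j2 + 1))"
      using d h \<kappa> by (intro mult_mono) auto
    ultimately show ?thesis by linarith
  qed
  then show ?thesis
    using that[of "min \<mu> (\<kappa> * h * h)"] \<mu>(1) \<kappa> h by auto
qed

section \<open>Eventually constant sequences and truncation\<close>

lemma flat_J_extend:
  assumes z: "inbox a b z" "flat \<alpha> \<beta> p q z" and ends: "\<alpha> \<in> {a, b}" "\<beta> \<in> {a, b}"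
    and "p' \<le> p - int r" "q + int r \<le> q'"
  shows "J f p' q' z = En p q z"
proof -
  have "p \<le> q" using z by (simp add: flat_def)
  have c: "inbox a b (\<lambda>_. \<alpha>)" "inbox a b (\<lambda>_. \<beta>)"
    using ends ab by (auto intro!: inbox_const)
  have "J f p' (p - int r - 1) z = J f p' (p - int r - 1) (\<lambda>_. \<alpha>)"
    by (rule J_eq) (use z c in \<open>auto simp: flat_def\<close>)
  moreover have "J f (q + int r + 1) q' z = J f (q + int r + 1) q' (\<lambda>_. \<beta>)"
    by (rule J_eq) (use z c in \<open>auto simp: flat_def\<close>)
  ultimately show ?thesis
    using J_split[of p' "p - int r - 1" q' f z] J_split[of "p - int r" "q + int r" q' f z]
      assms \<open>p \<le> q\<close> J_const[OF ends(1)] J_const[OF ends(2)] by simp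
qed

text \<open>The block [p - r, q + r] repeated periodically. Its margins carry the value
  \<open>t\<close>, so a site of the block that looks across the seam sees \<open>t\<close>, exactly
  as it does in \<open>z\<close>.\<close>

lemma flat_periodic:
  assumes z: "inbox a b z" "flat t t p q z"
  obtains y N where "inbox a b y" "\<And>i. y (i + N) = y i" "N > 0" "p - int r + N - 1 = q + int r"
    "En p q y = En p q z"
    "\<And>i. p - int r \<le> i \<Longrightarrow> i \<le> q + int r \<Longrightarrow> y i = z i"
proof -
  define P where "P = p - int r"
  define N where "N = q - p + 2 * int r + 1"
  define y where "y = (\<lambda>i. z (P + (i - P) mod N))"
  have pq: "p \<le> q" using z by (simp add: flat_def)
  have N: "N > 0" using pq by (simp add: N_def)
  have yz: "y i = z i" if "P \<le> i" "i \<le> q + int r" for i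
    using that by (simp add: y_def N_def P_def)
  have per: "y (i + N) = y i" for i
  proof -
    have "i + N - P = i - P + N" by simp
    then show ?thesis by (simp only: y_def mod_add_self2)
  qed
  have t: "z i = t" if "i \<le> p \<or> q \<le> i" for i
    using z that by (auto simp: flat_def)
  have y: "inbox a b y"
    using z by (simp add: inbox_def y_def)
  have "J f P (q + int r) y = J f P (q + int r) z"
  proof (rule J_eq[OF y z(1)])
    fix i assume i: "P - int r \<le> i" "i \<le> q + int r + int r"
    consider "i < P" | "P \<le> i" "i \<le> q + int r" | "q + int r < i" by linarith
    then show "y i = z i"
    proof cases
      case 1
      then have "y (i + N) = z (i + N)"
        using i pq by (intro yz) (auto simp: N_def P_def)
      then show ?thesis
        using 1 i pq t[of i] t[of "i + N"] per[of i] by (simp add: N_def P_def)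
    next
      case 3
      then have "y (i - N) = z (i - N)"
        using i pq by (intro yz) (auto simp: N_def P_def)
      then show ?thesis
        using 3 i pq t[of i] t[of "i - N"] per[of "i - N"] by (simp add: N_def P_def)
    qed (use yz in auto)
  qed
  then show ?thesis
    using that[of y N] y per N yz by (simp add: P_def N_def)
qed

lemma hom_ge:
  assumes z: "inbox a b z" "flat t t p q z"
  shows "(\<Sum>i=p..q. g (z i)) \<le> En p q z"
proof -
  obtain y N where y: "inbox a b y" "\<And>i. y (i + N) = y i" "N > 0" "p - int r + N - 1 = q + int r"
    "En p q y = En p q z"
    "\<And>i. p - int r \<le> i \<Longrightarrow> i \<le> q + int r \<Longrightarrow> y i = z i"
    using flat_periodic[OF z] by blast
  have "(\<Sum>i=p..q. g (z i)) \<le> (\<Sum>i=p - int r..q + int r. g (z i))"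
    by (rule sum_mono2) (use z g_nonneg in \<open>auto simp: inbox_def\<close>)
  also have "\<dots> = (\<Sum>i=p - int r..q + int r. g (y i))"
    using y(6) by simp
  finally show ?thesis
    using periodic_ge[OF y(1-3), of "p - int r"] y(4,5) by simp
qed

text \<open>The factor 6 is the sum of three contributions of 2 in \<open>truncation\<close>: r
  sites off by 2\<delta> in each outer collar, and 2r sites off by \<delta> inside. The added 1
  keeps \<open>C\<close> positive, so that one can divide by it.\<close>

definition "C \<equiv> 6 * real r * L + 1"

lemma C_pos: "0 < C"
  using L_nonneg by (simp add: C_def add_nonneg_pos)

lemma truncation:
  assumes x: "inbox a b x" and ends: "\<alpha> \<in> {a, b}" "\<beta> \<in> {a, b}" and "p \<le> q" and "0 \<le> \<delta>"
    and cl: "close \<alpha> \<delta> (p - int r) (p + int r) x" "close \<beta> \<delta> (q - int r) (q + int r) x"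
  shows "\<bar>En (p - 1) (q + 1) (tr p q \<alpha> \<beta> x) - J f p q x\<bar> \<le> C * \<delta>"
proof -
  define z where "z = tr p q \<alpha> \<beta> x"
  have c: "inbox a b (\<lambda>_. \<alpha>)" "inbox a b (\<lambda>_. \<beta>)"
    using ends ab by (auto intro!: inbox_const)
  have z: "inbox a b z"
    unfolding z_def by (rule inbox_tr) (use x ends ab in auto)
  \<comment> \<open>The bound is 2\<delta> rather than \<delta> because the stretch may be shorter
    than \<open>r\<close>: a site of the left collar beyond \<open>q\<close> carries \<beta>, but
    \<open>x\<close> is within \<delta> of both \<alpha> and \<beta> there.\<close>
  have 1: "\<bar>J f (p - 1 - int r) (p - 1) z - J f (p - 1 - int r) (p - 1) (\<lambda>_. \<alpha>)\<bar>
      \<le> L * (real (card {p..p - 1 + int r}) * (2 * \<delta>))"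
  proof (rule J_close[OF z c(1)])
    fix i assume "i \<in> {p..p - 1 + int r}"
    then show "\<bar>z i - \<alpha>\<bar> \<le> 2 * \<delta>"
      using closeD[OF cl(1), of i] closeD[OF cl(2), of i] \<open>0 \<le> \<delta>\<close> \<open>p \<le> q\<close>
      by (auto simp: z_def tr_def abs_if split: if_splits)
  qed (use \<open>0 \<le> \<delta>\<close> \<open>p \<le> q\<close> in \<open>auto simp: z_def tr_def\<close>)
  have 2: "\<bar>J f (q + 1) (q + 1 + int r) z - J f (q + 1) (q + 1 + int r) (\<lambda>_. \<beta>)\<bar>
      \<le> L * (real (card {q + 1 - int r..q}) * (2 * \<delta>))"
  proof (rule J_close[OF z c(2)])
    fix i assume "i \<in> {q + 1 - int r..q}"
    then show "\<bar>z i - \<beta>\<bar> \<le> 2 * \<delta>"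
      using closeD[OF cl(1), of i] closeD[OF cl(2), of i] \<open>0 \<le> \<delta>\<close> \<open>p \<le> q\<close>
      by (auto simp: z_def tr_def abs_if split: if_splits)
  qed (use \<open>0 \<le> \<delta>\<close> \<open>p \<le> q\<close> in \<open>auto simp: z_def tr_def\<close>)
  have 3: "\<bar>J f p q z - J f p q x\<bar>
      \<le> L * (real (card ({p - int r..p - 1} \<union> {q + 1..q + int r})) * \<delta>)"
  proof (rule J_close[OF z x])
    fix i assume "i \<in> {p - int r..p - 1} \<union> {q + 1..q + int r}"
    then show "\<bar>z i - x i\<bar> \<le> \<delta>"
      using closeD[OF cl(1), of i] closeD[OF cl(2), of i] \<open>p \<le> q\<close>
      by (auto simp: z_def tr_def abs_minus_commute)
  qed (use \<open>0 \<le> \<delta>\<close> in \<open>auto simp: z_def tr_def\<close>)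
  have 4: "card ({p - int r..p - 1} \<union> {q + 1..q + int r}) = 2 * r"
    using \<open>p \<le> q\<close> by (subst card_Un_disjoint) auto
  have 5: "En (p - 1) (q + 1) z
      = J f (p - 1 - int r) (p - 1) z + J f p q z + J f (q + 1) (q + 1 + int r) z"
    using J_split[of "p - 1 - int r" "p - 1" "q + 1 + int r" f z] J_split[of p q "q + 1 + int r" f z]
      \<open>p \<le> q\<close> by simp
  have "real (card {p..p - 1 + int r}) = r" "real (card {q + 1 - int r..q}) = r"
    by simp_all
  note 1 = 1[unfolded J_const[OF ends(1)] this diff_0_right]
    and 2 = 2[unfolded J_const[OF ends(2)] this diff_0_right] and 3 = 3[unfolded 4]
  have "\<bar>En (p - 1) (q + 1) z - J f p q x\<bar>
      \<le> \<bar>J f (p - 1 - int r) (p - 1) z\<bar> + \<bar>J f p q z - J f p q x\<bar>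
        + \<bar>J f (q + 1) (q + 1 + int r) z\<bar>"
    unfolding 5 by linarith
  also have "\<dots> \<le> L * (real r * (2 * \<delta>)) + L * (real (2 * r) * \<delta>) + L * (real r * (2 * \<delta>))"
    using 1 2 3 by linarith
  also have "\<dots> \<le> C * \<delta>"
    using \<open>0 \<le> \<delta>\<close> by (simp add: C_def algebra_simps)
  finally show ?thesis
    by (simp add: z_def)
qed

text \<open>The truncation error for \<delta> = b - a, a precision that every sequence in the box
  has; thus the price of a cut at an arbitrary place.\<close>

definition "K \<equiv> C * (b - a)"

lemma K_pos: "0 < K"
  using C_pos ab by (simp add: K_def)

lemma J_ge:
  assumes x: "inbox a b x"
  shows "(\<Sum>i=p..q. g (x i)) - K \<le> J f p q x"
proof (cases "p \<le> q")
  case True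
  define z where "z = tr p q a a x"
  have z: "inbox a b z" "flat a a (p - 1) (q + 1) z"
    unfolding z_def by (auto intro!: inbox_tr flat_tr x simp: True less_imp_le[OF ab])
  have "\<bar>En (p - 1) (q + 1) z - J f p q x\<bar> \<le> C * (b - a)"
    unfolding z_def by (rule truncation) (use x ab True in \<open>auto simp: close_def inbox_def\<close>)
  moreover have "(\<Sum>i=p..q. g (x i)) = (\<Sum>i=p..q. g (z i))"
    by (intro sum.cong) (auto simp: z_def tr_def)
  moreover have "\<dots> \<le> (\<Sum>i=p - 1..q + 1. g (z i))"
    by (rule sum_mono2) (use z g_nonneg in \<open>auto simp: inbox_def\<close>)
  ultimately show ?thesis
    using hom_ge[OF z] by (simp add: K_def)
qed (use K_pos in \<open>simp add: J_def\<close>)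

lemma J_ge_K: "inbox a b x \<Longrightarrow> - K \<le> J f p q x"
  using J_ge[of x p q] sum_nonneg[of "{p..q}" "\<lambda>i. g (x i)"] g_nonneg by (simp add: inbox_def)

lemma J_hom_0:
  assumes "inbox a b x" "t \<in> {a, b}" "p \<le> q" "0 \<le> \<delta>"
    and "close t \<delta> (p - int r) (p + int r) x" "close t \<delta> (q - int r) (q + int r) x"
  shows "- (C * \<delta>) \<le> J f p q x"
proof -
  let ?z = "tr p q t t x"
  have z: "inbox a b ?z" "flat t t (p - 1) (q + 1) ?z"
    using assms ab by (auto intro!: inbox_tr flat_tr)
  have "0 \<le> (\<Sum>i=p - 1..q + 1. g (?z i))"
    using z g_nonneg by (intro sum_nonneg) (auto simp: inbox_def)
  then show ?thesis
    using hom_ge[OF z] truncation[OF assms(1,2,2,3,4,5,6)] by simp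
qed

abbreviation "deviation_bound \<theta> \<beta> \<equiv> (\<forall>x t p q \<delta> i. inbox a b x \<longrightarrow> t \<in> {a, b} \<longrightarrow> 0 \<le> \<delta> \<longrightarrow>
  close t \<delta> (p - int r) (p + int r) x \<longrightarrow> close t \<delta> (q - int r) (q + int r) x \<longrightarrow>
  p \<le> i \<longrightarrow> i \<le> q \<longrightarrow> \<theta> \<le> \<bar>x i - t\<bar> \<longrightarrow> \<beta> - C * \<delta> \<le> J f p q x)"

text \<open>The truncated stretch closes up to a periodic sequence that takes both the value
  \<open>t\<close> and the deviating value, so \<open>periodic_beta\<close> applies. The resulting
  \<beta> depends on \<theta> alone, not on the length of the stretch.\<close>

lemma J_hom:
  assumes "0 < \<theta>"
  obtains \<beta> where "0 < \<beta>" "deviation_bound \<theta> \<beta>"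
proof -
  obtain \<beta> where \<beta>: "0 < \<beta>"
    "\<And>y N p t i0 i1. inbox a b y \<Longrightarrow> (\<And>i. y (i + N) = y i) \<Longrightarrow> N > 0 \<Longrightarrow> t \<in> {a, b} \<Longrightarrow>
       y i1 = t \<Longrightarrow> \<theta> \<le> \<bar>y i0 - t\<bar> \<Longrightarrow> \<beta> \<le> J f p (p + N - 1) y"
    using periodic_beta[OF assms] by metis
  have "\<beta> - C * \<delta> \<le> J f p q x"
    if x: "inbox a b x" and t: "t \<in> {a, b}" and \<delta>: "0 \<le> \<delta>"
      and cl: "close t \<delta> (p - int r) (p + int r) x" "close t \<delta> (q - int r) (q + int r) x"
      and i: "p \<le> i" "i \<le> q" "\<theta> \<le> \<bar>x i - t\<bar>" for x t p q \<delta> i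
  proof -
    let ?z = "tr p q t t x"
    have z: "inbox a b ?z" "flat t t (p - 1) (q + 1) ?z"
      using x t i ab by (auto intro!: inbox_tr flat_tr)
    obtain y N where y: "inbox a b y" "\<And>i. y (i + N) = y i" "N > 0"
      "p - 1 - int r + N - 1 = q + 1 + int r"
      "En (p - 1) (q + 1) y = En (p - 1) (q + 1) ?z"
      "\<And>j. p - 1 - int r \<le> j \<Longrightarrow> j \<le> q + 1 + int r \<Longrightarrow> y j = ?z j"
      using flat_periodic[OF z] by blast
    have "y (p - 1) = t" "y i = x i"
      using y(6)[of "p - 1"] y(6)[of i] i by (auto simp: tr_def)
    then have "\<beta> \<le> J f (p - 1 - int r) (p - 1 - int r + N - 1) y"
      using i t y(1-3) by (intro \<beta>(2)[of y N t "p - 1" i]) auto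
    then have "\<beta> \<le> En (p - 1) (q + 1) ?z"
      using y(4,5) by simp
    then show ?thesis
      using truncation[OF x t t order_trans[OF i(1,2)] \<delta> cl] by simp
  qed
  then show ?thesis
    using that \<beta>(1) by blast
qed

end

section \<open>Compactness and heteroclinic connections\<close>

text \<open>Competitors have exact end states, so their total energy is a finite sum. By
  \<open>J_ge_at_ends_minval\<close> the infimum also bounds sequences that reach their end states
  only in the limit.\<close>

definition energies where
  "energies f r \<alpha> \<beta> lo hi = {J f (p - int r) (q + int r) z | p q z. between lo hi z \<and> flat \<alpha> \<beta> p q z}"

definition minval where
  "minval f r \<alpha> \<beta> lo hi = Inf (energies f r \<alpha> \<beta> lo hi)"

text \<open>An upper limit, although \<open>J1\<close> is a lower limit: the bound is then available
  on every sufficiently long stretch, where a minimizer can be compared with a modification of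
  itself.\<close>

definition J_le_at_ends :: "((int \<Rightarrow> real) \<Rightarrow> real) \<Rightarrow> real \<Rightarrow> (int \<Rightarrow> real) \<Rightarrow> bool" where
  "J_le_at_ends f c x \<longleftrightarrow> (\<forall>\<epsilon>>0. \<exists>P. \<forall>p\<le>-P. \<forall>q\<ge>P. J f p q x \<le> c + \<epsilon>)"

definition J_ge_at_ends :: "((int \<Rightarrow> real) \<Rightarrow> real) \<Rightarrow> real \<Rightarrow> (int \<Rightarrow> real) \<Rightarrow> bool" where
  "J_ge_at_ends f c x \<longleftrightarrow> (\<forall>\<epsilon>>0. \<exists>P. \<forall>p\<le>-P. \<forall>q\<ge>P. c - \<epsilon> \<le> J f p q x)"

abbreviation homoclinic_minimizer ::
  "((int \<Rightarrow> real) \<Rightarrow> real) \<Rightarrow> nat \<Rightarrow> real \<Rightarrow> (int \<Rightarrow> real) \<Rightarrow> (int \<Rightarrow> real) \<Rightarrow> (int \<Rightarrow> real) \<Rightarrow> bool" where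
  "homoclinic_minimizer f r a lo hi U \<equiv> between lo hi U \<and> (U \<longlongrightarrow> a) at_bot \<and> (U \<longlongrightarrow> a) at_top \<and>
    J_le_at_ends f (minval f r a a lo hi) U"

lemma between_const_iff: "between (\<lambda>_. a) (\<lambda>_. b) = inbox a b"
  by (auto simp: between_def inbox_def fun_eq_iff)

text \<open>Tychonoff's theorem for a product over the countable set of integers, where compactness
  is sequential.\<close>

lemma inbox_subsequence:
  fixes z :: "nat \<Rightarrow> int \<Rightarrow> real"
  assumes z: "\<And>k. inbox a b (z k)"
  obtains x \<sigma> where "strict_mono \<sigma>" "inbox a b x" "\<And>i. (\<lambda>k. z (\<sigma> k) i) \<longlonglongrightarrow> x i"
proof -
  let ?S = "PiE (UNIV :: int set) (\<lambda>_. {a..b})"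
  have "compactin (product_topology (\<lambda>_. euclidean) UNIV) ?S"
    by (rule compactin_PiE[THEN iffD2]) (simp add: compactin_euclidean_iff)
  then have "compact ?S"
    by (simp only: euclidean_product_topology compactin_euclidean_iff)
  then have "seq_compact ?S"
    by (rule compact_imp_seq_compact)
  moreover have "\<forall>k. z k \<in> ?S"
    using z by (simp add: PiE_iff inbox_def)
  ultimately obtain x \<sigma> where x: "x \<in> ?S" "strict_mono \<sigma>" "(z \<circ> \<sigma>) \<longlonglongrightarrow> x"
    unfolding seq_compact_def by metis
  have "(\<lambda>k. z (\<sigma> k) i) \<longlonglongrightarrow> x i" for i
    using continuous_on_tendsto_compose[OF continuous_on_product_coordinates x(3)]
    by (simp add: o_def)
  then show ?thesis
    using that[of \<sigma> x] x by (simp add: PiE_iff inbox_def)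
qed

lemma eventually_notin_finite_int:
  fixes S :: "int set"
  assumes "finite S"
  shows "eventually (\<lambda>i. i \<notin> S) at_bot" "eventually (\<lambda>i. i \<notin> S) at_top"
proof -
  obtain M where M: "\<forall>i\<in>S. \<bar>i\<bar> \<le> M"
    using assms by (metis Max_ge finite_imageI image_eqI)
  show "eventually (\<lambda>i. i \<notin> S) at_bot"
    unfolding eventually_at_bot_linorder using M by (intro exI[of _ "-M - 1"]) force
  show "eventually (\<lambda>i. i \<notin> S) at_top"
    unfolding eventually_at_top_linorder using M by (intro exI[of _ "M + 1"]) force
qed

lemma tendsto_close:
  fixes x :: "int \<Rightarrow> real"
  assumes "0 < \<delta>"
  shows "(x \<longlongrightarrow> t) at_bot \<Longrightarrow> \<exists>P. \<forall>i\<le>P. \<bar>x i - t\<bar> < \<delta>"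
    and "(x \<longlongrightarrow> t) at_top \<Longrightarrow> \<exists>P. \<forall>i\<ge>P. \<bar>x i - t\<bar> < \<delta>"
proof -
  show "\<exists>P. \<forall>i\<le>P. \<bar>x i - t\<bar> < \<delta>" if "(x \<longlongrightarrow> t) at_bot"
    using tendstoD[OF that assms] by (simp add: dist_real_def eventually_at_bot_linorder)
  show "\<exists>P. \<forall>i\<ge>P. \<bar>x i - t\<bar> < \<delta>" if "(x \<longlongrightarrow> t) at_top"
    using tendstoD[OF that assms] by (simp add: dist_real_def eventually_at_top_linorder)
qed

lemma tendsto_at_bot_cong:
  assumes "\<And>i::int. i < p \<Longrightarrow> y i = x i" "(x \<longlongrightarrow> t) at_bot"
  shows "(y \<longlongrightarrow> t) at_bot"
proof -
  have "\<forall>\<^sub>F i in at_bot. x i = y i"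
    unfolding eventually_at_bot_linorder by (intro exI[of _ "p - 1"]) (simp add: assms(1))
  then show ?thesis
    using assms(2) by (rule Lim_transform_eventually[rotated])
qed

lemma tendsto_at_top_cong:
  assumes "\<And>i::int. p < i \<Longrightarrow> y i = x i" "(x \<longlongrightarrow> t) at_top"
  shows "(y \<longlongrightarrow> t) at_top"
proof -
  have "\<forall>\<^sub>F i in at_top. x i = y i"
    unfolding eventually_at_top_linorder by (intro exI[of _ "p + 1"]) (simp add: assms(1))
  then show ?thesis
    using assms(2) by (rule Lim_transform_eventually[rotated])
qed

lemma flat_sh: "flat \<alpha> \<beta> p q z \<Longrightarrow> flat \<alpha> \<beta> (p - m) (q - m) (sh m z)"
  by (auto simp: flat_def sh_def)

context chain begin

lemma between_inbox: "between lo hi z \<Longrightarrow> \<forall>i. a \<le> lo i \<and> hi i \<le> b \<Longrightarrow> inbox a b z"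
  unfolding between_def inbox_def by (meson order_trans)

lemma minval_le:
  assumes "\<forall>i. a \<le> lo i \<and> hi i \<le> b" "between lo hi z" "flat \<alpha> \<beta> p q z"
  shows "minval f r \<alpha> \<beta> lo hi \<le> En p q z"
  unfolding minval_def
proof (rule cInf_lower)
  show "bdd_below (energies f r \<alpha> \<beta> lo hi)"
    by (rule bdd_belowI[of _ "- K"]) (use assms(1) between_inbox J_ge_K in \<open>auto simp: energies_def\<close>)
qed (use assms in \<open>auto simp: energies_def\<close>)

lemma minval_approx:
  assumes "\<forall>i. a \<le> lo i \<and> hi i \<le> b" "between lo hi z" "flat \<alpha> \<beta> p q z" "0 < \<epsilon>"
  obtains p' q' z' where "between lo hi z'" "flat \<alpha> \<beta> p' q' z'"
    "En p' q' z' < minval f r \<alpha> \<beta> lo hi + \<epsilon>"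
proof -
  have "energies f r \<alpha> \<beta> lo hi \<noteq> {}"
    using assms by (auto simp: energies_def)
  then obtain e where "e \<in> energies f r \<alpha> \<beta> lo hi" "e < minval f r \<alpha> \<beta> lo hi + \<epsilon>"
    using cInf_lessD[of "energies f r \<alpha> \<beta> lo hi" "minval f r \<alpha> \<beta> lo hi + \<epsilon>"] assms(4)
    unfolding minval_def by auto
  then show ?thesis
    using that by (auto simp: energies_def)
qed

text \<open>The conditions on \<open>lo\<close> and \<open>hi\<close> outside [p, q] make the
  truncation an admissible competitor.\<close>

lemma J_ge_minval:
  assumes box: "\<forall>i. a \<le> lo i \<and> hi i \<le> b" and x: "between lo hi x"
    and ends: "\<alpha> \<in> {a, b}" "\<beta> \<in> {a, b}" "\<forall>i<p. lo i \<le> \<alpha> \<and> \<alpha> \<le> hi i" "\<forall>i>q. lo i \<le> \<beta> \<and> \<beta> \<le> hi i"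
    and "p \<le> q" "0 \<le> \<delta>"
    and cl: "close \<alpha> \<delta> (p - int r) (p + int r) x" "close \<beta> \<delta> (q - int r) (q + int r) x"
  shows "minval f r \<alpha> \<beta> lo hi - C * \<delta> \<le> J f p q x"
proof -
  have "between lo hi (tr p q \<alpha> \<beta> x)"
    using x ends by (auto simp: between_def tr_def)
  from minval_le[OF box this flat_tr[OF \<open>p \<le> q\<close>]] show ?thesis
    using truncation[OF between_inbox[OF x box] ends(1,2) \<open>p \<le> q\<close> \<open>0 \<le> \<delta>\<close> cl] by simp
qed

lemma J_ge_at_ends_minval:
  assumes box: "\<forall>i. a \<le> lo i \<and> hi i \<le> b" and x: "between lo hi x"
    and ends: "\<alpha> \<in> {a, b}" "\<beta> \<in> {a, b}" "\<forall>i\<le>m. lo i \<le> \<alpha> \<and> \<alpha> \<le> hi i" "\<forall>i\<ge>m'. lo i \<le> \<beta> \<and> \<beta> \<le> hi i"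
    and lim: "(x \<longlongrightarrow> \<alpha>) at_bot" "(x \<longlongrightarrow> \<beta>) at_top"
  shows "J_ge_at_ends f (minval f r \<alpha> \<beta> lo hi) x"
  unfolding J_ge_at_ends_def
proof (intro allI impI)
  fix \<epsilon> :: real assume "0 < \<epsilon>"
  define \<delta> where "\<delta> = \<epsilon> / C"
  have \<delta>: "0 < \<delta>" "C * \<delta> = \<epsilon>"
    using \<open>0 < \<epsilon>\<close> C_pos by (auto simp: \<delta>_def)
  obtain P Q where PQ: "\<forall>i\<le>P. \<bar>x i - \<alpha>\<bar> < \<delta>" "\<forall>i\<ge>Q. \<bar>x i - \<beta>\<bar> < \<delta>"
    using tendsto_close[OF \<delta>(1)] lim by metis
  define R where "R = \<bar>P\<bar> + \<bar>Q\<bar> + \<bar>m\<bar> + \<bar>m'\<bar> + int r + 1"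
  have "minval f r \<alpha> \<beta> lo hi - \<epsilon> \<le> J f p q x" if "p \<le> - R" "q \<ge> R" for p q
    unfolding \<delta>(2)[symmetric]
    by (rule J_ge_minval) (use box x ends PQ \<delta>(1) that in \<open>auto simp: R_def close_def less_imp_le\<close>)
  then show "\<exists>P. \<forall>p\<le>-P. \<forall>q\<ge>P. minval f r \<alpha> \<beta> lo hi - \<epsilon> \<le> J f p q x"
    by blast
qed

lemma J_tendsto:
  assumes z: "\<And>k. inbox a b (z k)" and x: "inbox a b x" and lim: "\<And>i. (\<lambda>k. z k i) \<longlonglongrightarrow> x i"
  shows "(\<lambda>k. J f p q (z k)) \<longlonglongrightarrow> J f p q x"
proof -
  have "(\<lambda>k. L * (\<Sum>i=p - int r..q + int r. \<bar>z k i - x i\<bar>)) \<longlonglongrightarrow> L * (\<Sum>i=p - int r..q + int r. \<bar>x i - x i\<bar>)"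
    by (intro tendsto_mult tendsto_const tendsto_sum tendsto_rabs tendsto_diff lim)
  then have "(\<lambda>k. L * (\<Sum>i=p - int r..q + int r. \<bar>z k i - x i\<bar>)) \<longlonglongrightarrow> 0"
    by simp
  then have "(\<lambda>k. J f p q (z k) - J f p q x) \<longlonglongrightarrow> 0"
    by (rule Lim_null_comparison[rotated]) (simp add: J_Lip[OF z x])
  then show ?thesis
    by (simp add: LIM_zero_iff)
qed

text \<open>The two complementary stretches cannot have energy below -K each.\<close>

lemma J_le_energy:
  assumes z: "inbox a b z" "flat \<alpha> \<beta> p q z" and ends: "\<alpha> \<in> {a, b}" "\<beta> \<in> {a, b}"
  shows "J f p' q' z \<le> En p q z + 2 * K"
proof (cases "p' \<le> q'")
  case True
  define P Q where "P = min p' (p - int r)" and "Q = max q' (q + int r)"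
  have "En p q z = J f P Q z"
    by (rule flat_J_extend[symmetric, OF z ends]) (auto simp: P_def Q_def)
  also have "\<dots> = J f P (p' - 1) z + J f p' q' z + J f (q' + 1) Q z"
    using J_split[of P "p' - 1" Q f z] J_split[of p' q' Q f z] True by (auto simp: P_def Q_def)
  finally show ?thesis
    using J_ge_K[OF z(1), of P "p' - 1"] J_ge_K[OF z(1), of "q' + 1" Q] by simp
next
  case False
  then show ?thesis
    using J_ge_K[OF z(1), of "p - int r" "q + int r"] K_pos by (simp add: J_def)
qed

text \<open>Fixed stretches converge. An outer stretch of \<open>z k\<close> starts near its end
  state and finishes exactly in it, so by \<open>J_hom_0\<close> its energy is at least -(C
  \<delta>): energy may escape to infinity, but no negative energy can.\<close>

lemma lower_semicontinuity:
  assumes z: "\<And>k. inbox a b (z k)" "\<And>k. flat \<alpha> \<beta> (p k) (q k) (z k)" and ends: "\<alpha> \<in> {a, b}" "\<beta> \<in> {a, b}"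
    and e: "\<And>\<epsilon>. 0 < \<epsilon> \<Longrightarrow> \<forall>\<^sub>F k in sequentially. En (p k) (q k) (z k) < c + \<epsilon>"
    and x: "inbox a b x" and lim: "\<And>i. (\<lambda>k. z k i) \<longlonglongrightarrow> x i"
    and lim_ends: "(x \<longlongrightarrow> \<alpha>) at_bot" "(x \<longlongrightarrow> \<beta>) at_top"
  shows "J_le_at_ends f c x"
  unfolding J_le_at_ends_def
proof (intro allI impI)
  fix \<epsilon> :: real assume "0 < \<epsilon>"
  define \<delta> where "\<delta> = \<epsilon> / (4 * C)"
  have \<delta>: "0 < \<delta>" "C * \<delta> = \<epsilon> / 4"
    using \<open>0 < \<epsilon>\<close> C_pos by (auto simp: \<delta>_def)
  obtain P Q where PQ: "\<forall>i\<le>P. \<bar>x i - \<alpha>\<bar> < \<delta>" "\<forall>i\<ge>Q. \<bar>x i - \<beta>\<bar> < \<delta>"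
    using tendsto_close[OF \<delta>(1)] lim_ends by metis
  define R where "R = \<bar>P\<bar> + \<bar>Q\<bar> + int r + 1"
  have "J f p0 q0 x \<le> c + \<epsilon>" if pq0: "p0 \<le> - R" "q0 \<ge> R" for p0 q0
  proof (rule LIMSEQ_le_const2[OF J_tendsto[OF z(1) x lim]])
    have near: "\<forall>\<^sub>F k in sequentially. \<bar>z k i - t\<bar> \<le> \<delta>" if "\<bar>x i - t\<bar> < \<delta>" for i t
    proof -
      have "\<forall>\<^sub>F k in sequentially. \<bar>z k i - t\<bar> < \<delta>"
        by (rule order_tendstoD(2)[OF _ that]) (intro tendsto_intros lim)
      then show ?thesis by eventually_elim simp
    qed
    have "\<forall>\<^sub>F k in sequentially. \<forall>i\<in>{p0 - 1 - int r..p0 - 1 + int r}. \<bar>z k i - \<alpha>\<bar> \<le> \<delta>"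
      by (intro eventually_ball_finite ballI near) (use PQ pq0 in \<open>auto simp: R_def\<close>)
    moreover have "\<forall>\<^sub>F k in sequentially. \<forall>i\<in>{q0 + 1 - int r..q0 + 1 + int r}. \<bar>z k i - \<beta>\<bar> \<le> \<delta>"
      by (intro eventually_ball_finite ballI near) (use PQ pq0 in \<open>auto simp: R_def\<close>)
    moreover have "\<forall>\<^sub>F k in sequentially. En (p k) (q k) (z k) < c + \<epsilon> / 2"
      using e[of "\<epsilon> / 2"] \<open>0 < \<epsilon>\<close> by simp
    ultimately have "\<forall>\<^sub>F k in sequentially. J f p0 q0 (z k) \<le> c + \<epsilon>"
    proof eventually_elim
      case (elim k)
      \<comment> \<open>If a plateau of \<open>z k\<close> reaches into [p0, q0], it is shortened;
        the energy stays the same and both outer stretches become nonempty.\<close>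
      define P' Q' where "P' = min (p k) (p0 - 1)" and "Q' = max (q k) (q0 + 1)"
      have fl: "flat \<alpha> \<beta> P' Q' (z k)"
        using z(2) by (rule flat_mono) (auto simp: P'_def Q'_def)
      have cl: "close \<alpha> \<delta> (P' - int r - int r) (P' - int r + int r) (z k)"
        "close \<beta> \<delta> (Q' + int r - int r) (Q' + int r + int r) (z k)"
        using fl \<delta>(1) by (auto simp: close_def flat_def)
      have "En (p k) (q k) (z k) = En P' Q' (z k)"
        by (rule flat_J_extend[symmetric, OF z ends]) (auto simp: P'_def Q'_def)
      also have "\<dots> = J f (P' - int r) (p0 - 1) (z k) + J f p0 q0 (z k) + J f (q0 + 1) (Q' + int r) (z k)"
        using J_split[of "P' - int r" "p0 - 1" "Q' + int r" f "z k"] J_split[of p0 q0 "Q' + int r" f "z k"]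
          pq0 by (simp add: P'_def Q'_def R_def)
      moreover have "- (C * \<delta>) \<le> J f (P' - int r) (p0 - 1) (z k)"
        by (rule J_hom_0[OF z(1) ends(1)]) (use cl elim \<delta> in \<open>auto simp: close_def P'_def\<close>)
      moreover have "- (C * \<delta>) \<le> J f (q0 + 1) (Q' + int r) (z k)"
        by (rule J_hom_0[OF z(1) ends(2)]) (use cl elim \<delta> in \<open>auto simp: close_def Q'_def\<close>)
      ultimately show ?case
        using elim(3) \<delta>(2) by linarith
    qed
    then show "\<exists>N. \<forall>n\<ge>N. J f p0 q0 (z n) \<le> c + \<epsilon>"
      by (simp add: eventually_sequentially)
  qed
  then show "\<exists>P. \<forall>p\<le>-P. \<forall>q\<ge>P. J f p q x \<le> c + \<epsilon>"
    by blast
qed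

section \<open>End states of limits of bounded energy\<close>

lemma finite_middle:
  assumes x: "inbox a b x" and E: "\<And>p q. J f p q x \<le> E" and "0 < \<theta>"
  shows "finite {i. a + \<theta> \<le> x i \<and> x i \<le> b - \<theta>}" (is "finite ?M")
proof (rule ccontr)
  assume inf: "infinite ?M"
  obtain \<mu> where \<mu>: "0 < \<mu>" "\<And>u. a + \<theta> \<le> u \<Longrightarrow> u \<le> b - \<theta> \<Longrightarrow> \<mu> \<le> g u"
    using g_bound[OF \<open>0 < \<theta>\<close>] by blast
  obtain n :: nat where n: "E + K < n * \<mu>"
    using \<mu>(1) reals_Archimedean3 by blast
  obtain F where F: "F \<subseteq> ?M" "finite F" "card F = n"
    using infinite_arbitrarily_large[OF inf] by blast
  obtain M where M: "\<forall>i\<in>F. \<bar>i\<bar> \<le> M"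
    using F(2) by (metis Max_ge finite_imageI image_eqI)
  have "n * \<mu> = (\<Sum>i\<in>F. \<mu>)"
    using F by simp
  also have "\<dots> \<le> (\<Sum>i\<in>F. g (x i))"
    by (intro sum_mono \<mu>) (use F in auto)
  also have "\<dots> \<le> (\<Sum>i=-M..M. g (x i))"
    by (rule sum_mono2) (use M x g_nonneg in \<open>force simp: inbox_def\<close>)+
  finally show False
    using J_ge[OF x, of "-M" M] E[of "-M" M] n by simp
qed

text \<open>For every precision, all but finitely many terms are near \<open>a\<close> or near
  \<open>b\<close>; the eventual bound excludes one of the two.\<close>

lemma tendsto_side:
  assumes x: "inbox a b x" and fin: "\<And>\<theta>. 0 < \<theta> \<Longrightarrow> finite {i. a + \<theta> \<le> x i \<and> x i \<le> b - \<theta>}"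
    and F: "F \<in> {at_bot, at_top}" and "0 < \<theta>"
  shows "eventually (\<lambda>i. x i < b - \<theta>) F \<Longrightarrow> (x \<longlongrightarrow> a) F"
    and "eventually (\<lambda>i. a + \<theta> < x i) F \<Longrightarrow> (x \<longlongrightarrow> b) F"
proof -
  have mid: "eventually (\<lambda>i. \<not> (a + e \<le> x i \<and> x i \<le> b - e)) F" if "0 < e" for e
    using eventually_notin_finite_int[OF fin[OF that]] F by auto
  have *: "(x \<longlongrightarrow> t) F" if t: "t \<in> {a, b}" and ev: "eventually (\<lambda>i. \<bar>x i - t\<bar> < b - a - \<theta>) F" for t
  proof (rule tendstoI)
    fix e :: real assume "0 < e"
    then have "0 < min e \<theta>" using \<open>0 < \<theta>\<close> by simp
    from mid[OF this] ev show "\<forall>\<^sub>F i in F. dist (x i) t < e"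
    proof eventually_elim
      case (elim i)
      then show ?case
        using inboxD[OF x, of i] t by (auto simp: dist_real_def min_def split: if_splits)
    qed
  qed
  have abs: "\<bar>x i - a\<bar> = x i - a" "\<bar>x i - b\<bar> = b - x i" for i
    using inboxD[OF x, of i] by auto
  show "eventually (\<lambda>i. x i < b - \<theta>) F \<Longrightarrow> (x \<longlongrightarrow> a) F"
    "eventually (\<lambda>i. a + \<theta> < x i) F \<Longrightarrow> (x \<longlongrightarrow> b) F"
    by (rule *; auto simp: abs elim: eventually_mono)+
qed

text \<open>Otherwise the sequence visits both sides again and again, and far out it does so without
  intermediate values, hence by direct jumps in both directions.\<close>

lemma one_sided:
  assumes x: "inbox a b x" and fin: "finite {i. a + \<theta> \<le> x i \<and> x i \<le> b - \<theta>}"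
    and F: "F \<in> {at_bot, at_top}"
    and no: "\<And>i j. x i < a + \<theta> \<Longrightarrow> b - \<theta> < x (i + 1) \<Longrightarrow> b - \<theta> < x j \<Longrightarrow> x (j + 1) < a + \<theta> \<Longrightarrow> False"
  shows "eventually (\<lambda>i. x i < a + \<theta>) F \<or> eventually (\<lambda>i. b - \<theta> < x i) F"
proof (rule ccontr)
  let ?P = "\<lambda>i. x i < a + \<theta>"
  assume "\<not> ?thesis"
  then have n: "\<not> eventually ?P F" "\<not> eventually (\<lambda>i. b - \<theta> < x i) F" by auto
  have mid: "eventually (\<lambda>i. ?P i \<or> b - \<theta> < x i) F"
    using eventually_notin_finite_int[OF fin] F by (auto simp: not_le elim: eventually_mono)
  \<comment> \<open>Low, not low, low in this order: the first change contains a rise and the second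
    a fall.\<close>
  have "\<exists>i1 i2 i3. i1 < i2 \<and> i2 < i3 \<and> ?P i1 \<and> \<not> ?P i2 \<and> ?P i3
      \<and> (\<forall>i\<in>{i1..i3}. ?P i \<or> b - \<theta> < x i)"
    using F
  proof (elim insertE emptyE)
    assume bot: "F = at_bot"
    obtain N where N: "\<forall>i\<le>N. ?P i \<or> b - \<theta> < x i"
      using mid unfolding bot eventually_at_bot_linorder by blast
    have a: "\<exists>i\<le>m. ?P i" if "m \<le> N" for m
      using n(2) N that unfolding bot eventually_at_bot_linorder by (meson order_trans)
    have b: "\<exists>i\<le>m. \<not> ?P i" for m
      using n(1) unfolding bot eventually_at_bot_linorder by blast
    obtain i3 where i3: "i3 \<le> N" "?P i3" using a by blast
    obtain i2 where i2: "i2 \<le> i3" "\<not> ?P i2" using b by blast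
    obtain i1 where i1: "i1 \<le> i2" "?P i1" using a[of i2] i2 i3 by auto
    have "i2 \<noteq> i3" "i1 \<noteq> i2" using i1 i2 i3 by auto
    then show ?thesis
      using i1 i2 i3 N by (intro exI[of _ i1] exI[of _ i2] exI[of _ i3]) auto
  next
    assume top: "F = at_top"
    obtain N where N: "\<forall>i\<ge>N. ?P i \<or> b - \<theta> < x i"
      using mid unfolding top eventually_at_top_linorder by blast
    have a: "\<exists>i\<ge>m. ?P i" if "m \<ge> N" for m
      using n(2) N that unfolding top eventually_at_top_linorder by (meson order_trans)
    have b: "\<exists>i\<ge>m. \<not> ?P i" for m
      using n(1) unfolding top eventually_at_top_linorder by blast
    obtain i1 where i1: "i1 \<ge> N" "?P i1" using a by blast
    obtain i2 where i2: "i2 \<ge> i1" "\<not> ?P i2" using b by blast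
    obtain i3 where i3: "i3 \<ge> i2" "?P i3" using a[of i2] i2 i1 by auto
    have "i2 \<noteq> i3" "i1 \<noteq> i2" using i1 i2 i3 by auto
    then show ?thesis
      using i1 i2 i3 N by (intro exI[of _ i1] exI[of _ i2] exI[of _ i3]) auto
  qed
  then obtain i1 i2 i3 where i: "i1 < i2" "i2 < i3" "?P i1" "\<not> ?P i2" "?P i3"
    and s: "\<forall>i\<in>{i1..i3}. ?P i \<or> b - \<theta> < x i" by blast
  obtain k where k: "i1 \<le> k" "k < i2" "?P k" "\<not> ?P (k + 1)"
    using int_crossing[of ?P i1 i2] i by blast
  obtain l where l: "i2 \<le> l" "l < i3" "\<not> ?P l" "?P (l + 1)"
    by (rule int_crossing[of "\<lambda>i. \<not> ?P i" i2 i3]) (use i in auto)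
  have "b - \<theta> < x (k + 1)" "b - \<theta> < x l"
    using bspec[OF s, of "k + 1"] bspec[OF s, of l] k l i by auto
  from no[OF k(3) this l(4)] show False .
qed

section \<open>Nearly minimal heteroclinic sequences\<close>

abbreviation "c\<^sub>1 \<equiv> minval f r a b (\<lambda>_. a) (\<lambda>_. b)"

lemma c1_le: "inbox a b z \<Longrightarrow> flat a b p q z \<Longrightarrow> c\<^sub>1 \<le> En p q z"
  by (rule minval_le) (auto simp: between_const_iff)

text \<open>A jump up and a jump down of the same configuration can be cancelled against each other by
  passing to the minimum and the maximum with a translate.\<close>

lemma no_double_jump:
  obtains \<eta> where "0 < \<eta>"
    "\<And>z p q i j. inbox a b z \<Longrightarrow> flat a b p q z \<Longrightarrow> En p q z < c\<^sub>1 + \<eta> \<Longrightarrow>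
      z i < a + (b - a) / 4 \<Longrightarrow> b - (b - a) / 4 < z (i + 1) \<Longrightarrow>
      b - (b - a) / 4 < z j \<Longrightarrow> z (j + 1) < a + (b - a) / 4 \<Longrightarrow> False"
proof -
  define h where "h = (b - a) / 2"
  have h: "0 < h" using ab by (simp add: h_def)
  define G where "G = \<kappa> * h * h"
  have G: "0 < G" using \<kappa> h by (simp add: G_def)
  have False
    if z: "inbox a b z" "flat a b p q z" "En p q z < c\<^sub>1 + G / 2"
      and ij: "z i < a + (b - a) / 4" "b - (b - a) / 4 < z (i + 1)"
        "b - (b - a) / 4 < z j" "z (j + 1) < a + (b - a) / 4" for z p q i j
  proof -
    \<comment> \<open>The translation that brings the fall at \<open>j\<close> onto the rise at
      \<open>i\<close>, so that \<open>z\<close> and its translate cross there.\<close>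
    define m where "m = j - i"
    define y where "y = sh m z"
    define P Q where "P = min p (p - m)" and "Q = max q (q - m)"
    have y: "inbox a b y" "flat a b (p - m) (q - m) y"
      using z by (auto simp: y_def intro: inbox_sh flat_sh)
    let ?mi = "\<lambda>i. min (z i) (y i)" and ?ma = "\<lambda>i. max (z i) (y i)"
    have fl: "flat a b P Q z" "flat a b P Q y"
      using z(2) y(2) by (auto simp: P_def Q_def intro: flat_mono)
    then have fl': "flat a b P Q ?mi" "flat a b P Q ?ma"
      by (auto simp: flat_def)
    have w: "inbox a b ?mi" "inbox a b ?ma"
      using inbox_min_max z y by auto
    have i: "i \<in> {P - int r..Q + int r}"
    proof -
      have "z (i + 1) \<noteq> a" "z i \<noteq> b"
        using ij ab by (auto simp: field_simps)
      then have "p < i + 1" "i < q"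
        using z(2) by (auto simp: flat_def not_le[symmetric])
      then show ?thesis by (auto simp: P_def Q_def)
    qed
    have *: "f (sh k ?mi) + f (sh k ?ma) \<le> f (sh k z) + f (sh k y) - (if k = i then G else 0)" for k
    proof -
      have s: "sh k ?mi = (\<lambda>l. min (sh k z l) (sh k y l))" "sh k ?ma = (\<lambda>l. max (sh k z l) (sh k y l))"
        by (auto simp: sh_def)
      have v: "inbox a b (sh k z)" "inbox a b (sh k y)"
        using z y inbox_sh by auto
      show ?thesis
      proof (cases "k = i")
        case True
        have e: "sh k z 0 = z i" "sh k y 0 = z j" "sh k z 1 = z (i + 1)" "sh k y 1 = z (j + 1)"
          by (auto simp: sh_def y_def m_def True algebra_simps)
        have d: "h \<le> z j - z i" "h \<le> z (i + 1) - z (j + 1)"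
          using ij by (auto simp: h_def field_simps)
        have "G \<le> \<kappa> * (z j - z i) * (z (i + 1) - z (j + 1))"
          unfolding G_def using d h \<kappa> by (intro mult_mono) auto
        then show ?thesis
          using strict[OF v, of 1] True d h unfolding s e by simp
      qed (use submod[OF v] s in simp)
    qed
    \<comment> \<open>The minimum and the maximum again connect \<open>a\<close> to \<open>b\<close>
      and cost at least \<open>c\<^sub>1\<close> each; the gain \<open>G\<close> is at least twice
      the excess allowed to \<open>z\<close>.\<close>
    have "En P Q ?mi + En P Q ?ma
        \<le> (\<Sum>k=P - int r..Q + int r. f (sh k z) + f (sh k y) - (if k = i then G else 0))"
      unfolding J_def sum.distrib[symmetric] by (rule sum_mono) (rule *)
    also have "\<dots> = En P Q z + En P Q y - G"
      using i by (simp add: J_def sum.distrib sum_subtractf sum.delta)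
    also have "En P Q z = En p q z"
      by (rule flat_J_extend[OF z(1,2)]) (auto simp: P_def Q_def)
    also have "En P Q y = En p q z"
      by (subst flat_J_extend[OF y]) (auto simp: P_def Q_def y_def J_sh)
    finally show False
      using c1_le[OF w(1) fl'(1)] c1_le[OF w(2) fl'(2)] z(3) by simp
  qed
  then show ?thesis
    using that[of "G / 2"] G by force
qed

text \<open>A window near \<open>b\<close> before the visit to \<open>lev\<close> splits the energy
  into a complete transition and an excursion from \<open>b\<close>, which costs \<beta> extra;
  likewise for a window near \<open>a\<close> after the visit. Windows have 2r + 2 sites so that a
  cut between \<open>w\<close> and \<open>w + 1\<close> leaves a full neighbourhood of radius
  \<open>r\<close> around the end of either piece.\<close>

lemma level_windows:
  assumes lev: "a < lev" "lev < b"
  obtains \<eta> \<delta> where "0 < \<eta>" "0 < \<delta>"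
    "\<And>z p q w. inbox a b z \<Longrightarrow> flat a b p q z \<Longrightarrow> En p q z < c\<^sub>1 + \<eta> \<Longrightarrow>
      z 0 = lev \<Longrightarrow> w < 0 \<Longrightarrow> \<not> close b \<delta> (w - int r) (w + int r + 1) z"
    "\<And>z p q w. inbox a b z \<Longrightarrow> flat a b p q z \<Longrightarrow> En p q z < c\<^sub>1 + \<eta> \<Longrightarrow>
      z 0 = lev \<Longrightarrow> 0 \<le> w \<Longrightarrow> \<not> close a \<delta> (w - int r) (w + int r + 1) z"
proof -
  define \<theta> where "\<theta> = min (lev - a) (b - lev)"
  have \<theta>: "0 < \<theta>" "\<theta> \<le> \<bar>lev - a\<bar>" "\<theta> \<le> \<bar>lev - b\<bar>" using lev by (auto simp: \<theta>_def)
  obtain \<beta> where \<beta>: "0 < \<beta>" "deviation_bound \<theta> \<beta>"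
    using J_hom[OF \<theta>(1)] .
  note \<beta> = \<beta>(1) \<beta>(2)[rule_format]
  \<comment> \<open>The first term keeps two truncation errors below \<beta> / 2; the second keeps a
    window near one state off the plateau of the other.\<close>
  define \<delta> where "\<delta> = min (\<beta> / (4 * C)) ((b - a) / 2)"
  have \<delta>: "0 < \<delta>" "\<delta> < b - a"
    using \<beta>(1) C_pos ab by (auto simp: \<delta>_def min_less_iff_disj)
  have C\<delta>: "C * \<delta> \<le> \<beta> / 4"
  proof -
    have "C * \<delta> \<le> C * (\<beta> / (4 * C))"
      using C_pos by (intro mult_left_mono) (auto simp: \<delta>_def)
    then show ?thesis using C_pos by simp
  qed
  have 1: "\<not> close b \<delta> (w - int r) (w + int r + 1) z"
    if z: "inbox a b z" "flat a b p q z" "En p q z < c\<^sub>1 + \<beta> / 2"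
      and "z 0 = lev" "w < 0" for z p q w
  proof
    assume cl: "close b \<delta> (w - int r) (w + int r + 1) z"
    have w: "p < w" "0 < q"
      using closeD[OF cl, of w] z(2) \<delta> \<open>z 0 = lev\<close> lev by (force simp: flat_def not_le[symmetric])+
    have pq: "close a \<delta> (p - int r - int r) (p - int r + int r) z"
        "close b \<delta> (q + int r - int r) (q + int r + int r) z"
      using z(2) \<delta> by (auto simp: flat_def close_def)
    have "c\<^sub>1 - C * \<delta> \<le> J f (p - int r) w z"
      by (rule J_ge_minval) (use z(1) pq cl w \<delta>(1) ab in \<open>auto simp: between_const_iff close_def\<close>)
    moreover have "\<beta> - C * \<delta> \<le> J f (w + 1) (q + int r) z"
      by (rule \<beta>(2)[of _ b _ _ _ 0]) (use z(1) pq cl w \<delta>(1) \<theta> \<open>z 0 = lev\<close> \<open>w < 0\<close> in \<open>auto simp: close_def\<close>)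
    moreover have "En p q z = J f (p - int r) w z + J f (w + 1) (q + int r) z"
      by (rule J_split) (use w \<open>w < 0\<close> in auto)
    ultimately show False
      using z(3) C\<delta> by linarith
  qed
  have 2: "\<not> close a \<delta> (w - int r) (w + int r + 1) z"
    if z: "inbox a b z" "flat a b p q z" "En p q z < c\<^sub>1 + \<beta> / 2"
      and "z 0 = lev" "0 \<le> w" for z p q w
  proof
    assume cl: "close a \<delta> (w - int r) (w + int r + 1) z"
    have w: "w + 1 < q" "p < 0"
      using closeD[OF cl, of "w + 1"] z(2) \<delta> \<open>z 0 = lev\<close> lev by (force simp: flat_def not_le[symmetric])+
    have pq: "close a \<delta> (p - int r - int r) (p - int r + int r) z"
        "close b \<delta> (q + int r - int r) (q + int r + int r) z"
      using z(2) \<delta> by (auto simp: flat_def close_def)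
    have "c\<^sub>1 - C * \<delta> \<le> J f (w + 1) (q + int r) z"
      by (rule J_ge_minval) (use z(1) pq cl w \<delta>(1) ab in \<open>auto simp: between_const_iff close_def\<close>)
    moreover have "\<beta> - C * \<delta> \<le> J f (p - int r) w z"
      by (rule \<beta>(2)[of _ a _ _ _ 0]) (use z(1) pq cl w \<delta>(1) \<theta> \<open>z 0 = lev\<close> \<open>0 \<le> w\<close> in \<open>auto simp: close_def\<close>)
    moreover have "En p q z = J f (p - int r) w z + J f (w + 1) (q + int r) z"
      by (rule J_split) (use w \<open>0 \<le> w\<close> in auto)
    ultimately show False
      using z(3) C\<delta> by linarith
  qed
  show ?thesis
    using that[of "\<beta> / 2" \<delta>] \<beta>(1) \<delta>(1) 1 2 by auto
qed

text \<open>The energy bound passes to every stretch of the limit, which leaves it finitely many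
  intermediate values. The end states stay undetermined here and have to be identified in each
  application.\<close>

lemma minimizing_limit:
  assumes Z: "\<And>k. inbox a b (Z k)" "\<And>k. flat \<alpha> \<beta> (P k) (Q k) (Z k)"
      "\<And>k. En (P k) (Q k) (Z k) < c + 1 / real (Suc k)"
    and ends: "\<alpha> \<in> {a, b}" "\<beta> \<in> {a, b}"
  obtains \<sigma> x where "inbox a b x" "\<And>i. (\<lambda>k. Z (\<sigma> k) i) \<longlonglongrightarrow> x i"
    "\<And>\<epsilon>. 0 < \<epsilon> \<Longrightarrow>
      \<forall>\<^sub>F k in sequentially. En (P (\<sigma> k)) (Q (\<sigma> k)) (Z (\<sigma> k)) < c + \<epsilon>"
    "\<And>\<theta>. 0 < \<theta> \<Longrightarrow> finite {i. a + \<theta> \<le> x i \<and> x i \<le> b - \<theta>}"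
proof -
  obtain x \<sigma> where \<sigma>: "strict_mono \<sigma>" and x: "inbox a b x" and lim: "\<And>i. (\<lambda>k. Z (\<sigma> k) i) \<longlonglongrightarrow> x i"
    using inbox_subsequence[of a b Z] Z(1) by metis
  have e: "\<forall>\<^sub>F k in sequentially. En (P (\<sigma> k)) (Q (\<sigma> k)) (Z (\<sigma> k)) < c + \<epsilon>"
    if "0 < \<epsilon>" for \<epsilon>
  proof -
    have "(\<lambda>k. c + 1 / real (Suc (\<sigma> k))) \<longlonglongrightarrow> c + 0"
      using LIMSEQ_subseq_LIMSEQ[OF LIMSEQ_inverse_real_of_nat \<sigma>]
      by (intro tendsto_add tendsto_const) (simp add: o_def inverse_eq_divide)
    then have "\<forall>\<^sub>F k in sequentially. c + 1 / real (Suc (\<sigma> k)) < c + \<epsilon>"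
      by (rule order_tendstoD) (use that in simp)
    then show ?thesis
      by eventually_elim (rule less_trans[OF Z(3)])
  qed
  have "finite {i. a + \<theta> \<le> x i \<and> x i \<le> b - \<theta>}" if "0 < \<theta>" for \<theta>
  proof (rule finite_middle[OF x _ that])
    fix p' q'
    show "J f p' q' x \<le> c + 1 + 2 * K"
    proof (rule tendsto_upperbound[OF J_tendsto[OF Z(1) x lim]])
      show "\<forall>\<^sub>F k in sequentially. J f p' q' (Z (\<sigma> k)) \<le> c + 1 + 2 * K"
        using e[OF zero_less_one]
      proof eventually_elim
        case (elim k)
        then show ?case
          using J_le_energy[OF Z(1,2) ends, of p' q' "\<sigma> k"] by simp
      qed
    qed simp
  qed
  then show ?thesis
    using that[of x \<sigma>] x lim e by blast
qed

text \<open>Otherwise there are eventually constant sequences through \<open>lev\<close> with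
  energies tending to the infimum. Translating the visit to site 0 prevents the transition from
  escaping to infinity. In the limit \<open>no_double_jump\<close> excludes oscillation and
  \<open>level_windows\<close> excludes interchanged or equal end states, so the limit is a minimal
  heteroclinic with the excluded value at 0.\<close>

lemma level_gap:
  assumes lev: "a < lev" "lev < b"
    and no: "\<And>x. inbox a b x \<Longrightarrow> x 0 = lev \<Longrightarrow> (x \<longlongrightarrow> a) at_bot \<Longrightarrow> (x \<longlongrightarrow> b) at_top \<Longrightarrow>
      J_le_at_ends f c\<^sub>1 x \<Longrightarrow> False"
  obtains \<eta> where "0 < \<eta>"
    "\<And>z p q i. inbox a b z \<Longrightarrow> flat a b p q z \<Longrightarrow> z i = lev \<Longrightarrow> c\<^sub>1 + \<eta> \<le> En p q z"
proof -
  have "\<exists>\<eta>>0. \<forall>z p q i. inbox a b z \<longrightarrow> flat a b p q z \<longrightarrow> z i = lev \<longrightarrow>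
    c\<^sub>1 + \<eta> \<le> En p q z" (is "\<exists>\<eta>>0. ?gap \<eta>")
  proof (rule ccontr)
    assume contra: "\<not> ?thesis"
    have "\<exists>z p q. inbox a b z \<and> flat a b p q z \<and> z 0 = lev \<and>
        En p q z < c\<^sub>1 + 1 / real (Suc k)" for k
    proof -
      have "0 < 1 / real (Suc k)" by simp
      then have "\<not> ?gap (1 / real (Suc k))"
        using contra by blast
      then obtain z p q i where z: "inbox a b z" "flat a b p q z" "z i = lev"
        "En p q z < c\<^sub>1 + 1 / real (Suc k)"
        unfolding not_le[symmetric] by blast
      have "En (p - i) (q - i) (sh i z) = En p q z"
        by (simp add: J_sh algebra_simps)
      moreover have "sh i z 0 = lev"
        using z by (simp add: sh_def)
      ultimately show ?thesis
        using z inbox_sh[OF z(1), of i] flat_sh[OF z(2), of i] by metis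
    qed
    then obtain Z P Q where Z: "\<And>k. inbox a b (Z k)" "\<And>k. flat a b (P k) (Q k) (Z k)" "\<And>k. Z k 0 = lev"
      "\<And>k. En (P k) (Q k) (Z k) < c\<^sub>1 + 1 / real (Suc k)"
      by metis
    obtain x \<sigma> where x: "inbox a b x" and lim': "\<And>i. (\<lambda>k. Z (\<sigma> k) i) \<longlonglongrightarrow> x i"
      and e': "\<And>\<epsilon>. 0 < \<epsilon> \<Longrightarrow>
        \<forall>\<^sub>F k in sequentially. En (P (\<sigma> k)) (Q (\<sigma> k)) (Z (\<sigma> k)) < c\<^sub>1 + \<epsilon>"
      and fin: "\<And>\<theta>. 0 < \<theta> \<Longrightarrow> finite {i. a + \<theta> \<le> x i \<and> x i \<le> b - \<theta>}"
      by (rule minimizing_limit[OF Z(1,2,4)]) auto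
    define z p q where "z k = Z (\<sigma> k)" and "p k = P (\<sigma> k)" and "q k = Q (\<sigma> k)" for k
    have z: "\<And>k. inbox a b (z k)" "\<And>k. flat a b (p k) (q k) (z k)" "\<And>k. z k 0 = lev"
      and lim: "\<And>i. (\<lambda>k. z k i) \<longlonglongrightarrow> x i"
      and e: "\<And>\<epsilon>. 0 < \<epsilon> \<Longrightarrow> \<forall>\<^sub>F k in sequentially. En (p k) (q k) (z k) < c\<^sub>1 + \<epsilon>"
      using Z lim' e' by (simp_all add: z_def p_def q_def)
    have x0: "x 0 = lev"
      using lim[of 0] z(3) by (simp add: LIMSEQ_const_iff)
    obtain \<eta>1 where \<eta>1: "0 < \<eta>1"
      "\<And>z p q i j. inbox a b z \<Longrightarrow> flat a b p q z \<Longrightarrow> En p q z < c\<^sub>1 + \<eta>1 \<Longrightarrow>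
        z i < a + (b - a) / 4 \<Longrightarrow> b - (b - a) / 4 < z (i + 1) \<Longrightarrow>
        b - (b - a) / 4 < z j \<Longrightarrow> z (j + 1) < a + (b - a) / 4 \<Longrightarrow> False"
      using no_double_jump by metis
    obtain \<eta>2 \<delta> where \<eta>2: "0 < \<eta>2" and \<delta>: "0 < \<delta>"
      "\<And>z p q w. inbox a b z \<Longrightarrow> flat a b p q z \<Longrightarrow> En p q z < c\<^sub>1 + \<eta>2 \<Longrightarrow>
        z 0 = lev \<Longrightarrow> w < 0 \<Longrightarrow> \<not> close b \<delta> (w - int r) (w + int r + 1) z"
      "\<And>z p q w. inbox a b z \<Longrightarrow> flat a b p q z \<Longrightarrow> En p q z < c\<^sub>1 + \<eta>2 \<Longrightarrow>
        z 0 = lev \<Longrightarrow> 0 \<le> w \<Longrightarrow> \<not> close a \<delta> (w - int r) (w + int r + 1) z"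
      using level_windows[OF lev] by metis
    define \<theta> where "\<theta> = min \<delta> ((b - a) / 4)"
    have \<theta>: "0 < \<theta>" "\<theta> \<le> \<delta>" "\<theta> \<le> (b - a) / 4"
      unfolding \<theta>_def using \<delta>(1) ab by (simp_all only: min.cobounded1 min.cobounded2) simp
    have "a + \<theta> < b" using \<theta> ab by (simp add: field_simps)
    have below: "\<forall>\<^sub>F k in sequentially. z k i < t" if "x i < t" for i t
      using order_tendstoD(2)[OF lim that] .
    have above: "\<forall>\<^sub>F k in sequentially. t < z k i" if "t < x i" for i t
      using order_tendstoD(1)[OF lim that] .
    have sided: "eventually (\<lambda>i. x i < a + \<theta>) F \<or> eventually (\<lambda>i. b - \<theta> < x i) F"
      if "F \<in> {at_bot, at_top}" for F
    proof (rule one_sided[OF x fin[OF \<theta>(1)] that])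
      fix i j
      assume ij: "x i < a + \<theta>" "b - \<theta> < x (i + 1)" "b - \<theta> < x j" "x (j + 1) < a + \<theta>"
      have "\<forall>\<^sub>F k in sequentially. False"
        using below[OF ij(1)] above[OF ij(2)] above[OF ij(3)] below[OF ij(4)] e[OF \<eta>1(1)]
      proof eventually_elim
        case (elim k)
        then show ?case
          using \<eta>1(2)[OF z(1,2), of k i j] \<theta>(3) by linarith
      qed
      then show False by simp
    qed
    have bot: "eventually (\<lambda>i. x i < a + \<theta>) at_bot"
    proof (rule ccontr)
      assume "\<not> ?thesis"
      then obtain N where N: "\<forall>i\<le>N. b - \<theta> < x i"
        using sided[of at_bot] unfolding eventually_at_bot_linorder by auto
      \<comment> \<open>Places the whole window to the left of 0 and inside the region where
        \<open>x\<close> is near \<open>b\<close>.\<close>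
      define w where "w = min N 0 - int r - 2"
      have "\<forall>\<^sub>F k in sequentially. \<forall>i\<in>{w - int r..w + int r + 1}. b - \<theta> < z k i"
        by (intro eventually_ball_finite ballI above) (use N in \<open>auto simp: w_def\<close>)
      then have "\<forall>\<^sub>F k in sequentially. False"
        using e[OF \<eta>2]
      proof eventually_elim
        case (elim k)
        have "close b \<delta> (w - int r) (w + int r + 1) (z k)"
          unfolding close_def
        proof
          fix i assume "i \<in> {w - int r..w + int r + 1}"
          then have "b - \<theta> < z k i" using elim by blast
          then show "\<bar>z k i - b\<bar> \<le> \<delta>" using inboxD(2)[OF z(1), of k i] \<theta>(2) by linarith
        qed
        moreover have "w < 0" by (simp add: w_def)
        ultimately show ?case
          using \<delta>(2)[OF z(1,2) elim(2) z(3)] by blast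
      qed
      then show False by simp
    qed
    have top: "eventually (\<lambda>i. b - \<theta> < x i) at_top"
    proof (rule ccontr)
      assume "\<not> ?thesis"
      then obtain N where N: "\<forall>i\<ge>N. x i < a + \<theta>"
        using sided[of at_top] unfolding eventually_at_top_linorder by auto
      define w where "w = max N 0 + int r"
      have "\<forall>\<^sub>F k in sequentially. \<forall>i\<in>{w - int r..w + int r + 1}. z k i < a + \<theta>"
        by (intro eventually_ball_finite ballI below) (use N in \<open>auto simp: w_def\<close>)
      then have "\<forall>\<^sub>F k in sequentially. False"
        using e[OF \<eta>2]
      proof eventually_elim
        case (elim k)
        have "close a \<delta> (w - int r) (w + int r + 1) (z k)"
          unfolding close_def
        proof
          fix i assume "i \<in> {w - int r..w + int r + 1}"
          then have "z k i < a + \<theta>" using elim by blast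
          then show "\<bar>z k i - a\<bar> \<le> \<delta>" using inboxD(1)[OF z(1), of k i] \<theta>(2) by linarith
        qed
        moreover have "0 \<le> w" by (simp add: w_def)
        ultimately show ?case
          using \<delta>(3)[OF z(1,2) elim(2) z(3)] by blast
      qed
      then show False by simp
    qed
    have "a + \<theta> \<le> b - \<theta>" using \<theta>(3) ab by (simp add: field_simps)
    have lims: "(x \<longlongrightarrow> a) at_bot" "(x \<longlongrightarrow> b) at_top"
    proof -
      show "(x \<longlongrightarrow> a) at_bot"
        by (rule tendsto_side(1)[OF x fin _ \<theta>(1)])
           (use bot \<open>a + \<theta> \<le> b - \<theta>\<close> in \<open>auto elim: eventually_mono\<close>)
      show "(x \<longlongrightarrow> b) at_top"
        by (rule tendsto_side(2)[OF x fin _ \<theta>(1)])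
           (use top \<open>a + \<theta> \<le> b - \<theta>\<close> in \<open>auto elim: eventually_mono\<close>)
    qed
    have "J_le_at_ends f c\<^sub>1 x"
      by (rule lower_semicontinuity[OF z(1,2) _ _ e x lim lims]) auto
    then show False
      using no[OF x x0 lims] by blast
  qed
  then show ?thesis
    using that by blast
qed

end

section \<open>Constrained minimizers\<close>

context chain begin

text \<open>By \<open>J_ge\<close> the energy bounds the number of sites that are \<delta>' away
  from both \<open>a\<close> and \<open>b\<close> by some n. Among n disjoint windows one is free of
  them, whence the length n(2r + 2); the bound \<rho> < b - a forces that window to the side of
  \<open>t\<close>.\<close>

lemma window:
  assumes "0 < \<delta>" "\<rho> < b - a"
  obtains l0 :: nat where
    "\<And>x t p q. inbox a b x \<Longrightarrow> t \<in> {a, b} \<Longrightarrow> J f p q x \<le> E \<Longrightarrow> p + int l0 \<le> q + 1 \<Longrightarrow>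
      close t \<rho> p q x \<Longrightarrow>
      \<exists>w. p \<le> w - int r \<and> w + int r + 1 \<le> q \<and> close t \<delta> (w - int r) (w + int r + 1) x"
proof -
  \<comment> \<open>A value at most \<rho> from \<open>t\<close> is at least b - a - \<rho> from the
    other ground state.\<close>
  define \<delta>' where "\<delta>' = min \<delta> (b - a - \<rho>)"
  have \<delta>': "0 < \<delta>'" "\<delta>' \<le> \<delta>" "\<delta>' \<le> b - a - \<rho>"
    using assms by (auto simp: \<delta>'_def)
  obtain \<mu> where \<mu>: "0 < \<mu>" "\<And>u. a + \<delta>' \<le> u \<Longrightarrow> u \<le> b - \<delta>' \<Longrightarrow> \<mu> \<le> g u"
    using g_bound[OF \<delta>'(1)] by blast
  obtain n :: nat where n: "E + K < n * \<mu>"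
    using \<mu>(1) reals_Archimedean3 by blast
  define m where "m = 2 * int r + 2"
  have m: "0 < m" by (simp add: m_def)
  have "\<exists>w. p \<le> w - int r \<and> w + int r + 1 \<le> q \<and> close t \<delta> (w - int r) (w + int r + 1) x"
    if x: "inbox a b x" and t: "t \<in> {a, b}" and E: "J f p q x \<le> E" and l: "p + int n * m \<le> q + 1"
      and cl: "close t \<rho> p q x" for x t p q
  proof (rule ccontr)
    assume no: "\<not> ?thesis"
    have "\<exists>i. p + int k * m \<le> i \<and> i < p + int (Suc k) * m \<and> \<mu> \<le> g (x i)" if k: "k < n" for k
    proof -
      have "int (Suc k) * m \<le> int n * m"
        using k m by (intro mult_right_mono) auto
      then have bd: "p + int (Suc k) * m \<le> q + 1" using l by simp
      define w where "w = p + int k * m + int r"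
      have w: "w - int r = p + int k * m" "w + int r + 1 = p + int (Suc k) * m - 1"
        by (simp_all add: w_def m_def algebra_simps)
      have pq: "p \<le> w - int r" "w + int r + 1 \<le> q"
        using m bd unfolding w by simp_all
      then have "\<not> close t \<delta> (w - int r) (w + int r + 1) x"
        using no by blast
      then obtain i where i: "w - int r \<le> i" "i \<le> w + int r + 1" "\<delta> < \<bar>x i - t\<bar>"
        by (auto simp: close_def not_le)
      have "\<bar>x i - t\<bar> \<le> \<rho>"
        using closeD[OF cl] pq i by simp
      then have "a + \<delta>' \<le> x i" "x i \<le> b - \<delta>'"
        using t i \<delta>' inboxD[OF x, of i] by (auto simp: abs_if split: if_splits)
      then show ?thesis
        using \<mu>(2) i unfolding w by (intro exI[of _ i]) auto
    qed
    then obtain i where i: "\<And>k. k < n \<Longrightarrow> p + int k * m \<le> i k" "\<And>k. k < n \<Longrightarrow> i k < p + int (Suc k) * m"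
      "\<And>k. k < n \<Longrightarrow> \<mu> \<le> g (x (i k))" by metis
    have "(i k - p) div m = int k" if "k < n" for k
    proof (rule int_div_pos_eq[where r = "i k - p - int k * m"])
      show "i k - p = m * int k + (i k - p - int k * m)" by simp
      show "0 \<le> i k - p - int k * m" "i k - p - int k * m < m"
        using i(1,2)[OF that] by (auto simp: algebra_simps)
    qed
    then have inj: "inj_on i {..<n}"
      by (intro inj_onI) (metis lessThan_iff of_nat_eq_iff)
    have sub: "i ` {..<n} \<subseteq> {p..q}"
    proof
      fix j assume "j \<in> i ` {..<n}"
      then obtain k where k: "k < n" "j = i k" by blast
      have "int (Suc k) * m \<le> int n * m" "0 \<le> int k * m"
        using k m by (auto intro: mult_right_mono)
      then show "j \<in> {p..q}"
        using i(1,2)[OF k(1)] k(2) l by auto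
    qed
    have "n * \<mu> = (\<Sum>k<n. \<mu>)" by simp
    also have "\<dots> \<le> (\<Sum>k<n. g (x (i k)))"
      by (intro sum_mono) (use i in auto)
    also have "\<dots> = (\<Sum>j\<in>i ` {..<n}. g (x j))"
      using inj by (simp add: sum.reindex)
    also have "\<dots> \<le> (\<Sum>j=p..q. g (x j))"
      by (rule sum_mono2) (use sub x g_nonneg in \<open>auto simp: inbox_def\<close>)
    finally show False
      using J_ge[OF x, of p q] E n by simp
  qed
  then show ?thesis
    using that[of "n * nat m"] m by simp
qed

text \<open>A minimizing configuration that is close to \<open>a\<close> on a window cannot leave \<open>a\<close> on the far side
  of the window: cutting it off there would save the energy of a homoclinic.\<close>

lemma quiet_left:
  assumes box: "\<forall>i. a \<le> lo i \<and> lo i \<le> hi i \<and> hi i \<le> b" and z: "between lo hi z" "flat a a p q z"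
    and cl: "close a \<delta> (w - int r) (w + int r + 1) z" and "0 \<le> \<delta>" "p \<le> w" "w < q"
    and lo: "\<forall>i\<le>w. lo i = a" and \<beta>: "\<beta> - C * \<delta> \<le> J f (p - int r) w z"
  shows "minval f r a a lo hi + \<beta> - 2 * C * \<delta> \<le> En p q z"
proof -
  have cl': "close a \<delta> (q + int r - int r) (q + int r + int r) z"
    using z(2) \<open>0 \<le> \<delta>\<close> by (auto simp: flat_def close_def)
  have lo': "lo i = a" if "q + int r < i" for i
  proof -
    have "z i = a" using z(2) that by (simp add: flat_def)
    then show ?thesis using z(1) box by (metis between_def order_antisym)
  qed
  have "minval f r a a lo hi - C * \<delta> \<le> J f (w + 1) (q + int r) z"
    by (rule J_ge_minval)
       (use box z cl cl' lo lo' \<open>w < q\<close> \<open>0 \<le> \<delta>\<close> in \<open>auto simp: close_def intro: order_trans\<close>)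
  moreover have "0 \<le> C * \<delta>" using C_pos \<open>0 \<le> \<delta>\<close> by simp
  moreover have "En p q z = J f (p - int r) w z + J f (w + 1) (q + int r) z"
    by (rule J_split) (use \<open>p \<le> w\<close> \<open>w < q\<close> in auto)
  ultimately show ?thesis
    using \<beta> by linarith
qed

text \<open>The mirror image of \<open>quiet_left\<close>: the excursion to the right of the window
  is cut off.\<close>

lemma quiet_right:
  assumes box: "\<forall>i. a \<le> lo i \<and> lo i \<le> hi i \<and> hi i \<le> b" and z: "between lo hi z" "flat a a p q z"
    and cl: "close a \<delta> (w - int r) (w + int r + 1) z" and "0 \<le> \<delta>" "p \<le> w" "w \<le> q"
    and lo: "\<forall>i>w. lo i = a" and \<beta>: "\<beta> - C * \<delta> \<le> J f (w + 1) (q + int r) z"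
  shows "minval f r a a lo hi + \<beta> - 2 * C * \<delta> \<le> En p q z"
proof -
  have cl': "close a \<delta> (p - int r - int r) (p - int r + int r) z"
    using z(2) \<open>0 \<le> \<delta>\<close> by (auto simp: flat_def close_def)
  have lo': "lo i = a" if "i < p - int r" for i
  proof -
    have "z i = a" using z(2) that by (simp add: flat_def)
    then show ?thesis using z(1) box by (metis between_def order_antisym)
  qed
  have "minval f r a a lo hi - C * \<delta> \<le> J f (p - int r) w z"
    by (rule J_ge_minval)
       (use box z cl cl' lo lo' \<open>p \<le> w\<close> \<open>0 \<le> \<delta>\<close> in \<open>auto simp: close_def intro: order_trans\<close>)
  moreover have "0 \<le> C * \<delta>" using C_pos \<open>0 \<le> \<delta>\<close> by simp
  moreover have "En p q z = J f (p - int r) w z + J f (w + 1) (q + int r) z"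
    by (rule J_split) (use \<open>p \<le> w\<close> \<open>w \<le> q\<close> in auto)
  ultimately show ?thesis
    using \<beta> by linarith
qed

text \<open>Bounded energy forces a window near \<open>a\<close> into each of the two blocks, and by
  \<open>quiet_left\<close> and \<open>quiet_right\<close> nearly minimal sequences stay below a +
  \<theta> beyond the blocks. This bound survives the limit and makes \<open>a\<close> the end state
  on both sides. The length \<open>l0\<close> depends on \<rho> and on the energy \<open>E\<close>
  of one competitor, not on the position of the blocks.\<close>

lemma existence:
  assumes "\<rho> < b - a"
  obtains l0 :: nat where
    "\<And>lo hi \<alpha> \<alpha>' l z0 p0 q0. l0 \<le> l \<Longrightarrow> \<forall>i. a \<le> lo i \<and> lo i \<le> hi i \<and> hi i \<le> b \<Longrightarrow>
      \<forall>i<\<alpha> + int l. lo i = a \<Longrightarrow> \<forall>i\<in>{\<alpha>..<\<alpha> + int l}. hi i \<le> a + \<rho> \<Longrightarrow>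
      \<forall>i\<ge>\<alpha>'. lo i = a \<Longrightarrow> \<forall>i\<in>{\<alpha>'..<\<alpha>' + int l}. hi i \<le> a + \<rho> \<Longrightarrow>
      between lo hi z0 \<Longrightarrow> flat a a p0 q0 z0 \<Longrightarrow> En p0 q0 z0 \<le> E \<Longrightarrow>
      \<exists>U. homoclinic_minimizer f r a lo hi U"
proof -
  define \<theta> where "\<theta> = (b - a) / 4"
  have \<theta>: "0 < \<theta>" "a + \<theta> < b - \<theta>" using ab by (auto simp: \<theta>_def field_simps)
  obtain \<beta> where \<beta>: "0 < \<beta>" "deviation_bound \<theta> \<beta>"
    using J_hom[OF \<theta>(1)] .
  note \<beta> = \<beta>(1) \<beta>(2)[rule_format]
  \<comment> \<open>Two cutting errors then amount to \<beta> / 2, so an excursion beyond the blocks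
    leaves an excess of \<beta> / 2 over the infimum.\<close>
  define \<delta> where "\<delta> = \<beta> / (4 * C)"
  have \<delta>: "0 < \<delta>" "C * \<delta> = \<beta> / 4" using \<beta>(1) C_pos by (auto simp: \<delta>_def)
  obtain l0 :: nat where l0:
    "\<And>x t p q. inbox a b x \<Longrightarrow> t \<in> {a, b} \<Longrightarrow> J f p q x \<le> E + 1 + 2 * K \<Longrightarrow> p + int l0 \<le> q + 1 \<Longrightarrow>
      close t \<rho> p q x \<Longrightarrow>
      \<exists>w. p \<le> w - int r \<and> w + int r + 1 \<le> q \<and> close t \<delta> (w - int r) (w + int r + 1) x"
    using window[OF \<delta>(1) assms] by metis
  have main: "\<exists>U. homoclinic_minimizer f r a lo hi U"
    if l: "l0 \<le> l" and box: "\<forall>i. a \<le> lo i \<and> lo i \<le> hi i \<and> hi i \<le> b"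
      and \<alpha>: "\<forall>i<\<alpha> + int l. lo i = a" "\<forall>i\<in>{\<alpha>..<\<alpha> + int l}. hi i \<le> a + \<rho>"
      and \<alpha>': "\<forall>i\<ge>\<alpha>'. lo i = a" "\<forall>i\<in>{\<alpha>'..<\<alpha>' + int l}. hi i \<le> a + \<rho>"
      and z0: "between lo hi z0" "flat a a p0 q0 z0" "En p0 q0 z0 \<le> E"
    for lo hi \<alpha> \<alpha>' l z0 p0 q0
  proof -
    let ?B = "minval f r a a lo hi"
    have box': "\<forall>i. a \<le> lo i \<and> hi i \<le> b" using box by blast
    have BE: "?B \<le> E"
      using minval_le[OF box' z0(1,2)] z0(3) by simp
    have "\<exists>z p q. between lo hi z \<and> flat a a p q z \<and>
        En p q z < ?B + 1 / real (Suc k)" for k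
      using minval_approx[OF box' z0(1,2), of "1 / real (Suc k)"] by (metis of_nat_0_less_iff zero_less_Suc zero_less_divide_1_iff)
    then obtain Z P Q where Z: "\<And>k. between lo hi (Z k)" "\<And>k. flat a a (P k) (Q k) (Z k)"
      "\<And>k. En (P k) (Q k) (Z k) < ?B + 1 / real (Suc k)"
      by metis
    have Zin: "inbox a b (Z k)" for k
      using between_inbox[OF Z(1) box'] .
    obtain x \<sigma> where x: "inbox a b x" and lim: "\<And>i. (\<lambda>k. Z (\<sigma> k) i) \<longlonglongrightarrow> x i"
      and e: "\<And>\<epsilon>. 0 < \<epsilon> \<Longrightarrow>
        \<forall>\<^sub>F k in sequentially. En (P (\<sigma> k)) (Q (\<sigma> k)) (Z (\<sigma> k)) < ?B + \<epsilon>"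
      and fin: "\<And>\<theta>. 0 < \<theta> \<Longrightarrow> finite {i. a + \<theta> \<le> x i \<and> x i \<le> b - \<theta>}"
      by (rule minimizing_limit[OF Zin Z(2,3)]) auto
    have bx: "between lo hi x"
      unfolding between_def
    proof (intro allI conjI)
      fix i
      show "lo i \<le> x i"
        by (rule LIMSEQ_le_const[OF lim]) (use Z(1) in \<open>auto simp: between_def\<close>)
      show "x i \<le> hi i"
        by (rule LIMSEQ_le_const2[OF lim]) (use Z(1) in \<open>auto simp: between_def\<close>)
    qed
    have win: "\<exists>w. p \<le> w - int r \<and> w + int r + 1 < p + int l \<and> close a \<delta> (w - int r) (w + int r + 1) z"
      if z: "between lo hi z" "flat a a P Q z" "En P Q z < ?B + 1"
        and p: "\<forall>i\<in>{p..<p + int l}. hi i \<le> a + \<rho>" for z P Q p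
    proof -
      have zin: "inbox a b z" using between_inbox[OF z(1) box'] .
      have "close a \<rho> p (p + int l - 1) z"
        unfolding close_def
      proof
        fix i assume "i \<in> {p..p + int l - 1}"
        then have "hi i \<le> a + \<rho>" using p by simp
        then have "z i \<le> a + \<rho>" using z(1) by (meson between_def order_trans)
        then show "\<bar>z i - a\<bar> \<le> \<rho>" using inboxD[OF zin, of i] by simp
      qed
      moreover have "J f p (p + int l - 1) z \<le> E + 1 + 2 * K"
        using J_le_energy[OF zin z(2), of p "p + int l - 1"] z(3) BE by simp
      ultimately have "\<exists>w. p \<le> w - int r \<and> w + int r + 1 \<le> p + int l - 1 \<and>
          close a \<delta> (w - int r) (w + int r + 1) z"
        by (intro l0[OF zin]) (use l in auto)
      then show ?thesis by force
    qed
    have low: "z i < a + \<theta>"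
      if z: "between lo hi z" "flat a a P Q z" "En P Q z < ?B + min 1 (\<beta> / 2)"
        and i: "i < \<alpha> \<or> \<alpha>' + int l \<le> i" for z P Q i
    proof (rule ccontr)
      assume contra: "\<not> z i < a + \<theta>"
      have zin: "inbox a b z" using between_inbox[OF z(1) box'] .
      define s where "s = (if i < \<alpha> then \<alpha> else \<alpha>')"
      have "En P Q z < ?B + 1" "\<forall>i\<in>{s..<s + int l}. hi i \<le> a + \<rho>"
        using z(3) \<alpha>(2) \<alpha>'(2) by (simp_all add: s_def)
      from win[OF z(1,2) this] obtain w where w: "s \<le> w - int r" "w + int r + 1 < s + int l"
        "close a \<delta> (w - int r) (w + int r + 1) z"
        by blast
      \<comment> \<open>Shortening the plateaus makes the cut at \<open>w\<close> lie between them
        without changing the energy.\<close>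
      define P' Q' where "P' = min P w" and "Q' = max Q (w + 1)"
      have fl: "flat a a P' Q' z" "P' \<le> w" "w < Q'"
        using z(2) by (auto simp: P'_def Q'_def intro: flat_mono)
      have E: "En P' Q' z < ?B + \<beta> / 2"
        using z(3) by (subst flat_J_extend[OF zin z(2)]) (auto simp: P'_def Q'_def)
      have ends: "close a \<delta> (P' - int r - int r) (P' - int r + int r) z"
        "close a \<delta> (Q' + int r - int r) (Q' + int r + int r) z"
        using fl \<delta>(1) by (auto simp: flat_def close_def)
      have PQ: "P' < i" "i < Q'"
        using contra fl(1) \<theta>(1) by (auto simp: flat_def not_le[symmetric])
      have far: "\<theta> \<le> \<bar>z i - a\<bar>" using contra by simp
      have wcl: "close a \<delta> (w - int r) (w + int r) z" "close a \<delta> (w + 1 - int r) (w + 1 + int r) z"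
        using w(3) by (auto simp: close_def)
      have "?B + \<beta> - 2 * C * \<delta> \<le> En P' Q' z"
      proof (cases "i < \<alpha>")
        case True
        have "\<beta> - C * \<delta> \<le> J f (P' - int r) w z"
          by (rule \<beta>(2)[OF zin _ _ ends(1) wcl(1) _ _ far]) (use PQ True w \<delta>(1) in \<open>auto simp: s_def\<close>)
        then show ?thesis
          by (intro quiet_left[OF box z(1) fl(1) w(3) _ fl(2,3)]) (use \<delta>(1) \<alpha>(1) w True in \<open>auto simp: s_def\<close>)
      next
        case False
        have "\<beta> - C * \<delta> \<le> J f (w + 1) (Q' + int r) z"
          by (rule \<beta>(2)[OF zin _ _ wcl(2) ends(2) _ _ far]) (use PQ False i w \<delta>(1) in \<open>auto simp: s_def\<close>)
        then show ?thesis
          by (intro quiet_right[OF box z(1) fl(1) w(3) _ fl(2) less_imp_le[OF fl(3)]]) (use \<delta>(1) \<alpha>'(1) w False in \<open>auto simp: s_def\<close>)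
      qed
      then show False
        using E \<delta>(2) by (simp add: algebra_simps)
    qed
    have xlow: "x i \<le> a + \<theta>" if i: "i < \<alpha> \<or> \<alpha>' + int l \<le> i" for i
    proof (rule tendsto_upperbound[OF lim])
      have "0 < min 1 (\<beta> / 2)" using \<beta>(1) by simp
      from e[OF this] show "\<forall>\<^sub>F k in sequentially. Z (\<sigma> k) i \<le> a + \<theta>"
        by eventually_elim (use low[OF Z(1,2) _ i] in \<open>auto intro: less_imp_le\<close>)
    qed simp
    have xlow': "x i < b - \<theta>" if "i < \<alpha> \<or> \<alpha>' + int l \<le> i" for i
      using xlow[OF that] \<theta>(2) by simp
    have lims: "(x \<longlongrightarrow> a) at_bot" "(x \<longlongrightarrow> a) at_top"
    proof -
      have "\<forall>\<^sub>F i in at_bot. x i < b - \<theta>"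
        unfolding eventually_at_bot_linorder
        by (rule exI[of _ "\<alpha> - 1"]) (use xlow' in auto)
      then show "(x \<longlongrightarrow> a) at_bot"
        by (intro tendsto_side(1)[OF x fin _ \<theta>(1)]) auto
      have "\<forall>\<^sub>F i in at_top. x i < b - \<theta>"
        unfolding eventually_at_top_linorder
        by (rule exI[of _ "\<alpha>' + int l"]) (use xlow' in auto)
      then show "(x \<longlongrightarrow> a) at_top"
        by (intro tendsto_side(1)[OF x fin _ \<theta>(1)]) auto
    qed
    have "J_le_at_ends f ?B x"
      by (rule lower_semicontinuity[OF Zin Z(2) _ _ e x lim lims]) auto
    then show ?thesis
      using bx lims by blast
  qed
  show ?thesis
    by (rule that[of l0]) (rule main)
qed

section \<open>Replacing pieces of a constrained minimizer\<close>

lemma J_le_at_ends_bound: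
  assumes x: "inbox a b x" and le: "J_le_at_ends f c x"
  shows "J f p q x \<le> c + 1 + 2 * K"
proof (cases "p \<le> q")
  case True
  obtain P where P: "\<forall>p\<le>-P. \<forall>q\<ge>P. J f p q x \<le> c + 1"
    using le unfolding J_le_at_ends_def by (meson zero_less_one)
  define R where "R = max P (\<bar>p\<bar> + \<bar>q\<bar>)"
  have "J f (- R) R x \<le> c + 1" using P by (simp add: R_def)
  moreover have "J f (- R) R x = J f (- R) (p - 1) x + J f p q x + J f (q + 1) R x"
    using J_split[of "- R" "p - 1" R f x] J_split[of p q R f x] True by (simp add: R_def)
  ultimately show ?thesis
    using J_ge_K[OF x, of "- R" "p - 1"] J_ge_K[OF x, of "q + 1" R] by simp
next
  case False
  obtain P where P: "\<forall>p\<le>-P. \<forall>q\<ge>P. J f p q x \<le> c + 1"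
    using le unfolding J_le_at_ends_def by (meson zero_less_one)
  have "J f (- P) P x \<le> c + 1" using P by simp
  then show ?thesis
    using J_ge_K[OF x, of "- P" P] K_pos False by (simp add: J_def)
qed

text \<open>The bounds for \<open>U\<close> and \<open>Z\<close> hold up to an arbitrary error on
  long stretches, so the improvement has to be by a fixed \<gamma> on all of them.\<close>

lemma no_improvement:
  assumes "J_le_at_ends f c U" "J_ge_at_ends f c Z" "0 < \<gamma>"
    and better: "\<And>p q. p \<le> - P \<Longrightarrow> P \<le> q \<Longrightarrow> J f p q Z + \<gamma> \<le> J f p q U"
  shows False
proof -
  have "0 < \<gamma> / 4" using assms(3) by simp
  then obtain P1 P2 where "\<forall>p\<le>-P1. \<forall>q\<ge>P1. J f p q U \<le> c + \<gamma> / 4"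
    "\<forall>p\<le>-P2. \<forall>q\<ge>P2. c - \<gamma> / 4 \<le> J f p q Z"
    using assms(1,2) unfolding J_le_at_ends_def J_ge_at_ends_def by metis
  moreover define R where "R = max P (max P1 P2)"
  ultimately have "J f (- R) R U \<le> c + \<gamma> / 4" "c - \<gamma> / 4 \<le> J f (- R) R Z" by simp_all
  then show False
    using better[of "- R" R] assms(3) by (simp add: R_def)
qed

text \<open>Up to the window at \<open>w\<close> the minimizer performs a transition through a
  forbidden level, which costs at least \<open>c\<^sub>1 + \<eta>\<close> up to the truncation
  error. It is replaced by the cheaper transition \<open>y\<close>, moved into the free room between
  \<open>m\<close> and \<open>m + M\<close>; the pieces fit at \<open>w\<close>, where both are near
  \<open>b\<close>.\<close>

lemma left_inactive:
  assumes box: "\<forall>i. a \<le> lo i \<and> lo i \<le> hi i \<and> hi i \<le> b" and U: "between lo hi U"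
    and lim: "(U \<longlongrightarrow> a) at_bot" "(U \<longlongrightarrow> a) at_top" and le: "J_le_at_ends f (minval f r a a lo hi) U"
    and far: "\<forall>i\<ge>e. lo i = a"
    and gap: "\<And>z p q i. inbox a b z \<Longrightarrow> flat a b p q z \<Longrightarrow> z i = lev \<Longrightarrow>
      c\<^sub>1 + \<eta> \<le> En p q z" and "0 < \<eta>"
    and y: "inbox a b y" "flat a b 0 M y" "En 0 M y \<le> c\<^sub>1 + \<eta> / 4"
    and cl: "close b \<delta> (w - int r) (w + int r + 1) U" and \<delta>: "0 < \<delta>" "C * \<delta> \<le> \<eta> / 16"
    and m: "m + M \<le> w - int r" "\<forall>i<m + M. lo i = a" "\<forall>i. m < i \<and> i \<le> w \<longrightarrow> hi i = b"
    and i: "i \<le> w" "U i = lev"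
  shows False
proof -
  have box': "\<forall>i. a \<le> lo i \<and> hi i \<le> b" using box by blast
  have Uin: "inbox a b U" using between_inbox[OF U box'] .
  have M: "0 \<le> M" using y(2) by (simp add: flat_def)
  define y' where "y' = sh (- m) y"
  have y': "inbox a b y'" "flat a b m (m + M) y'"
    using y flat_sh[OF y(2), of "- m"] by (auto simp: y'_def add.commute intro: inbox_sh)
  define Z where "Z = (\<lambda>i. if i \<le> w then y' i else U i)"
  have Zin: "inbox a b Z" using y'(1) Uin by (simp add: inbox_def Z_def)
  have bZ: "between lo hi Z"
    unfolding between_def
  proof
    fix i
    consider "w < i" | "i \<le> w" "i \<le> m" | "i \<le> w" "m < i" "i < m + M" | "i \<le> w" "m + M \<le> i" by linarith
    then show "lo i \<le> Z i \<and> Z i \<le> hi i"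
    proof cases
      case 1 then show ?thesis using U by (simp add: between_def Z_def)
    next
      case 2
      then have "Z i = a" using y'(2) by (simp add: Z_def flat_def)
      \<comment> \<open>The only doubtful site is \<open>i = m\<close> with \<open>M = 0\<close>,
        where \<open>y'\<close> would have to equal both \<open>a\<close> and
        \<open>b\<close>.\<close>
      moreover have "lo i = a"
      proof (cases "i < m + M")
        case False
        then have "M = 0" "i = m" using 2 M by auto
        then have "y' i = b" "y' i = a" using y'(2) by (auto simp: flat_def)
        then show ?thesis using ab by simp
      qed (use m in auto)
      ultimately show ?thesis using box by (metis order_refl)
    next
      case 3
      then have "lo i = a" "hi i = b" using m by auto
      then show ?thesis using inboxD[OF Zin, of i] by simp
    next
      case 4
      then have "Z i = b" using y'(2) by (simp add: Z_def flat_def)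
      moreover have "m \<noteq> i"
      proof
        assume "m = i"
        then have "y' i = b" "y' i = a" using 4 M y'(2) by (auto simp: flat_def)
        then show False using ab by simp
      qed
      then have "hi i = b" using m(3) 4 M by auto
      ultimately show ?thesis using box by (metis order_refl order_trans)
    qed
  qed
  have limZ: "(Z \<longlongrightarrow> a) at_bot" "(Z \<longlongrightarrow> a) at_top"
  proof -
    show "(Z \<longlongrightarrow> a) at_bot"
      by (rule tendsto_at_bot_cong[of "min m w", OF _ tendsto_const])
         (use y'(2) in \<open>auto simp: Z_def flat_def\<close>)
    show "(Z \<longlongrightarrow> a) at_top"
      by (rule tendsto_at_top_cong[of w, OF _ lim(2)]) (simp add: Z_def)
  qed
  have lo_m: "lo i = a" if "i \<le> m" for i
    using bZ[unfolded between_def, rule_format, of i] y'(2) that box m M \<open>C * \<delta> \<le> \<eta> / 16\<close>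
    by (auto simp: Z_def flat_def intro: order_antisym)
  have geZ: "J_ge_at_ends f (minval f r a a lo hi) Z"
    by (rule J_ge_at_ends_minval[OF box' bZ _ _ _ _ limZ, of m e])
       (use lo_m far box in \<open>auto intro: order_trans\<close>)
  obtain P0 where P0: "\<forall>i\<le>P0. \<bar>U i - a\<bar> < \<delta>"
    using tendsto_close(1)[OF \<delta>(1) lim(1)] by blast
  define R where "R = \<bar>P0\<bar> + \<bar>m\<bar> + \<bar>w\<bar> + \<bar>i\<bar> + 2 * int r + 1"
  \<comment> \<open>The gain \<eta> is reduced by \<eta> / 4 for the new transition and by three
    errors of at most \<eta> / 16, for truncating \<open>U\<close> and for the two sides of the
    seam.\<close>
  have "J f p q Z + \<eta> / 2 \<le> J f p q U" if pq: "p \<le> - R" "R \<le> q" for p q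
  proof -
    let ?t = "tr p w a b U"
    have pw: "p \<le> w" using pq by (simp add: R_def)
    have "c\<^sub>1 + \<eta> \<le> En (p - 1) (w + 1) ?t"
      by (rule gap[of _ _ _ i]) (use inbox_tr[OF Uin] ab flat_tr[OF pw] i pq in \<open>auto simp: tr_def R_def\<close>)
    moreover have "\<bar>En (p - 1) (w + 1) ?t - J f p w U\<bar> \<le> C * \<delta>"
      by (rule truncation) (use Uin P0 pq cl \<delta>(1) in \<open>auto simp: close_def R_def less_imp_le\<close>)
    ultimately have 1: "c\<^sub>1 + \<eta> - C * \<delta> \<le> J f p w U" by linarith
    have Lr: "L * (real r * \<delta>) \<le> C * \<delta>"
      using L_nonneg \<delta>(1) by (simp add: C_def algebra_simps)
    have "\<bar>J f p w Z - J f p w y'\<bar> \<le> L * (real (card {w + 1..w + int r}) * \<delta>)"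
    proof (rule J_close[OF Zin y'(1)])
      fix j assume "j \<in> {w + 1..w + int r}"
      then show "\<bar>Z j - y' j\<bar> \<le> \<delta>"
        using closeD[OF cl, of j] y'(2) m(1) by (simp add: Z_def flat_def)
    qed (use \<delta>(1) in \<open>auto simp: Z_def\<close>)
    then have 2: "J f p w Z \<le> J f p w y' + C * \<delta>" using Lr by simp
    have "J f p w y' = En m (m + M) y'"
      by (rule flat_J_extend[OF y']) (use pq m in \<open>auto simp: R_def\<close>)
    also have "\<dots> = En 0 M y"
      by (simp add: y'_def J_sh)
    finally have 3: "J f p w y' \<le> c\<^sub>1 + \<eta> / 4" using y(3) by simp
    have "\<bar>J f (w + 1) q Z - J f (w + 1) q U\<bar> \<le> L * (real (card {w + 1 - int r..w}) * \<delta>)"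
    proof (rule J_close[OF Zin Uin])
      fix j assume "j \<in> {w + 1 - int r..w}"
      then show "\<bar>Z j - U j\<bar> \<le> \<delta>"
        using closeD[OF cl, of j] y'(2) m(1) by (simp add: Z_def flat_def abs_minus_commute)
    qed (use \<delta>(1) in \<open>auto simp: Z_def\<close>)
    then have 4: "J f (w + 1) q Z \<le> J f (w + 1) q U + C * \<delta>" using Lr by simp
    have "J f p q Z = J f p w Z + J f (w + 1) q Z" "J f p q U = J f p w U + J f (w + 1) q U"
      using pq by (auto simp: R_def intro!: J_split)
    then show ?thesis
      using 1 2 3 4 \<delta>(2) \<open>0 < \<eta>\<close> by linarith
  qed
  then show False
    using no_improvement[OF le geZ, of "\<eta> / 2" R] \<open>0 < \<eta>\<close> by simp
qed

text \<open>Between two windows near \<open>b\<close> the constant \<open>b\<close> is admissible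
  and almost free, whereas a deviation of \<open>U\<close> from \<open>b\<close> costs
  \<beta>.\<close>

lemma middle_inactive:
  assumes box: "\<forall>i. a \<le> lo i \<and> lo i \<le> hi i \<and> hi i \<le> b" and U: "between lo hi U"
    and lim: "(U \<longlongrightarrow> a) at_bot" "(U \<longlongrightarrow> a) at_top" and le: "J_le_at_ends f (minval f r a a lo hi) U"
    and far: "\<forall>i\<le>e'. lo i = a" "\<forall>i\<ge>e. lo i = a"
    and \<beta>: "\<beta> - C * \<delta> \<le> J f (w + 1) w' U" "0 < \<beta>"
    and cl: "close b \<delta> (w - int r) (w + int r + 1) U" "close b \<delta> (w' - int r) (w' + int r + 1) U"
    and \<delta>: "0 < \<delta>" "C * \<delta> \<le> \<beta> / 8" and "w < w'" and hi: "\<forall>i\<in>{w + 1..w'}. hi i = b"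
  shows False
proof -
  have box': "\<forall>i. a \<le> lo i \<and> hi i \<le> b" using box by blast
  have Uin: "inbox a b U" using between_inbox[OF U box'] .
  have bin: "inbox a b (\<lambda>_. b)" using ab by (intro inbox_const) auto
  define Z where "Z = (\<lambda>i. if w < i \<and> i \<le> w' then b else U i)"
  have Zin: "inbox a b Z" using Uin ab by (simp add: inbox_def Z_def)
  have bZ: "between lo hi Z"
    unfolding between_def
  proof
    fix i show "lo i \<le> Z i \<and> Z i \<le> hi i"
    proof (cases "w < i \<and> i \<le> w'")
      case True
      then have "hi i = b" using hi by auto
      then show ?thesis using True box by (metis Z_def order_refl)
    qed (use U in \<open>auto simp: between_def Z_def\<close>)
  qed
  have limZ: "(Z \<longlongrightarrow> a) at_bot" "(Z \<longlongrightarrow> a) at_top"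
    by (rule tendsto_at_bot_cong[of w, OF _ lim(1)], simp add: Z_def)
       (rule tendsto_at_top_cong[of w', OF _ lim(2)], simp add: Z_def)
  have geZ: "J_ge_at_ends f (minval f r a a lo hi) Z"
    by (rule J_ge_at_ends_minval[OF box' bZ _ _ _ _ limZ, of e' e])
       (use far box in \<open>auto intro: order_trans\<close>)
  have Lr: "L * (real r * \<delta>) \<le> C * \<delta>" "L * (2 * real r * \<delta>) \<le> C * \<delta>"
    using L_nonneg \<delta>(1) by (auto simp: C_def algebra_simps)
  define R where "R = \<bar>w\<bar> + \<bar>w'\<bar> + 1"
  \<comment> \<open>Four errors of at most \<beta> / 8 each: one in the bound for \<open>U\<close>,
    two at the seams and one on the inserted constant.\<close>
  have "J f p q Z + \<beta> / 2 \<le> J f p q U" if pq: "p \<le> - R" "R \<le> q" for p q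
  proof -
    have "\<bar>J f p w Z - J f p w U\<bar> \<le> L * (real (card {w + 1..w + int r}) * \<delta>)"
    proof (rule J_close[OF Zin Uin])
      fix j assume "j \<in> {w + 1..w + int r}"
      then show "\<bar>Z j - U j\<bar> \<le> \<delta>"
        using closeD[OF cl(1), of j] \<delta>(1) by (auto simp: Z_def abs_minus_commute)
    qed (use \<delta>(1) in \<open>auto simp: Z_def\<close>)
    then have 1: "J f p w Z \<le> J f p w U + C * \<delta>" using Lr by simp
    have "\<bar>J f (w' + 1) q Z - J f (w' + 1) q U\<bar> \<le> L * (real (card {w' + 1 - int r..w'}) * \<delta>)"
    proof (rule J_close[OF Zin Uin])
      fix j assume "j \<in> {w' + 1 - int r..w'}"
      then show "\<bar>Z j - U j\<bar> \<le> \<delta>"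
        using closeD[OF cl(2), of j] \<delta>(1) by (auto simp: Z_def abs_minus_commute)
    qed (use \<delta>(1) in \<open>auto simp: Z_def\<close>)
    then have 2: "J f (w' + 1) q Z \<le> J f (w' + 1) q U + C * \<delta>" using Lr by simp
    let ?F = "{w + 1 - int r..w} \<union> {w' + 1..w' + int r}"
    have "card ?F = 2 * r"
      using \<open>w < w'\<close> by (subst card_Un_disjoint) auto
    moreover have "\<bar>J f (w + 1) w' Z - J f (w + 1) w' (\<lambda>_. b)\<bar> \<le> L * (real (card ?F) * \<delta>)"
    proof (rule J_close[OF Zin bin])
      fix j assume "j \<in> ?F"
      then show "\<bar>Z j - b\<bar> \<le> \<delta>"
        using closeD[OF cl(1), of j] closeD[OF cl(2), of j] \<delta>(1) by (auto simp: Z_def)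
    qed (use \<delta>(1) in \<open>auto simp: Z_def\<close>)
    ultimately have 3: "J f (w + 1) w' Z \<le> C * \<delta>"
      using Lr J_const[of b "w + 1" w'] by simp
    have "J f p q Z = J f p w Z + J f (w + 1) w' Z + J f (w' + 1) q Z"
      "J f p q U = J f p w U + J f (w + 1) w' U + J f (w' + 1) q U"
      using J_split[of p w q f] J_split[of "w + 1" w' q f] pq \<open>w < w'\<close> by (auto simp: R_def)
    then show ?thesis
      using 1 2 3 \<beta> \<delta>(2) by linarith
  qed
  then show False
    using no_improvement[OF le geZ, of "\<beta> / 2" R] \<beta>(2) by simp
qed

end

section \<open>Reflection and inactive constraints\<close>

text \<open>Reflection interchanges transitions from \<open>a\<close> to \<open>b\<close> with those
  from \<open>b\<close> to \<open>a\<close>, so the constraints on the right are treated as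
  constraints on the left for \<open>f \<circ> refl_seq\<close>.\<close>

definition refl_seq :: "(int \<Rightarrow> real) \<Rightarrow> int \<Rightarrow> real" where
  "refl_seq x = (\<lambda>i. x (- i))"

lemma refl_seq_refl_seq [simp]: "refl_seq (refl_seq x) = x"
  by (simp add: refl_seq_def)

lemma refl_seq_apply [simp]: "refl_seq x i = x (- i)"
  by (simp add: refl_seq_def)

lemma all_uminus_int: "(\<forall>i::int. P (- i)) \<longleftrightarrow> (\<forall>i. P i)"
proof
  assume P: "\<forall>i. P (- i)"
  show "\<forall>i. P i"
  proof
    fix i show "P i" using spec[OF P, of "- i"] by simp
  qed
qed simp

lemma inbox_refl_seq [simp]: "inbox a b (refl_seq x) = inbox a b x"
  unfolding inbox_def refl_seq_apply by (rule all_uminus_int[of "\<lambda>i. a \<le> x i \<and> x i \<le> b"])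

lemma between_refl_seq [simp]: "between (refl_seq lo) (refl_seq hi) (refl_seq x) = between lo hi x"
  unfolding between_def refl_seq_apply by (rule all_uminus_int[of "\<lambda>i. lo i \<le> x i \<and> x i \<le> hi i"])

lemma flat_refl_seq [simp]: "flat \<beta> \<alpha> (- q) (- p) (refl_seq x) = flat \<alpha> \<beta> p q x"
  using all_uminus_int[of "\<lambda>i. q \<le> i \<longrightarrow> x i = \<beta>"] all_uminus_int[of "\<lambda>i. i \<le> p \<longrightarrow> x i = \<alpha>"]
  by (auto simp: flat_def le_minus_iff minus_le_iff)

lemma J_refl_seq: "J (f \<circ> refl_seq) p q x = J f (- q) (- p) (refl_seq x)"
proof -
  have "refl_seq (sh j x) = sh (- j) (refl_seq x)" for j
    by (simp add: fun_eq_iff sh_def)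
  then show ?thesis
    unfolding J_def by (intro sum.reindex_bij_witness[of _ uminus uminus]) auto
qed

lemma energies_refl_seq:
  "energies (f \<circ> refl_seq) r \<beta> \<alpha> (refl_seq lo) (refl_seq hi) = energies f r \<alpha> \<beta> lo hi"
proof -
  have "energies (f \<circ> refl_seq) r \<beta> \<alpha> (refl_seq lo) (refl_seq hi) \<subseteq> energies f r \<alpha> \<beta> lo hi"
    for f r \<alpha> \<beta> lo hi
  proof
    fix e assume "e \<in> energies (f \<circ> refl_seq) r \<beta> \<alpha> (refl_seq lo) (refl_seq hi)"
    then obtain p q z where z: "e = J (f \<circ> refl_seq) (p - int r) (q + int r) z"
      "between (refl_seq lo) (refl_seq hi) z" "flat \<beta> \<alpha> p q z"
      by (auto simp: energies_def)
    have "e = J f (- q - int r) (- p + int r) (refl_seq z)"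
      unfolding z(1) J_refl_seq by simp
    moreover have "between lo hi (refl_seq z)" "flat \<alpha> \<beta> (- q) (- p) (refl_seq z)"
      using z(2,3) between_refl_seq[of "refl_seq lo" "refl_seq hi" z] by simp_all
    ultimately show "e \<in> energies f r \<alpha> \<beta> lo hi"
      unfolding energies_def by blast
  qed
  \<comment> \<open>Reflection is an involution, so the inclusion for
    \<open>f \<circ> refl_seq\<close> is the converse one.\<close>
  from this[of f r \<beta> \<alpha> lo hi] this[of "f \<circ> refl_seq" r \<alpha> \<beta> "refl_seq lo" "refl_seq hi"]
  show ?thesis
    by (auto simp: comp_assoc fun_eq_iff o_def)
qed

lemma minval_refl_seq:
  "minval (f \<circ> refl_seq) r \<beta> \<alpha> (refl_seq lo) (refl_seq hi) = minval f r \<alpha> \<beta> lo hi"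
  by (simp add: minval_def energies_refl_seq)

lemma minval_refl_seq_const:
  "minval (f \<circ> refl_seq) r \<beta> \<alpha> (\<lambda>_. u) (\<lambda>_. v) = minval f r \<alpha> \<beta> (\<lambda>_. u) (\<lambda>_. v)"
  using minval_refl_seq[of f r \<beta> \<alpha> "\<lambda>_. u" "\<lambda>_. v"] by (simp add: refl_seq_def)

lemma tendsto_refl_seq:
  "(refl_seq x \<longlongrightarrow> t) at_bot \<longleftrightarrow> (x \<longlongrightarrow> t) at_top"
  "(refl_seq x \<longlongrightarrow> t) at_top \<longleftrightarrow> (x \<longlongrightarrow> t) at_bot"
proof -
  have *: "(refl_seq x \<longlongrightarrow> t) at_bot" if x: "(x \<longlongrightarrow> t) at_top" for x :: "int \<Rightarrow> real"
  proof (rule tendstoI)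
    fix e :: real assume "0 < e"
    then obtain N where "\<forall>n\<ge>N. dist (x n) t < e"
      using tendstoD[OF x] by (auto simp: eventually_at_top_linorder)
    then show "\<forall>\<^sub>F n in at_bot. dist (refl_seq x n) t < e"
      unfolding eventually_at_bot_linorder by (intro exI[of _ "- N"]) simp
  qed
  have **: "(refl_seq x \<longlongrightarrow> t) at_top" if x: "(x \<longlongrightarrow> t) at_bot" for x :: "int \<Rightarrow> real"
  proof (rule tendstoI)
    fix e :: real assume "0 < e"
    then obtain N where "\<forall>n\<le>N. dist (x n) t < e"
      using tendstoD[OF x] by (auto simp: eventually_at_bot_linorder)
    then show "\<forall>\<^sub>F n in at_top. dist (refl_seq x n) t < e"
      unfolding eventually_at_top_linorder by (intro exI[of _ "- N"]) simp
  qed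
  show "(refl_seq x \<longlongrightarrow> t) at_bot \<longleftrightarrow> (x \<longlongrightarrow> t) at_top"
    "(refl_seq x \<longlongrightarrow> t) at_top \<longleftrightarrow> (x \<longlongrightarrow> t) at_bot"
    using *[of x] **[of "refl_seq x"] *[of "refl_seq x"] **[of x] by auto
qed

lemma J_le_at_ends_refl_seq: "J_le_at_ends (f \<circ> refl_seq) c x \<longleftrightarrow> J_le_at_ends f c (refl_seq x)"
proof -
  have "(\<forall>p\<le>-P. \<forall>q\<ge>P. J f (- q) (- p) y \<le> e) \<longleftrightarrow> (\<forall>p\<le>-P. \<forall>q\<ge>P. J f p q y \<le> e)" for P e y
  proof safe
    fix p q assume *: "\<forall>p\<le>-P. \<forall>q\<ge>P. J f (- q) (- p) y \<le> e" "p \<le> - P" "P \<le> q"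
    show "J f p q y \<le> e"
      using *(1)[rule_format, of "- q" "- p"] *(2,3) by simp
  qed simp
  then show ?thesis
    unfolding J_le_at_ends_def J_refl_seq by simp
qed

lemma close_refl_seq: "close t \<delta> p q (refl_seq x) \<longleftrightarrow> close t \<delta> (- q) (- p) x"
proof -
  have "(\<forall>i. p \<le> - i \<and> - i \<le> q \<longrightarrow> \<bar>x i - t\<bar> \<le> \<delta>) \<longleftrightarrow> (\<forall>i. p \<le> i \<and> i \<le> q \<longrightarrow> \<bar>x (- i) - t\<bar> \<le> \<delta>)"
    using all_uminus_int[of "\<lambda>i. p \<le> i \<and> i \<le> q \<longrightarrow> \<bar>x (- i) - t\<bar> \<le> \<delta>"] by simp
  then show ?thesis
    unfolding close_def Ball_def atLeastAtMost_iff refl_seq_apply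
    by (simp add: le_minus_iff minus_le_iff conj_commute)
qed

text \<open>Conditions (a) and (d) as one upper barrier; (b) and (c) form the lower barrier below.
  For the admissible positions the two blocks of each barrier are disjoint.\<close>

definition upper_bound :: "real \<Rightarrow> real \<Rightarrow> real \<Rightarrow> real \<Rightarrow> int \<Rightarrow> int \<Rightarrow> nat \<Rightarrow> int \<Rightarrow> real" where
  "upper_bound a b \<rho>1 \<rho>4 m1 m4 l i =
    (if i \<in> {m1 - int l..m1 - 1} then a + \<rho>1 else if i \<in> {m4..m4 + int l - 1} then a + \<rho>4 else b)"

definition lower_bound :: "real \<Rightarrow> real \<Rightarrow> real \<Rightarrow> real \<Rightarrow> int \<Rightarrow> int \<Rightarrow> nat \<Rightarrow> int \<Rightarrow> real" where
  "lower_bound a b \<rho>2 \<rho>3 m2 m3 l i =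
    (if i \<in> {m2..m2 + int l - 1} then b - \<rho>2 else if i \<in> {m3 - int l..m3 - 1} then b - \<rho>3 else a)"

abbreviation inactive :: "real \<Rightarrow> real \<Rightarrow> (int \<Rightarrow> real) \<Rightarrow> (int \<Rightarrow> real) \<Rightarrow> (int \<Rightarrow> real) \<Rightarrow> bool" where
  "inactive a b lo hi U \<equiv> \<forall>i. (hi i = b \<or> U i < hi i) \<and> (lo i = a \<or> lo i < U i)"

text \<open>The form in which the choice of \<rho>1, ..., \<rho>4 enters. Only the value at site 0
  is mentioned; translation in \<open>level_gap\<close> extends the exclusion to all sites.\<close>

definition no_minimal_heteroclinic ::
  "((int \<Rightarrow> real) \<Rightarrow> real) \<Rightarrow> nat \<Rightarrow> real \<Rightarrow> real \<Rightarrow> real \<Rightarrow> real \<Rightarrow> real \<Rightarrow> bool" where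
  "no_minimal_heteroclinic f r a b \<alpha> \<beta> lev \<longleftrightarrow>
    \<not> (\<exists>x. inbox a b x \<and> x 0 = lev \<and> (x \<longlongrightarrow> \<alpha>) at_bot \<and> (x \<longlongrightarrow> \<beta>) at_top \<and>
      J_le_at_ends f (minval f r \<alpha> \<beta> (\<lambda>_. a) (\<lambda>_. b)) x)"

lemma no_minimal_heteroclinic_refl_seq:
  assumes "no_minimal_heteroclinic f r a b \<beta> \<alpha> lev"
  shows "no_minimal_heteroclinic (f \<circ> refl_seq) r a b \<alpha> \<beta> lev"
  unfolding no_minimal_heteroclinic_def minval_refl_seq_const J_le_at_ends_refl_seq
proof safe
  fix x assume x: "inbox a b x" "lev = x 0" "(x \<longlongrightarrow> \<alpha>) at_bot" "(x \<longlongrightarrow> \<beta>) at_top"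
    "J_le_at_ends f (minval f r \<beta> \<alpha> (\<lambda>_. a) (\<lambda>_. b)) (refl_seq x)"
  moreover have "refl_seq x 0 = x 0" by simp
  ultimately show False
    using assms inbox_refl_seq tendsto_refl_seq unfolding no_minimal_heteroclinic_def by metis
qed

context chain begin

text \<open>The range and the values are symmetric under reflection; in the strict inequality
  \<sigma> becomes -\<sigma>.\<close>

lemma reflect: "chain (f \<circ> refl_seq) r a b \<Lambda> \<kappa>"
proof
  fix x y :: "int \<Rightarrow> real" and \<sigma> :: int
  assume xy: "inbox a b x" "inbox a b y"
  have "(\<Sum>i=-int r..int r. \<bar>refl_seq x i - refl_seq y i\<bar>) = (\<Sum>i=-int r..int r. \<bar>x i - y i\<bar>)"
    by (rule sum.reindex_bij_witness[of _ uminus uminus]) auto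
  then show "\<bar>(f \<circ> refl_seq) x - (f \<circ> refl_seq) y\<bar> \<le> \<Lambda> * (\<Sum>i=-int r..int r. \<bar>x i - y i\<bar>)"
    using lip[of "refl_seq x" "refl_seq y"] xy by simp
  have m: "refl_seq (\<lambda>i. min (x i) (y i)) = (\<lambda>i. min (refl_seq x i) (refl_seq y i))"
    "refl_seq (\<lambda>i. max (x i) (y i)) = (\<lambda>i. max (refl_seq x i) (refl_seq y i))"
    by (auto simp: fun_eq_iff)
  show "(f \<circ> refl_seq) (\<lambda>i. min (x i) (y i)) + (f \<circ> refl_seq) (\<lambda>i. max (x i) (y i))
      \<le> (f \<circ> refl_seq) x + (f \<circ> refl_seq) y"
    using submod[of "refl_seq x" "refl_seq y"] xy by (simp add: m)
  assume "\<sigma> \<in> {1, -1}" "x 0 \<le> y 0" "y \<sigma> \<le> x \<sigma>"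
  then show "(f \<circ> refl_seq) (\<lambda>i. min (x i) (y i)) + (f \<circ> refl_seq) (\<lambda>i. max (x i) (y i)) +
      \<kappa> * (y 0 - x 0) * (x \<sigma> - y \<sigma>) \<le> (f \<circ> refl_seq) x + (f \<circ> refl_seq) y"
    using strict[of "refl_seq x" "refl_seq y" "- \<sigma>"] xy by (auto simp: m)
qed (use ab \<Lambda> \<kappa> f_a f_b f_pos in \<open>auto simp: refl_seq_def\<close>)

lemma level_gap2:
  assumes "a < lev" "lev < b" "no_minimal_heteroclinic f r a b a b lev"
    and "a < lev'" "lev' < b" "no_minimal_heteroclinic f r a b a b lev'"
  obtains \<eta> where "0 < \<eta>"
    "\<And>z p q i. inbox a b z \<Longrightarrow> flat a b p q z \<Longrightarrow> z i \<in> {lev, lev'} \<Longrightarrow>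
      c\<^sub>1 + \<eta> \<le> En p q z"
proof -
  obtain \<eta> where \<eta>: "0 < \<eta>"
    "\<And>z p q i. inbox a b z \<Longrightarrow> flat a b p q z \<Longrightarrow> z i = lev \<Longrightarrow> c\<^sub>1 + \<eta> \<le> En p q z"
    by (rule level_gap[OF assms(1,2)]) (use assms(3) in \<open>unfold no_minimal_heteroclinic_def, blast+\<close>)
  obtain \<eta>' where \<eta>': "0 < \<eta>'"
    "\<And>z p q i. inbox a b z \<Longrightarrow> flat a b p q z \<Longrightarrow> z i = lev' \<Longrightarrow> c\<^sub>1 + \<eta>' \<le> En p q z"
    by (rule level_gap[OF assms(4,5)]) (use assms(6) in \<open>unfold no_minimal_heteroclinic_def, blast+\<close>)
  have "c\<^sub>1 + min \<eta> \<eta>' \<le> En p q z"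
    if "inbox a b z" "flat a b p q z" "z i \<in> {lev, lev'}" for z p q i
    using \<eta>(2)[OF that(1,2), of i] \<eta>'(2)[OF that(1,2), of i] that(3) by auto
  then show ?thesis
    using that[of "min \<eta> \<eta>'"] \<eta>(1) \<eta>'(1) by simp
qed

text \<open>Its length \<open>M\<close> is the room that must be available between an
  \<open>a\<close> block and the adjacent \<open>b\<close> block.\<close>

lemma near_minimal_heteroclinic:
  assumes "0 < \<epsilon>"
  obtains y M where "inbox a b y" "flat a b 0 M y" "En 0 M y \<le> c\<^sub>1 + \<epsilon>"
proof -
  let ?z = "\<lambda>i. if i \<le> 0 then a else b"
  have "\<forall>i::int. a \<le> a \<and> b \<le> b" "between (\<lambda>_. a) (\<lambda>_. b) ?z" "flat a b 0 1 ?z"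
    using ab by (auto simp: between_def flat_def)
  from minval_approx[OF this assms] obtain p q z where
    z: "between (\<lambda>_. a) (\<lambda>_. b) z" "flat a b p q z"
      "En p q z < c\<^sub>1 + \<epsilon>"
    by metis
  have "inbox a b (sh p z)" "flat a b 0 (q - p) (sh p z)"
    using z flat_sh[OF z(2), of p] by (auto simp: between_const_iff intro: inbox_sh)
  moreover have "En 0 (q - p) (sh p z) = En p q z"
    by (simp add: J_sh algebra_simps)
  ultimately show ?thesis
    using that z(3) by (metis less_imp_le)
qed

text \<open>The \<open>b\<close> blocks contain windows at \<open>w\<close> and \<open>w'\<close>. A
  barrier touched up to \<open>w\<close> contradicts \<open>left_inactive\<close>, one touched
  beyond \<open>w'\<close> its reflection; between them only the lower barrier can be touched, which
  contradicts \<open>middle_inactive\<close>. \<open>N\<close> is the larger length of two fixed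
  nearly minimal transitions, one in each direction.\<close>

lemma constrained_minimizer:
  assumes \<rho>: "\<rho>1 \<in> {0<..<b - a}" "\<rho>2 \<in> {0<..<b - a}" "\<rho>3 \<in> {0<..<b - a}" "\<rho>4 \<in> {0<..<b - a}"
    and up: "no_minimal_heteroclinic f r a b a b (a + \<rho>1)" "no_minimal_heteroclinic f r a b a b (b - \<rho>2)"
    and down: "no_minimal_heteroclinic f r a b b a (b - \<rho>3)" "no_minimal_heteroclinic f r a b b a (a + \<rho>4)"
  obtains l0 :: nat and N :: int where
    "\<And>l m1 m2 m3 m4. l0 \<le> l \<Longrightarrow> m1 < m2 \<Longrightarrow> m2 + 2 * int l < m3 \<Longrightarrow> m3 < m4 \<Longrightarrow>
      \<exists>U. homoclinic_minimizer f r a (lower_bound a b \<rho>2 \<rho>3 m2 m3 l) (upper_bound a b \<rho>1 \<rho>4 m1 m4 l) U \<and>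
        (N \<le> m2 - m1 \<and> N \<le> m4 - m3 \<longrightarrow>
          inactive a b (lower_bound a b \<rho>2 \<rho>3 m2 m3 l) (upper_bound a b \<rho>1 \<rho>4 m1 m4 l) U)"
proof -
  interpret R: chain "f \<circ> refl_seq" r a b \<Lambda> \<kappa> by (rule reflect)
  have RL: "R.L = L" "R.C = C" "R.K = K"
    by (simp_all add: R.L_def L_def R.C_def C_def R.K_def K_def)
  obtain \<eta> where \<eta>: "0 < \<eta>"
    "\<And>z p q i. inbox a b z \<Longrightarrow> flat a b p q z \<Longrightarrow> z i \<in> {a + \<rho>1, b - \<rho>2} \<Longrightarrow>
      c\<^sub>1 + \<eta> \<le> En p q z"
    by (rule level_gap2[OF _ _ up(1) _ _ up(2)]) (use \<rho> in auto)
  obtain \<eta>' where \<eta>': "0 < \<eta>'"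
    "\<And>z p q i. inbox a b z \<Longrightarrow> flat a b p q z \<Longrightarrow> z i \<in> {a + \<rho>4, b - \<rho>3} \<Longrightarrow>
      minval (f \<circ> refl_seq) r a b (\<lambda>_. a) (\<lambda>_. b) + \<eta>' \<le> J (f \<circ> refl_seq) (p - int r) (q + int r) z"
    by (rule R.level_gap2[OF _ _ no_minimal_heteroclinic_refl_seq[OF down(2)]
          _ _ no_minimal_heteroclinic_refl_seq[OF down(1)]]) (use \<rho> in auto)
  obtain y M where y: "inbox a b y" "flat a b 0 M y" "En 0 M y \<le> c\<^sub>1 + \<eta> / 4"
    using near_minimal_heteroclinic[of "\<eta> / 4"] \<eta>(1) by auto
  obtain y' M' where y': "inbox a b y'" "flat a b 0 M' y'"
    "J (f \<circ> refl_seq) (0 - int r) (M' + int r) y' \<le> minval (f \<circ> refl_seq) r a b (\<lambda>_. a) (\<lambda>_. b) + \<eta>' / 4"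
    using R.near_minimal_heteroclinic[of "\<eta>' / 4"] \<eta>'(1) by auto
  define \<theta> where "\<theta> = min \<rho>2 \<rho>3"
  have \<theta>: "0 < \<theta>" "\<theta> \<le> \<rho>2" "\<theta> \<le> \<rho>3" using \<rho> by (auto simp: \<theta>_def)
  obtain \<beta> where \<beta>: "0 < \<beta>" "deviation_bound \<theta> \<beta>"
    using J_hom[OF \<theta>(1)] .
  note \<beta> = \<beta>(1) \<beta>(2)[rule_format]
  \<comment> \<open>Meets the error budgets of \<open>middle_inactive\<close>, of
    \<open>left_inactive\<close> and of its reflection at once.\<close>
  define e where "e = min (\<beta> / 8) (min (\<eta> / 16) (\<eta>' / 16))"
  have e: "0 < e" "e \<le> \<beta> / 8" "e \<le> \<eta> / 16" "e \<le> \<eta>' / 16"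
    using \<beta>(1) \<eta>(1) \<eta>'(1) by (auto simp: e_def)
  define \<delta> where "\<delta> = e / C"
  have \<delta>: "0 < \<delta>" "C * \<delta> = e" using e(1) C_pos by (auto simp: \<delta>_def)
  define \<rho>a \<rho>b where "\<rho>a = max \<rho>1 \<rho>4" and "\<rho>b = max \<rho>2 \<rho>3"
  have \<rho>ab: "\<rho>a < b - a" "\<rho>b < b - a" using \<rho> by (auto simp: \<rho>a_def \<rho>b_def)
  obtain l1 :: nat where l1:
    "\<And>lo hi \<alpha> \<alpha>' l z0 p0 q0. l1 \<le> l \<Longrightarrow> \<forall>i. a \<le> lo i \<and> lo i \<le> hi i \<and> hi i \<le> b \<Longrightarrow>
      \<forall>i<\<alpha> + int l. lo i = a \<Longrightarrow> \<forall>i\<in>{\<alpha>..<\<alpha> + int l}. hi i \<le> a + \<rho>a \<Longrightarrow>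
      \<forall>i\<ge>\<alpha>'. lo i = a \<Longrightarrow> \<forall>i\<in>{\<alpha>'..<\<alpha>' + int l}. hi i \<le> a + \<rho>a \<Longrightarrow>
      between lo hi z0 \<Longrightarrow> flat a a p0 q0 z0 \<Longrightarrow> En p0 q0 z0 \<le> K \<Longrightarrow>
      \<exists>U. homoclinic_minimizer f r a lo hi U"
    by (fact existence[OF \<rho>ab(1)])
  obtain l2 :: nat where l2:
    "\<And>x t p q. inbox a b x \<Longrightarrow> t \<in> {a, b} \<Longrightarrow> J f p q x \<le> K + 1 + 2 * K \<Longrightarrow> p + int l2 \<le> q + 1 \<Longrightarrow>
      close t \<rho>b p q x \<Longrightarrow>
      \<exists>w. p \<le> w - int r \<and> w + int r + 1 \<le> q \<and> close t \<delta> (w - int r) (w + int r + 1) x"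
    using window[OF \<delta>(1) \<rho>ab(2)] by metis
  have main: "\<exists>U. homoclinic_minimizer f r a (lower_bound a b \<rho>2 \<rho>3 m2 m3 l) (upper_bound a b \<rho>1 \<rho>4 m1 m4 l) U \<and>
      (max M M' \<le> m2 - m1 \<and> max M M' \<le> m4 - m3 \<longrightarrow>
        inactive a b (lower_bound a b \<rho>2 \<rho>3 m2 m3 l) (upper_bound a b \<rho>1 \<rho>4 m1 m4 l) U)"
    if l: "max l1 l2 \<le> l" and m: "m1 < m2" "m2 + 2 * int l < m3" "m3 < m4" for l m1 m2 m3 m4
  proof -
    define lo where "lo = lower_bound a b \<rho>2 \<rho>3 m2 m3 l"
    define hi where "hi = upper_bound a b \<rho>1 \<rho>4 m1 m4 l"
    note defs = lo_def hi_def lower_bound_def upper_bound_def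
    have lo_cases: "lo i = a \<or> i \<in> {m2..m2 + int l - 1} \<and> lo i = b - \<rho>2 \<or>
        i \<in> {m3 - int l..m3 - 1} \<and> lo i = b - \<rho>3" for i
      by (simp add: defs)
    have hi_cases: "hi i = b \<or> i \<in> {m1 - int l..m1 - 1} \<and> hi i = a + \<rho>1 \<or>
        i \<in> {m4..m4 + int l - 1} \<and> hi i = a + \<rho>4" for i
      by (simp add: defs)
    have lo_a: "lo i = a" if "i < m2 \<or> m3 \<le> i" for i
      using lo_cases[of i] that m by auto
    have hi_b: "hi i = b" if "m1 \<le> i" "i < m4" for i
      using hi_cases[of i] that m by auto
    have box: "\<forall>i. a \<le> lo i \<and> lo i \<le> hi i \<and> hi i \<le> b"
    proof
      fix i
      have "lo i = a \<or> hi i = b"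
        using lo_a[of i] hi_b[of i] m by linarith
      then show "a \<le> lo i \<and> lo i \<le> hi i \<and> hi i \<le> b"
        using lo_cases[of i] hi_cases[of i] \<rho> ab by auto
    qed
    have box': "\<forall>i. a \<le> lo i \<and> hi i \<le> b" using box by blast
    \<comment> \<open>A sharp plateau at \<open>b\<close>. Its energy is at most \<open>K\<close>
      independently of \<open>l\<close> and of the blocks, which makes the thresholds
      \<open>l1\<close> and \<open>l2\<close> uniform.\<close>
    define z0 where "z0 = tr m2 (m3 - 1) a a (\<lambda>_. b)"
    have z0: "between lo hi z0" "flat a a (m2 - 1) (m3 - 1 + 1) z0"
    proof -
      have "lo i \<le> z0 i \<and> z0 i \<le> hi i" for i
      proof (cases "m2 \<le> i \<and> i < m3")
        case True
        then have "z0 i = b" "hi i = b" using hi_b[of i] m by (auto simp: z0_def tr_def)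
        then show ?thesis using box by (metis order_refl order_trans)
      next
        case False
        then have "z0 i = a" "lo i = a" using lo_a[of i] by (auto simp: z0_def tr_def)
        then show ?thesis using box by (metis order_refl)
      qed
      then show "between lo hi z0" by (simp add: between_def)
      show "flat a a (m2 - 1) (m3 - 1 + 1) z0"
        unfolding z0_def by (rule flat_tr) (use m in auto)
    qed
    have "\<bar>En (m2 - 1) (m3 - 1 + 1) z0 - J f m2 (m3 - 1) (\<lambda>_. b)\<bar> \<le> C * (b - a)"
      unfolding z0_def by (rule truncation) (use m ab in \<open>auto simp: close_def inbox_def\<close>)
    then have z0K: "En (m2 - 1) (m3 - 1 + 1) z0 \<le> K"
      using J_const[of b m2 "m3 - 1"] by (simp add: K_def)
    have "\<exists>U. homoclinic_minimizer f r a lo hi U"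
    proof (rule l1[OF _ box _ _ _ _ z0 z0K])
      show "l1 \<le> l" using l by simp
      show "\<forall>i<m1 - int l + int l. lo i = a" "\<forall>i\<ge>m4. lo i = a"
        using lo_a m by auto
      show "\<forall>i\<in>{m1 - int l..<m1 - int l + int l}. hi i \<le> a + \<rho>a"
        by (auto simp: defs \<rho>a_def)
      show "\<forall>i\<in>{m4..<m4 + int l}. hi i \<le> a + \<rho>a"
        using m by (auto simp: defs \<rho>a_def)
    qed
    then obtain U where U: "between lo hi U" "(U \<longlongrightarrow> a) at_bot" "(U \<longlongrightarrow> a) at_top"
      "J_le_at_ends f (minval f r a a lo hi) U" by blast
    have Uin: "inbox a b U" using between_inbox[OF U(1) box'] .
    have JU: "J f p q U \<le> K + 1 + 2 * K" for p q
      using J_le_at_ends_bound[OF Uin U(4), of p q] minval_le[OF box' z0] z0K by simp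
    have win: "\<exists>w. s \<le> w - int r \<and> w + int r + 1 \<le> s + int l - 1 \<and> close b \<delta> (w - int r) (w + int r + 1) U"
      if "s \<in> {m2, m3 - int l}" for s
    proof (rule l2[OF Uin _ JU])
      show "close b \<rho>b s (s + int l - 1) U"
        unfolding close_def
      proof
        fix i assume i: "i \<in> {s..s + int l - 1}"
        then have "b - \<rho>b \<le> lo i"
          using that m by (auto simp: defs \<rho>b_def)
        then have "b - \<rho>b \<le> U i" using U(1) by (meson between_def order_trans)
        then show "\<bar>U i - b\<bar> \<le> \<rho>b" using inboxD[OF Uin, of i] by simp
      qed
    qed (use l in auto)
    obtain w where w: "m2 \<le> w - int r" "w + int r + 1 \<le> m2 + int l - 1"
      "close b \<delta> (w - int r) (w + int r + 1) U"
      using win[of m2] by auto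
    obtain w' where w': "m3 - int l \<le> w' - int r" "w' + int r + 1 \<le> m3 - int l + int l - 1"
      "close b \<delta> (w' - int r) (w' + int r + 1) U"
      using win[of "m3 - int l"] by auto
    have mid: "U i \<noteq> lo i" if i: "w < i" "i \<le> w'" "lo i \<noteq> a" for i
    proof
      assume eq: "U i = lo i"
      have "\<theta> \<le> \<bar>U i - b\<bar>"
        using lo_cases[of i] i(3) eq \<theta> by auto
      then have "\<beta> - C * \<delta> \<le> J f (w + 1) w' U"
        using i w(3) w'(3) \<delta>(1) by (intro \<beta>(2)[OF Uin, of b _ _ _ i]) (auto simp: close_def)
      then show False
        using middle_inactive[OF box U, of "m2 - 1" m3 \<beta> \<delta> w w'] lo_a hi_b \<beta>(1) w w' \<delta> e(2) m i
        by auto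
    qed
    \<comment> \<open>Starting from \<open>m1 - 1\<close>, the last site of block (a), the inserted
      transition is \<open>a\<close> on that block and has reached \<open>b\<close> before
      \<open>m2\<close>.\<close>
    have left: False if N: "max M M' \<le> m2 - m1" and i: "i \<le> w" "U i \<in> {a + \<rho>1, b - \<rho>2}" for i
    proof (rule left_inactive[OF box U, of m3 "U i" \<eta> y M \<delta> w "m1 - 1" i])
      show "\<forall>j\<ge>m3. lo j = a" using lo_a by auto
      show "c\<^sub>1 + \<eta> \<le> En p q z"
        if "inbox a b z" "flat a b p q z" "z j = U i" for z p q j
        using \<eta>(2)[OF that(1,2), of j] that(3) i(2) by simp
      show "m1 - 1 + M \<le> w - int r" using w(1) N by simp
      show "\<forall>j<m1 - 1 + M. lo j = a" using lo_a N by auto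
      show "\<forall>j. m1 - 1 < j \<and> j \<le> w \<longrightarrow> hi j = b" using hi_b w m by auto
    qed (use \<eta>(1) y w \<delta> e i in auto)
    \<comment> \<open>Reflection sends the cut between \<open>w'\<close> and \<open>w' + 1\<close>
      to the one between \<open>- w' - 1\<close> and \<open>- w'\<close>, which explains the centre;
      \<open>- m4\<close> is the image of the first site of block (d).\<close>
    have right: False if N: "max M M' \<le> m4 - m3" and i: "w' < i" "U i \<in> {a + \<rho>4, b - \<rho>3}" for i
    proof (rule R.left_inactive[of "refl_seq lo" "refl_seq hi" "refl_seq U" "- m2 + 1" "U i" \<eta>' y' M' \<delta>
          "- w' - 1" "- m4" "- i"])
      show "\<forall>i. a \<le> refl_seq lo i \<and> refl_seq lo i \<le> refl_seq hi i \<and> refl_seq hi i \<le> b"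
        using box by simp
      show "between (refl_seq lo) (refl_seq hi) (refl_seq U)" using U(1) by simp
      show "(refl_seq U \<longlongrightarrow> a) at_bot" "(refl_seq U \<longlongrightarrow> a) at_top"
        using U(2,3) by (simp_all add: tendsto_refl_seq)
      show "J_le_at_ends (f \<circ> refl_seq) (minval (f \<circ> refl_seq) r a a (refl_seq lo) (refl_seq hi)) (refl_seq U)"
        using U(4) by (simp add: J_le_at_ends_refl_seq minval_refl_seq)
      show "\<forall>j\<ge>- m2 + 1. refl_seq lo j = a" using lo_a by auto
      show "minval (f \<circ> refl_seq) r a b (\<lambda>_. a) (\<lambda>_. b) + \<eta>' \<le> J (f \<circ> refl_seq) (p - int r) (q + int r) z"
        if "inbox a b z" "flat a b p q z" "z j = U i" for z p q j
        using \<eta>'(2)[OF that(1,2), of j] that(3) i(2) by simp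
      show "close b \<delta> (- w' - 1 - int r) (- w' - 1 + int r + 1) (refl_seq U)"
      proof -
        have "- (- w' - 1 + int r + 1) = w' - int r" "- (- w' - 1 - int r) = w' + int r + 1"
          by simp_all
        then show ?thesis
          using w'(3) by (simp only: close_refl_seq)
      qed
      show "- m4 + M' \<le> - w' - 1 - int r" using w'(2) N by simp
      show "\<forall>j < - m4 + M'. refl_seq lo j = a" using lo_a N by auto
      show "\<forall>j. - m4 < j \<and> j \<le> - w' - 1 \<longrightarrow> refl_seq hi j = b" using hi_b w' m by auto
    qed (use \<eta>'(1) y' \<delta> e i RL in auto)
    have "(hi i = b \<or> U i < hi i) \<and> (lo i = a \<or> lo i < U i)"
      if N: "max M M' \<le> m2 - m1" "max M M' \<le> m4 - m3" for i
    proof (rule conjI; rule ccontr)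
      assume "\<not> (hi i = b \<or> U i < hi i)"
      then have eq: "U i = hi i" "hi i \<noteq> b" using U(1) by (auto simp: between_def order_le_less)
      then show False
        using hi_cases[of i] left[OF N(1), of i] right[OF N(2), of i] w w' m by auto
    next
      assume "\<not> (lo i = a \<or> lo i < U i)"
      then have eq: "U i = lo i" "lo i \<noteq> a" using U(1) by (auto simp: between_def order_le_less)
      then show False
        using lo_cases[of i] left[OF N(1), of i] right[OF N(2), of i] mid[of i] w w' m by force
    qed
    then show ?thesis
      using U unfolding lo_def hi_def by blast
  qed
  show ?thesis
    by (rule that[of "max l1 l2" "max M M'"]) (rule main)
qed

text \<open>Where both signs of variation are admissible, minimality alone gives the claim. Where
  \<open>U\<close> touches \<open>a\<close> or \<open>b\<close>, one sign is missing; there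
  submodularity compares the variation of \<open>U\<close> with that of the constant, whose
  derivative vanishes.\<close>

lemma stationary:
  assumes box: "\<forall>i. a \<le> lo i \<and> lo i \<le> hi i \<and> hi i \<le> b" and U: "between lo hi U"
    and lim: "(U \<longlongrightarrow> a) at_bot" "(U \<longlongrightarrow> a) at_top" and le: "J_le_at_ends f (minval f r a a lo hi) U"
    and far: "\<forall>i\<le>e'. lo i = a" "\<forall>i\<ge>e. lo i = a"
    and inactive: "hi i = b \<or> U i < hi i" "lo i = a \<or> lo i < U i"
    and dU: "((\<lambda>h. En i i (U(i := U i + h))) has_real_derivative E) (at 0)"
    and da: "((\<lambda>h. En i i ((\<lambda>_. a)(i := a + h))) has_real_derivative 0) (at 0)"
    and db: "((\<lambda>h. En i i ((\<lambda>_. b)(i := b + h))) has_real_derivative 0) (at 0)"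
  shows "E = 0"
proof -
  \<comment> \<open>\<open>En i i\<close> contains every term that reads site \<open>i\<close>, so a
    difference of \<open>D\<close> is the full change of energy.\<close>
  define D where "D y h = En i i (y(i := y i + h))" for y :: "int \<Rightarrow> real" and h
  have box': "\<forall>i. a \<le> lo i \<and> hi i \<le> b" using box by blast
  have Uin: "inbox a b U" using between_inbox[OF U box'] .
  have min: "D U 0 \<le> D U h" if h: "lo i \<le> U i + h" "U i + h \<le> hi i" for h
  proof (rule ccontr)
    assume "\<not> D U 0 \<le> D U h"
    define Z where "Z = U(i := U i + h)"
    have bZ: "between lo hi Z" using U h by (auto simp: Z_def between_def)
    have Zin: "inbox a b Z" using between_inbox[OF bZ box'] .
    have limZ: "(Z \<longlongrightarrow> a) at_bot" "(Z \<longlongrightarrow> a) at_top"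
      by (rule tendsto_at_bot_cong[of i, OF _ lim(1)], simp add: Z_def)
         (rule tendsto_at_top_cong[of i, OF _ lim(2)], simp add: Z_def)
    have geZ: "J_ge_at_ends f (minval f r a a lo hi) Z"
      by (rule J_ge_at_ends_minval[OF box' bZ _ _ _ _ limZ, of e' e])
         (use far box in \<open>auto intro: order_trans\<close>)
    have "J f p q Z + (D U 0 - D U h) \<le> J f p q U"
      if "p \<le> - (\<bar>i\<bar> + int r + 1)" "\<bar>i\<bar> + int r + 1 \<le> q" for p q
    proof -
      have "J f p q y = J f p (i - int r - 1) y + En i i y + J f (i + int r + 1) q y" for y
        using J_split[of p "i - int r - 1" q f y] J_split[of "i - int r" "i + int r" q f y] that by simp
      moreover have "J f p (i - int r - 1) Z = J f p (i - int r - 1) U"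
        by (rule J_eq[OF Zin Uin]) (simp add: Z_def)
      moreover have "J f (i + int r + 1) q Z = J f (i + int r + 1) q U"
        by (rule J_eq[OF Zin Uin]) (simp add: Z_def)
      ultimately show ?thesis
        by (simp add: D_def Z_def)
    qed
    then show False
      using no_improvement[OF le geZ, of "D U 0 - D U h"] \<open>\<not> D U 0 \<le> D U h\<close> by force
  qed
  have compare: "E1 \<le> E2"
    if "(\<phi> has_real_derivative E1) (at 0)" "(\<psi> has_real_derivative E2) (at 0)"
      "0 < e" "\<And>h. 0 < h \<Longrightarrow> h < e \<Longrightarrow> \<phi> h - \<phi> 0 \<le> \<psi> h - \<psi> 0" for \<phi> \<psi> :: "real \<Rightarrow> real" and E1 E2 e
  proof (rule tendsto_le[where F = "at_right 0"])
    show "((\<lambda>h. (\<phi> h - \<phi> 0) / h) \<longlongrightarrow> E1) (at_right 0)" "((\<lambda>h. (\<psi> h - \<psi> 0) / h) \<longlongrightarrow> E2) (at_right 0)"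
      using that(1,2) by (auto simp: has_field_derivative_iff intro: tendsto_mono[OF at_le[of _ UNIV]])
    show "\<forall>\<^sub>F h in at_right 0. (\<phi> h - \<phi> 0) / h \<le> (\<psi> h - \<psi> 0) / h"
      using eventually_at_right_less[of 0] eventually_at_right_real[OF that(3)]
      by eventually_elim (use that(4) in \<open>auto intro: divide_right_mono\<close>)
  qed simp
  have const0: "((\<lambda>_. 0::real) has_real_derivative 0) (at 0)" by simp
  have neg: "((\<lambda>h. D y (- h)) has_real_derivative - E') (at 0)"
    if "(D y has_real_derivative E') (at 0)" for y E'
    using DERIV_chain2[of "D y" E' uminus 0 "- 1" UNIV] that by (simp add: DERIV_minus[OF DERIV_ident])
  have DU: "(D U has_real_derivative E) (at 0)"
    and Da: "(D (\<lambda>_. a) has_real_derivative 0) (at 0)"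
    and Db: "(D (\<lambda>_. b) has_real_derivative 0) (at 0)"
    using dU da db by (simp_all add: D_def[abs_def])
  \<comment> \<open>For t = a, the minimum of \<open>U\<close> and the constant raised at
    \<open>i\<close> is the constant, and their maximum is \<open>U\<close> raised at
    \<open>i\<close>; for t = b minimum and maximum are interchanged.\<close>
  have sub: "D U h - D U 0 \<le> D (\<lambda>_. t) h - D (\<lambda>_. t) 0"
    if t: "U i = t" "t = a \<and> 0 < h \<or> t = b \<and> h < 0" "\<bar>h\<bar> < b - a" for t h
  proof -
    let ?x = "(\<lambda>_::int. t)(i := t + h)" and ?J = "J f (i - int r) (i + int r)"
    have x: "inbox a b ?x" using t ab by (auto simp: inbox_def)
    have "?J (\<lambda>j. min (U j) (?x j)) + ?J (\<lambda>j. max (U j) (?x j)) \<le> ?J U + ?J ?x"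
      unfolding J_def sum.distrib[symmetric]
      by (rule sum_mono) (use submod[OF inbox_sh[OF Uin] inbox_sh[OF x]] in \<open>simp add: sh_def\<close>)
    moreover have "?J (\<lambda>j. min (U j) (?x j)) + ?J (\<lambda>j. max (U j) (?x j)) = ?J (\<lambda>_. t) + ?J (U(i := t + h))"
      using t(2)
    proof
      assume "t = a \<and> 0 < h"
      then have "(\<lambda>j. min (U j) (?x j)) = (\<lambda>_. t)" "(\<lambda>j. max (U j) (?x j)) = U(i := t + h)"
        using t(1) inboxD[OF Uin] by (auto simp: fun_eq_iff min_def max_def intro: order_antisym)
      then show ?thesis by simp
    next
      assume "t = b \<and> h < 0"
      then have "(\<lambda>j. max (U j) (?x j)) = (\<lambda>_. t)" "(\<lambda>j. min (U j) (?x j)) = U(i := t + h)"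
        using t(1) inboxD[OF Uin] by (auto simp: fun_eq_iff min_def max_def intro: order_antisym)
      then show ?thesis by simp
    qed
    ultimately show ?thesis
      by (simp add: D_def t(1) fun_upd_idem)
  qed
  have "0 \<le> E"
  proof (cases "U i < hi i")
    case True
    have "0 - 0 \<le> D U h - D U 0" if "0 < h" "h < hi i - U i" for h
      using min[of h] U that unfolding between_def by (smt (verit))
    then show ?thesis
      by (intro compare[OF const0 DU, of "hi i - U i"]) (use True in auto)
  next
    case False
    then have "U i = b" using inactive(1) inboxD(2)[OF Uin, of i] by auto
    then have "- E \<le> - 0"
      by (intro compare[OF neg[OF DU] neg[OF Db], of "b - a"]) (use sub ab in auto)
    then show ?thesis by simp
  qed
  moreover have "E \<le> 0"
  proof (cases "lo i < U i")
    case True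
    have "0 - 0 \<le> D U (- h) - D U (- 0)" if "0 < h" "h < U i - lo i" for h
      using min[of "- h"] U that unfolding between_def by (smt (verit))
    then have "0 \<le> - E"
      by (intro compare[OF const0 neg[OF DU], of "U i - lo i"]) (use True in auto)
    then show ?thesis by simp
  next
    case False
    then have "U i = a" using inactive(2) inboxD(1)[OF Uin, of i] by auto
    then show ?thesis
      by (intro compare[OF DU Da, of "b - a"]) (use sub ab in auto)
  qed
  ultimately show ?thesis by simp
qed

end

section \<open>Differential calculus on finite products\<close>

lemma tendsto_fun:
  assumes "\<And>k. ((\<lambda>t. p t k) \<longlongrightarrow> u k) F"
  shows "(p \<longlongrightarrow> (u :: 'a \<Rightarrow> 'b::topological_space)) F"
proof -
  have "limitin (product_topology (\<lambda>_. euclidean) UNIV) p u F"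
    unfolding limitin_componentwise using assms by simp
  then show ?thesis
    by (simp add: euclidean_product_topology)
qed

lemma tendsto_continuous_RB:
  assumes "continuous_on (RB B) f" "\<And>t. p t \<in> RB B" "u \<in> RB B" "\<And>k. ((\<lambda>t. p t k) \<longlongrightarrow> u k) F"
  shows "((\<lambda>t. f (p t)) \<longlongrightarrow> f u) F"
  by (rule continuous_on_tendsto_compose[OF assms(1) tendsto_fun[OF assms(4)] assms(3)])
     (use assms(2) in simp)

text \<open>A product of compact sets, since coordinates off \<open>B\<close> range over the single
  value \<open>undefined\<close>.\<close>

lemma compact_box_RB: "compact {u \<in> RB B. \<forall>k\<in>B. u k \<in> {a..b::real}}"
proof -
  have "{u \<in> RB B. \<forall>k\<in>B. u k \<in> {a..b}} = PiE UNIV (\<lambda>k. if k \<in> B then {a..b} else {undefined})"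
    by (auto simp: PiE_iff extensional_def split: if_splits)
  moreover have "compactin (product_topology (\<lambda>_. euclidean) UNIV) \<dots>"
    by (rule compactin_PiE[THEN iffD2]) (simp add: compactin_euclidean_iff)
  ultimately show ?thesis
    by (simp only: euclidean_product_topology compactin_euclidean_iff)
qed

lemma C1_RB_partial:
  assumes f: "C1_RB B f" and u: "u \<in> RB B" and k: "k \<in> B"
  shows "((\<lambda>t. f (u(k := t))) has_real_derivative partial_deriv k f (u(k := t0))) (at t0)"
proof -
  have "u(k := t0) \<in> RB B" using u k by (auto simp: PiE_iff extensional_def)
  then have "(\<lambda>t. f (u(k := t0, k := t))) field_differentiable at ((u(k := t0)) k)"
    using f k unfolding C1_RB_def by blast
  then show ?thesis
    by (simp add: partial_deriv_def field_differentiable_derivI)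
qed

text \<open>\<open>C1_RB\<close> speaks of partial derivatives only, so the directional derivative
  is built up coordinate by coordinate: the mean value theorem handles the new coordinate, and
  continuity of its partial derivative absorbs the displacement of the others.\<close>

lemma C1_RB_chain_at_0:
  assumes f: "C1_RB B f" and u: "u \<in> RB B" and A: "finite A" "A \<subseteq> B"
  shows "((\<lambda>t. f (\<lambda>k\<in>B. u k + (if k \<in> A then t * w k else 0)))
    has_real_derivative (\<Sum>k\<in>A. w k * partial_deriv k f u)) (at 0)"
  using A
proof (induction A rule: finite_induct)
  case empty
  then show ?case by simp
next
  case (insert k A)
  define v where "v A t = (\<lambda>j\<in>B. u j + (if j \<in> A then t * w j else 0))" for A and t :: real
  have k: "k \<in> B" using insert by simp
  have vRB: "v A t \<in> RB B" for A t by (simp add: v_def)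
  have v0: "v A 0 = u" for A
    using u by (auto simp: v_def fun_eq_iff PiE_iff extensional_def)
  have v_insert: "v (insert k A) t = (v A t)(k := u k + t * w k)" for t
    using k by (auto simp: v_def fun_eq_iff)
  have v_k: "(v A t)(k := u k) = v A t" for t
    using k insert.hyps by (auto simp: v_def fun_eq_iff)
  have "\<exists>s\<in>{0..1}. f (v (insert k A) t) - f (v A t)
      = t * (w k * partial_deriv k f ((v A t)(k := u k + s * t * w k)))" for t
  proof -
    have "((\<lambda>s. f ((v A t)(k := u k + s * t * w k))) has_real_derivative
        partial_deriv k f ((v A t)(k := u k + s * t * w k)) * (t * w k)) (at s)" for s
      by (rule DERIV_chain2[OF C1_RB_partial[OF f vRB k]]) (auto intro!: derivative_eq_intros)
    from MVT2[OF zero_less_one this] obtain s where "0 < s" "s < 1"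
      "f ((v A t)(k := u k + 1 * t * w k)) - f ((v A t)(k := u k + 0 * t * w k))
        = (1 - 0) * (partial_deriv k f ((v A t)(k := u k + s * t * w k)) * (t * w k))"
      by blast
    then show ?thesis
      by (intro bexI[of _ s]) (auto simp: v_insert v_k)
  qed
  then obtain s where s: "\<And>t. s t \<in> {0..1}" "\<And>t. f (v (insert k A) t) - f (v A t)
      = t * (w k * partial_deriv k f ((v A t)(k := u k + s t * t * w k)))" by metis
  \<comment> \<open>The intermediate point \<open>s t\<close> is an arbitrary choice for each
    \<open>t\<close>; its boundedness is enough.\<close>
  have lim0: "((\<lambda>t. s t * t * w k) \<longlongrightarrow> 0) (at 0)"
  proof (rule Lim_null_comparison)
    show "\<forall>\<^sub>F t in at 0. norm (s t * t * w k) \<le> \<bar>t\<bar> * \<bar>w k\<bar>"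
      using s(1) by (intro always_eventually allI) (auto simp: abs_mult intro!: mult_right_mono mult_left_le_one_le)
    show "((\<lambda>t. \<bar>t\<bar> * \<bar>w k\<bar>) \<longlongrightarrow> 0) (at 0)"
      by (auto intro!: tendsto_eq_intros)
  qed
  have "((\<lambda>t. partial_deriv k f ((v A t)(k := u k + s t * t * w k))) \<longlongrightarrow> partial_deriv k f u) (at 0)"
  proof (rule tendsto_continuous_RB[of B "partial_deriv k f" "\<lambda>t. (v A t)(k := u k + s t * t * w k)" u])
    show "continuous_on (RB B) (partial_deriv k f)" using f k by (auto simp: C1_RB_def)
    show "(v A t)(k := u k + s t * t * w k) \<in> RB B" for t
      using vRB k by (auto simp: PiE_iff extensional_def)
    fix j
    show "((\<lambda>t. ((v A t)(k := u k + s t * t * w k)) j) \<longlongrightarrow> u j) (at 0)"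
    proof (cases "j = k")
      case True
      then show ?thesis
        using tendsto_add[OF tendsto_const[of "u k"] lim0] by simp
    next
      case False
      have "((\<lambda>t. u j + (if j \<in> A then t * w j else 0)) \<longlongrightarrow> u j) (at 0)"
        by (cases "j \<in> A") (auto intro!: tendsto_eq_intros)
      then show ?thesis
        using False u by (cases "j \<in> B") (auto simp: v_def PiE_iff extensional_def)
    qed
  qed (rule u)
  then have "((\<lambda>t. w k * partial_deriv k f ((v A t)(k := u k + s t * t * w k)))
      \<longlongrightarrow> w k * partial_deriv k f u) (at 0)"
    by (rule tendsto_mult_left)
  then have "((\<lambda>t. f (v (insert k A) t) - f (v A t)) has_real_derivative w k * partial_deriv k f u) (at 0)"
    unfolding has_field_derivative_iff
    by (rule Lim_transform_eventually) (auto simp: eventually_at_filter s(2) v0)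
  moreover have "((\<lambda>t. f (v A t)) has_real_derivative (\<Sum>k\<in>A. w k * partial_deriv k f u)) (at 0)"
    unfolding v_def by (rule insert.IH) (use insert.prems in simp)
  ultimately have "((\<lambda>t. (f (v (insert k A) t) - f (v A t)) + f (v A t)) has_real_derivative
      w k * partial_deriv k f u + (\<Sum>k\<in>A. w k * partial_deriv k f u)) (at 0)"
    by (rule DERIV_add)
  then have "((\<lambda>t. f (v (insert k A) t)) has_real_derivative
      (\<Sum>k\<in>insert k A. w k * partial_deriv k f u)) (at 0)"
    using insert.hyps by simp
  then show ?case
    unfolding v_def .
qed

lemma C1_RB_chain:
  assumes f: "C1_RB B f" and B: "finite B"
  shows "((\<lambda>t. f (\<lambda>k\<in>B. u k + t * w k)) has_real_derivative
    (\<Sum>k\<in>B. w k * partial_deriv k f (\<lambda>k\<in>B. u k + t0 * w k))) (at t0)"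
proof -
  let ?v = "\<lambda>k\<in>B. u k + t0 * w k"
  have "((\<lambda>t. f (\<lambda>k\<in>B. ?v k + (if k \<in> B then t * w k else 0))) has_real_derivative
      (\<Sum>k\<in>B. w k * partial_deriv k f ?v)) (at 0)"
    by (rule C1_RB_chain_at_0[OF f _ B]) auto
  moreover have "(\<lambda>k\<in>B. ?v k + (if k \<in> B then t * w k else 0)) = (\<lambda>k\<in>B. u k + (t + t0) * w k)" for t
    by (auto simp: fun_eq_iff algebra_simps)
  ultimately show ?thesis
    using DERIV_at_within_shift[of "\<lambda>t. f (\<lambda>k\<in>B. u k + t * w k)" _ t0 0 UNIV]
    by (simp add: add.commute)
qed

lemma C1_RB_Lipschitz:
  assumes f: "C1_RB B f" and B: "finite B"
  obtains G where "0 \<le> G"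
    "\<And>u v. (\<And>k. k \<in> B \<Longrightarrow> u k \<in> {a..b}) \<Longrightarrow> (\<And>k. k \<in> B \<Longrightarrow> v k \<in> {a..b::real}) \<Longrightarrow>
      \<bar>f (restrict v B) - f (restrict u B)\<bar> \<le> G * (\<Sum>k\<in>B. \<bar>v k - u k\<bar>)"
proof -
  let ?X = "{u \<in> RB B. \<forall>k\<in>B. u k \<in> {a..b}}"
  have "\<exists>G. \<forall>u\<in>?X. \<bar>partial_deriv k f u\<bar> \<le> G" if "k \<in> B" for k
  proof -
    have "continuous_on ?X (partial_deriv k f)"
      by (rule continuous_on_subset[of "RB B"]) (use f that in \<open>auto simp: C1_RB_def\<close>)
    then have "bounded (partial_deriv k f ` ?X)"
      by (intro compact_imp_bounded compact_continuous_image compact_box_RB)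
    then show ?thesis
      unfolding bounded_iff ball_simps real_norm_def by blast
  qed
  then have "\<forall>k\<in>B. \<exists>G. \<forall>u\<in>?X. \<bar>partial_deriv k f u\<bar> \<le> G"
    by blast
  from bchoice[OF this] obtain G where "\<forall>k\<in>B. \<forall>u\<in>?X. \<bar>partial_deriv k f u\<bar> \<le> G k" ..
  then have G: "\<And>k u. k \<in> B \<Longrightarrow> u \<in> ?X \<Longrightarrow> \<bar>partial_deriv k f u\<bar> \<le> G k"
    by blast
  define M where "M = (\<Sum>k\<in>B. \<bar>G k\<bar>)"
  have M: "0 \<le> M" by (simp add: M_def sum_nonneg)
  have GM: "\<bar>partial_deriv k f u\<bar> \<le> M" if "k \<in> B" "u \<in> ?X" for k u
  proof -
    have "\<bar>partial_deriv k f u\<bar> \<le> \<bar>G k\<bar>" using G[OF that] by simp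
    also have "\<dots> \<le> M" unfolding M_def by (rule member_le_sum) (use that B in auto)
    finally show ?thesis .
  qed
  have "\<bar>f (restrict v B) - f (restrict u B)\<bar> \<le> M * (\<Sum>k\<in>B. \<bar>v k - u k\<bar>)"
    if u: "\<And>k. k \<in> B \<Longrightarrow> u k \<in> {a..b}" and v: "\<And>k. k \<in> B \<Longrightarrow> v k \<in> {a..b}" for u v
  proof -
    let ?p = "\<lambda>t. \<lambda>k\<in>B. u k + t * (v k - u k)"
    obtain t where t: "0 < t" "t < 1"
      "f (?p 1) - f (?p 0) = (1 - 0) * (\<Sum>k\<in>B. (v k - u k) * partial_deriv k f (?p t))"
      using MVT2[OF zero_less_one C1_RB_chain[OF f B, of u "\<lambda>k. v k - u k"]] by blast
    have X: "?p t \<in> ?X"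
    proof -
      have "u k + t * (v k - u k) \<in> {a..b}" if "k \<in> B" for k
        using convexD_alt[OF convex_real_interval(5) u[OF that] v[OF that], of t] t(1,2)
        by (simp add: algebra_simps)
      then show ?thesis by auto
    qed
    have "?p 1 = restrict v B" "?p 0 = restrict u B" by (auto simp: fun_eq_iff)
    then have "\<bar>f (restrict v B) - f (restrict u B)\<bar> = \<bar>\<Sum>k\<in>B. (v k - u k) * partial_deriv k f (?p t)\<bar>"
      using t(3) by simp
    also have "\<dots> \<le> (\<Sum>k\<in>B. \<bar>v k - u k\<bar> * M)"
      by (rule order_trans[OF sum_abs sum_mono]) (simp add: abs_mult mult_left_mono GM[OF _ X])
    finally show ?thesis
      by (simp add: sum_distrib_left mult.commute)
  qed
  then show ?thesis
    using that[OF M] by blast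
qed

text \<open>With \<open>m\<close> the minimum, the excesses \<open>p\<close> and \<open>q\<close>
  have disjoint supports, and the claim concerns the mixed second difference of \<open>s\<close> at
  \<open>m\<close> in the directions \<open>p\<close> and \<open>q\<close>. Two mean value arguments
  turn it into mixed derivatives weighted by products of \<open>p\<close> and \<open>q\<close>;
  diagonal terms vanish. One statement covers both uses: \<kappa> = 0 gives plain submodularity
  without any order condition.\<close>

lemma C2_RB_submodular:
  fixes s :: "('a \<Rightarrow> real) \<Rightarrow> real"
  assumes s: "C2_RB B s" and B: "finite B"
    and neg: "\<And>u k j. u \<in> RB B \<Longrightarrow> k \<in> B \<Longrightarrow> j \<in> B \<Longrightarrow> k \<noteq> j \<Longrightarrow> partial_deriv k (partial_deriv j s) u \<le> 0"
    and kj: "k0 \<in> B" "j0 \<in> B" "k0 \<noteq> j0"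
    and \<kappa>: "\<And>u. u \<in> RB B \<Longrightarrow> (\<And>k. k \<in> B \<Longrightarrow> u k \<in> {a..b}) \<Longrightarrow> partial_deriv k0 (partial_deriv j0 s) u \<le> - \<kappa>"
    and u: "\<And>k. k \<in> B \<Longrightarrow> u k \<in> {a..b}" and v: "\<And>k. k \<in> B \<Longrightarrow> v k \<in> {a..b::real}"
    and le: "\<kappa> \<noteq> 0 \<Longrightarrow> u k0 \<le> v k0 \<and> v j0 \<le> u j0"
  shows "s (\<lambda>k\<in>B. min (u k) (v k)) + s (\<lambda>k\<in>B. max (u k) (v k)) + \<kappa> * (v k0 - u k0) * (u j0 - v j0)
    \<le> s (restrict u B) + s (restrict v B)"
proof -
  define m where "m k = min (u k) (v k)" for k
  define p where "p k = u k - m k" for k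
  define q where "q k = v k - m k" for k
  have pq: "0 \<le> p k" "0 \<le> q k" "p k = 0 \<or> q k = 0" for k
    by (auto simp: p_def q_def m_def)
  have C1: "C1_RB B s" "\<And>k. k \<in> B \<Longrightarrow> C1_RB B (partial_deriv k s)"
    using s by (auto simp: C2_RB_def)
  let ?pt = "\<lambda>t \<tau>. \<lambda>k\<in>B. m k + \<tau> * q k + t * p k"
  have ptRB: "?pt t \<tau> \<in> RB B" for t \<tau> by simp
  have box: "?pt t \<tau> k \<in> {a..b}" if "k \<in> B" "t \<in> {0..1}" "\<tau> \<in> {0..1}" for t \<tau> k
  proof -
    have "m k \<le> m k + \<tau> * q k + t * p k" using pq that by simp
    moreover have "m k + \<tau> * q k + t * p k \<le> max (u k) (v k)"
    proof -
      have "\<tau> * q k \<le> q k" "t * p k \<le> p k"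
        using pq that by (auto intro: mult_left_le_one_le)
      then show ?thesis by (auto simp: p_def q_def m_def)
    qed
    ultimately show ?thesis
      using u[OF that(1)] v[OF that(1)] that(1) by (auto simp: m_def)
  qed
  \<comment> \<open>The intermediate \<tau> depends on \<open>k\<close>, so the signs are exploited
    for each \<open>k\<close> before summing.\<close>
  have bracket: "\<exists>\<tau>\<in>{0..1}. partial_deriv k s (?pt t 1) - partial_deriv k s (?pt t 0)
      = (\<Sum>j\<in>B. q j * partial_deriv j (partial_deriv k s) (?pt t \<tau>))" if "k \<in> B" for k t
  proof -
    have e: "(\<lambda>k\<in>B. (m k + t * p k) + \<tau> * q k) = ?pt t \<tau>" for \<tau>
      by (auto simp: fun_eq_iff)
    have "((\<lambda>\<tau>. partial_deriv k s (?pt t \<tau>)) has_real_derivative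
        (\<Sum>j\<in>B. q j * partial_deriv j (partial_deriv k s) (?pt t \<tau>))) (at \<tau>)" for \<tau>
      using C1_RB_chain[OF C1(2)[OF that] B, of "\<lambda>k. m k + t * p k" q \<tau>] unfolding e .
    from MVT2[OF zero_less_one this] obtain \<tau> where "0 < \<tau>" "\<tau> < 1"
      "partial_deriv k s (?pt t 1) - partial_deriv k s (?pt t 0)
        = (1 - 0) * (\<Sum>j\<in>B. q j * partial_deriv j (partial_deriv k s) (?pt t \<tau>))"
      by blast
    then show ?thesis
      by (intro bexI[of _ \<tau>]) simp_all
  qed
  have le0: "partial_deriv k s (?pt t 1) - partial_deriv k s (?pt t 0) \<le> (if k = j0 then - \<kappa> * q k0 else 0)"
    if k: "k \<in> B" "p k > 0" and t: "t \<in> {0..1}" for k t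
  proof -
    obtain \<tau> where \<tau>: "\<tau> \<in> {0..1}" and eq: "partial_deriv k s (?pt t 1) - partial_deriv k s (?pt t 0)
        = (\<Sum>j\<in>B. q j * partial_deriv j (partial_deriv k s) (?pt t \<tau>))"
      using bracket[OF k(1)] by blast
    have nonpos: "q j * partial_deriv j (partial_deriv k s) (?pt t \<tau>) \<le> 0" if "j \<in> B" for j
    proof (cases "j = k")
      case True
      then show ?thesis using pq(3)[of k] k(2) by simp
    next
      case False
      then show ?thesis
        using neg[OF ptRB that k(1)] pq(2)[of j] by (simp add: mult_nonneg_nonpos)
    qed
    show ?thesis
    proof (cases "k = j0")
      case True
      \<comment> \<open>All terms are nonpositive; only the one at \<open>k0\<close>, which has the
        quantitative bound, is kept.\<close>
      have "(\<Sum>j\<in>B. q j * partial_deriv j (partial_deriv k s) (?pt t \<tau>))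
          \<le> (\<Sum>j\<in>{k0}. q j * partial_deriv j (partial_deriv k s) (?pt t \<tau>))"
        by (rule sum_mono2[where f = "\<lambda>j. - (q j * partial_deriv j (partial_deriv k s) (?pt t \<tau>))",
              unfolded sum_negf, THEN neg_le_iff_le[THEN iffD1]])
           (use B kj nonpos in auto)
      also have "\<dots> = q k0 * partial_deriv k0 (partial_deriv j0 s) (?pt t \<tau>)"
        using True by simp
      also have "\<dots> \<le> q k0 * - \<kappa>"
        by (intro mult_left_mono \<kappa>[OF ptRB] box) (use pq t \<tau> in auto)
      finally show ?thesis using True eq by (simp add: mult.commute)
    next
      case False
      then show ?thesis
        unfolding eq using sum_nonpos[of B "\<lambda>j. q j * partial_deriv j (partial_deriv k s) (?pt t \<tau>)"] nonpos by simp
    qed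
  qed
  have "((\<lambda>t. s (?pt t 1) - s (?pt t 0)) has_real_derivative
      (\<Sum>k\<in>B. p k * partial_deriv k s (?pt t 1)) - (\<Sum>k\<in>B. p k * partial_deriv k s (?pt t 0))) (at t)" for t
    by (intro DERIV_diff C1_RB_chain[OF C1(1) B])
  from MVT2[OF zero_less_one this] obtain t where t: "0 < t" "t < 1"
    and eq: "s (?pt 1 1) - s (?pt 1 0) - (s (?pt 0 1) - s (?pt 0 0)) = (1 - 0) *
      ((\<Sum>k\<in>B. p k * partial_deriv k s (?pt t 1)) - (\<Sum>k\<in>B. p k * partial_deriv k s (?pt t 0)))"
    by blast
  have "(\<Sum>k\<in>B. p k * partial_deriv k s (?pt t 1)) - (\<Sum>k\<in>B. p k * partial_deriv k s (?pt t 0))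
      = (\<Sum>k\<in>B. p k * (partial_deriv k s (?pt t 1) - partial_deriv k s (?pt t 0)))"
    by (simp add: sum_subtractf right_diff_distrib)
  also have "\<dots> \<le> (\<Sum>k\<in>B. p k * (if k = j0 then - \<kappa> * q k0 else 0))"
  proof (rule sum_mono)
    fix k assume k: "k \<in> B"
    show "p k * (partial_deriv k s (?pt t 1) - partial_deriv k s (?pt t 0)) \<le> p k * (if k = j0 then - \<kappa> * q k0 else 0)"
    proof (cases "p k = 0")
      case False
      then have "0 < p k" using pq(1)[of k] by simp
      then show ?thesis
        using le0[OF k, of t] t by (intro mult_left_mono) auto
    qed simp
  qed
  also have "\<dots> = (\<Sum>k\<in>B. if k = j0 then p j0 * (- \<kappa> * q k0) else 0)"
    by (intro sum.cong) auto
  also have "\<dots> = p j0 * (- \<kappa> * q k0)"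
    using B kj by simp
  also have "\<dots> = - (\<kappa> * (v k0 - u k0) * (u j0 - v j0))"
    using le by (cases "\<kappa> = 0") (auto simp: p_def q_def m_def min_def)
  finally have "s (?pt 1 1) - s (?pt 1 0) - (s (?pt 0 1) - s (?pt 0 0))
      \<le> - (\<kappa> * (v k0 - u k0) * (u j0 - v j0))"
    using eq by simp
  moreover have "?pt 1 1 = (\<lambda>k\<in>B. max (u k) (v k))" "?pt 1 0 = restrict u B" "?pt 0 1 = restrict v B"
    "?pt 0 0 = (\<lambda>k\<in>B. min (u k) (v k))"
    by (auto simp: fun_eq_iff p_def q_def m_def)
  ultimately show ?thesis by simp
qed

section \<open>Reduction to one dimension\<close>

lemma periodic_in_axis:
  fixes u :: "'n::finite config"
  assumes "periodic_in j u"
  shows "u (i + axis j m) = u i"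
proof (induction m rule: int_induct[where k = 0])
  case base
  have "axis j 0 = (0 :: int ^ 'n)" by (simp add: vec_eq_iff axis_def)
  show ?case unfolding \<open>axis j 0 = 0\<close> by simp
next
  have step: "u (i + axis j (m + 1)) = u (i + axis j m)" for m
  proof -
    have "i + axis j (m + 1) = i + axis j m + axis j 1" by (simp add: vec_eq_iff axis_def)
    then show ?thesis by (simp only: assms[unfolded periodic_in_def])
  qed
  {
    case (step1 m)
    then show ?case using step[of m] by simp
  next
    case (step2 m)
    then show ?case using step[of "m - 1"] by simp
  }
qed

lemma periodic_in_sum_axis:
  assumes "finite A" "\<forall>j\<in>A. periodic_in j u"
  shows "u (i + (\<Sum>j\<in>A. axis j (c j))) = u i"
  using assms
proof (induction A arbitrary: i rule: finite_induct)
  case (insert j A)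
  have "u (i + (\<Sum>j\<in>insert j A. axis j (c j))) = u ((i + axis j (c j)) + (\<Sum>j\<in>A. axis j (c j)))"
    using insert.hyps by (simp add: algebra_simps)
  also have "\<dots> = u i"
    using insert periodic_in_axis[of j u] by simp
  finally show ?case .
qed simp

lemma sum_axis_component: "(\<Sum>j\<in>UNIV. axis j ((i :: int ^ 'n::finite) $ j)) = i"
  by (simp add: vec_eq_iff axis_def sum.delta if_distrib cong: if_cong)

text \<open>By \<open>periodic_imp_lift\<close> these are all configurations that are 1-periodic in
  the directions other than \<open>d\<close>.\<close>

definition lift :: "'n \<Rightarrow> (int \<Rightarrow> real) \<Rightarrow> 'n::finite config" where
  "lift d x = (\<lambda>j. x (j $ d))"

lemma lift_T [simp]: "lift d x (T d i) = x i"
  by (simp add: lift_def T_def axis_def)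

lemma periodic_in_lift: "j \<noteq> d \<Longrightarrow> periodic_in j (lift d x)"
  by (simp add: periodic_in_def lift_def axis_def)

lemma periodic_imp_lift:
  fixes u :: "'n::finite config"
  assumes "\<forall>j. j \<noteq> d \<longrightarrow> periodic_in j u"
  shows "u = lift d (\<lambda>m. u (T d m))"
proof
  fix i :: "int ^ 'n"
  have "i = axis d (i $ d) + (\<Sum>j\<in>UNIV - {d}. axis j (i $ j))"
    using sum_axis_component[of i] by (simp add: sum.remove[of UNIV d])
  then have "u i = u (axis d (i $ d) + (\<Sum>j\<in>UNIV - {d}. axis j (i $ j)))"
    by simp
  also have "\<dots> = u (axis d (i $ d))"
    by (rule periodic_in_sum_axis) (use assms in auto)
  finally show "u i = lift d (\<lambda>m. u (T d m)) i"
    by (simp add: lift_def T_def)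
qed

lemma periodic_imp_const:
  fixes u :: "'n::finite config"
  assumes "\<forall>j. periodic_in j u"
  shows "u = (\<lambda>_. u 0)"
proof
  fix i :: "int ^ 'n"
  have "u (0 + (\<Sum>j\<in>UNIV. axis j (i $ j))) = u 0"
    by (rule periodic_in_sum_axis) (use assms in auto)
  then show "u i = u 0" by (simp add: sum_axis_component)
qed

text \<open>Subtracting \<open>c0\<close> gives the constants in \<open>M0\<close> energy 0, as
  \<open>chain\<close> demands.\<close>

definition site_energy :: "nat \<Rightarrow> 'n::finite \<Rightarrow> ('n config \<Rightarrow> real) \<Rightarrow> (int \<Rightarrow> real) \<Rightarrow> real" where
  "site_energy r d s y = s (\<lambda>k\<in>l1ball r. y (k $ d)) - c0 r s"

lemma S_loc_lift: "S_loc r s (T d j) (lift d x) - c0 r s = site_energy r d s (sh j x)"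
  by (simp add: S_loc_def site_energy_def lift_def sh_def T_def axis_def add.commute)

lemma J1_part_lift: "J1_part r d s p q (lift d x) = J (site_energy r d s) p q x"
  by (simp add: J1_part_def J_def S_loc_lift)

text \<open>The bound holds for the upper limit, which dominates the lower limit because the product
  filter is nontrivial.\<close>

lemma J1_lift_le:
  assumes "J_le_at_ends (site_energy r d s) c x"
  shows "J1 r d s (lift d x) \<le> ereal c"
proof (rule ereal_le_epsilon2)
  fix e :: real assume "0 < e"
  then obtain P where P: "\<forall>p\<le>-P. \<forall>q\<ge>P. J (site_energy r d s) p q x \<le> c + e"
    using assms unfolding J_le_at_ends_def by blast
  let ?X = "\<lambda>(p, q). ereal (J1_part r d s p q (lift d x))"
  have "eventually (\<lambda>pq. ?X pq \<le> ereal (c + e)) (at_bot \<times>\<^sub>F at_top)"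
    unfolding eventually_prod_filter
    by (rule exI[of _ "\<lambda>p. p \<le> - P"], rule exI[of _ "\<lambda>q. P \<le> q"])
       (use P in \<open>auto simp: J1_part_lift eventually_le_at_bot eventually_ge_at_top\<close>)
  then have "Limsup (at_bot \<times>\<^sub>F at_top) ?X \<le> ereal (c + e)"
    by (rule Limsup_bounded)
  moreover have "Liminf (at_bot \<times>\<^sub>F at_top) ?X \<le> Limsup (at_bot \<times>\<^sub>F at_top) ?X"
    by (rule Liminf_le_Limsup) (simp add: prod_filter_eq_bot)
  ultimately show "J1 r d s (lift d x) \<le> ereal c + ereal e"
    unfolding J1_def by simp
qed

lemma J1_lift_ge:
  assumes "J_ge_at_ends (site_energy r d s) c x"
  shows "ereal c \<le> J1 r d s (lift d x)"
proof (rule ereal_le_epsilon2)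
  fix e :: real assume "0 < e"
  then obtain P where P: "\<forall>p\<le>-P. \<forall>q\<ge>P. c - e \<le> J (site_energy r d s) p q x"
    using assms unfolding J_ge_at_ends_def by blast
  let ?X = "\<lambda>(p, q). ereal (J1_part r d s p q (lift d x))"
  have "eventually (\<lambda>pq. ereal (c - e) \<le> ?X pq) (at_bot \<times>\<^sub>F at_top)"
    unfolding eventually_prod_filter
    by (rule exI[of _ "\<lambda>p. p \<le> - P"], rule exI[of _ "\<lambda>q. P \<le> q"])
       (use P in \<open>auto simp: J1_part_lift eventually_le_at_bot eventually_ge_at_top\<close>)
  then have "ereal (c - e) \<le> J1 r d s (lift d x)"
    unfolding J1_def by (rule Liminf_bounded)
  then have "ereal (c - e) + ereal e \<le> J1 r d s (lift d x) + ereal e"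
    by (rule add_right_mono)
  then show "ereal c \<le> J1 r d s (lift d x) + ereal e" by simp
qed

lemma lift_in_Gamma1_iff:
  "lift d x \<in> Gamma1 d (\<lambda>_. a) (\<lambda>_. b) (\<lambda>_. \<alpha>) (\<lambda>_. \<beta>) \<longleftrightarrow>
    inbox a b x \<and> (x \<longlongrightarrow> \<alpha>) at_bot \<and> (x \<longlongrightarrow> \<beta>) at_top"
proof -
  have "((\<lambda>i. dist_T d i (lift d x) (\<lambda>_. t)) \<longlongrightarrow> 0) F \<longleftrightarrow> (x \<longlongrightarrow> t) F" for t F
    by (simp add: dist_T_def tendsto_rabs_zero_iff LIM_zero_iff)
  moreover have "((\<lambda>_. a) \<le> lift d x \<and> lift d x \<le> (\<lambda>_. b)) \<longleftrightarrow> inbox a b x"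
  proof -
    have "(\<forall>j :: int ^ 'a. a \<le> x (j $ d) \<and> x (j $ d) \<le> b) \<longleftrightarrow> (\<forall>i. a \<le> x i \<and> x i \<le> b)"
      by (metis axis_nth)
    then show ?thesis by (auto simp: le_fun_def lift_def inbox_def)
  qed
  ultimately show ?thesis
    by (auto simp: Gamma1_def Gamma1_hat_def periodic_in_lift)
qed

lemma Gamma1_imp_lift: "u \<in> Gamma1 d v w \<alpha> \<beta> \<Longrightarrow> \<exists>x. u = lift d x"
  using periodic_imp_lift[of d u] by (auto simp: Gamma1_def Gamma1_hat_def)

lemma l1ball_component: "k \<in> l1ball r \<Longrightarrow> k $ d \<in> {- int r..int r}"
proof -
  assume "k \<in> l1ball r"
  then have "(\<Sum>j\<in>UNIV. \<bar>k $ j\<bar>) \<le> int r" by (simp add: l1ball_def l1norm_def)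
  moreover have "\<bar>k $ d\<bar> \<le> (\<Sum>j\<in>UNIV. \<bar>k $ j\<bar>)"
    by (rule member_le_sum) auto
  ultimately show ?thesis by auto
qed

lemma l1norm_axis: "l1norm (axis d (c :: int)) = \<bar>c\<bar>"
proof -
  have "(\<Sum>k\<in>UNIV. \<bar>axis d c $ k\<bar>) = (\<Sum>k\<in>UNIV. if k = d then \<bar>c\<bar> else 0)"
    by (rule sum.cong) (auto simp: axis_def)
  then show ?thesis by (simp add: l1norm_def)
qed

text \<open>The left-hand side of the Euler-Lagrange equation for configurations depending only on the
  coordinate \<open>d\<close>.\<close>

definition EL_term :: "nat \<Rightarrow> 'n::finite \<Rightarrow> ('n config \<Rightarrow> real) \<Rightarrow> (int \<Rightarrow> real) \<Rightarrow> int \<Rightarrow> real" where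
  "EL_term r d s x i = (\<Sum>k\<in>l1ball r. partial_deriv k s (\<lambda>k'\<in>l1ball r. x (i - k $ d + k' $ d)))"

lemma EL_solution_lift:
  assumes "\<And>i. EL_term r d s x i = 0"
  shows "EL_solution r s (lift d x :: 'n::finite config)"
  unfolding EL_solution_def
proof
  fix \<iota> :: "int ^ 'n"
  have term_eq: "partial_deriv \<iota> (S_loc r s j) (lift d x) =
      partial_deriv (\<iota> - j) s (\<lambda>k\<in>l1ball r. x (j $ d + k $ d))" if "\<iota> - j \<in> l1ball r" for j
  proof -
    have "S_loc r s j ((lift d x)(\<iota> := t)) = s ((\<lambda>k\<in>l1ball r. x (j $ d + k $ d))(\<iota> - j := t))" for t
      unfolding S_loc_def
      by (rule arg_cong[of _ _ s]) (use that in \<open>auto simp: fun_eq_iff lift_def algebra_simps\<close>)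
    moreover have "lift d x \<iota> = (\<lambda>k\<in>l1ball r. x (j $ d + k $ d)) (\<iota> - j)"
      using that by (simp add: lift_def)
    ultimately show ?thesis
      by (simp only: partial_deriv_def)
  qed
  have "(\<Sum>j | l1norm (j - \<iota>) \<le> int r. partial_deriv \<iota> (S_loc r s j) (lift d x)) = EL_term r d s x (\<iota> $ d)"
    unfolding EL_term_def
  proof (rule sum.reindex_bij_witness[of _ "\<lambda>k. \<iota> - k" "\<lambda>j. \<iota> - j"])
    have sym: "l1norm (v - w) = l1norm (w - v)" for v w :: "int ^ 'n"
      by (simp add: l1norm_def abs_minus_commute)
    show "\<iota> - j \<in> l1ball r" if "j \<in> {j. l1norm (j - \<iota>) \<le> int r}" for j
      using that sym[of j \<iota>] by (simp add: l1ball_def)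
    show "\<iota> - k \<in> {j. l1norm (j - \<iota>) \<le> int r}" if "k \<in> l1ball r" for k
      using that sym[of "\<iota> - k" \<iota>] by (simp add: l1ball_def)
    show "partial_deriv (\<iota> - j) s (\<lambda>k'\<in>l1ball r. x (\<iota> $ d - (\<iota> - j) $ d + k' $ d))
        = partial_deriv \<iota> (S_loc r s j) (lift d x)" if "j \<in> {j. l1norm (j - \<iota>) \<le> int r}" for j
      using that sym[of j \<iota>] by (subst term_eq) (auto simp: l1ball_def)
  qed auto
  then show "(\<Sum>j | l1norm (j - \<iota>) \<le> int r. partial_deriv \<iota> (S_loc r s j) (lift d x)) = 0"
    using assms by simp
qed

text \<open>Changing \<open>x\<close> at \<open>i\<close> moves a whole hyperplane of lattice sites,
  but energy is summed along one axis only. The axis site \<open>j\<close> reads \<open>x i\<close>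
  through all \<open>k\<close> with \<open>k $ d = i - j\<close>; over all \<open>j\<close> each
  \<open>k\<close> of the ball occurs once, as in the equation at a single lattice site.\<close>

lemma EL_term_derivative:
  fixes s :: "'n::finite config \<Rightarrow> real"
  assumes "C1_RB (l1ball r) s"
  shows "((\<lambda>h. J (site_energy r d s) (i - int r) (i + int r) (x(i := x i + h)))
    has_real_derivative EL_term r d s x i) (at 0)"
proof -
  let ?B = "l1ball r :: (int ^ 'n) set"
  let ?v = "\<lambda>j. \<lambda>k\<in>?B. x (k $ d + j)"
  have "((\<lambda>h. site_energy r d s (sh j (x(i := x i + h)))) has_real_derivative
      (\<Sum>k\<in>?B. (if k $ d + j = i then 1 else 0) * partial_deriv k s (?v j))) (at 0)" for j
  proof -
    have "site_energy r d s (sh j (x(i := x i + h)))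
        = s (\<lambda>k\<in>?B. x (k $ d + j) + h * (if k $ d + j = i then 1 else 0)) - c0 r s" for h
      unfolding site_energy_def sh_def
      by (rule arg_cong[of _ _ "\<lambda>y. s y - c0 r s"]) (auto simp: fun_eq_iff)
    then show ?thesis
      using DERIV_diff[OF C1_RB_chain[OF assms finite_l1ball, of "\<lambda>k. x (k $ d + j)"
            "\<lambda>k. if k $ d + j = i then 1 else 0" 0] DERIV_const[of "c0 r s"]]
      by (simp only: mult_zero_left add_0_right diff_0_right)
  qed
  then have "((\<lambda>h. J (site_energy r d s) (i - int r) (i + int r) (x(i := x i + h))) has_real_derivative
      (\<Sum>j=i - int r..i + int r. \<Sum>k\<in>?B. (if k $ d + j = i then 1 else 0) * partial_deriv k s (?v j))) (at 0)"
    unfolding J_def by (intro DERIV_sum)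
  also have "(\<Sum>j=i - int r..i + int r. \<Sum>k\<in>?B. (if k $ d + j = i then 1 else 0) * partial_deriv k s (?v j))
      = (\<Sum>k\<in>?B. \<Sum>j=i - int r..i + int r. if j = i - k $ d then partial_deriv k s (?v (i - k $ d)) else 0)"
    by (subst sum.swap) (auto intro!: sum.cong)
  also have "\<dots> = EL_term r d s x i"
    unfolding EL_term_def
  proof (rule sum.cong[OF refl])
    fix k assume "k \<in> ?B"
    then have "i - k $ d \<in> {i - int r..i + int r}"
      using l1ball_component[of k r d] by auto
    then show "(\<Sum>j=i - int r..i + int r. if j = i - k $ d then partial_deriv k s (?v (i - k $ d)) else 0)
        = partial_deriv k s (\<lambda>k'\<in>?B. x (i - k $ d + k' $ d))"
      by (simp add: add.commute)
  qed
  finally show ?thesis .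
qed

lemma c0_le_const:
  assumes "S2 r s"
  shows "c0 r s \<le> s (\<lambda>k\<in>l1ball r. t)"
proof -
  have "bdd_below (s ` RB (l1ball r))" using assms by (simp add: S2_def)
  then have "bdd_below (S_loc r s 0 ` {u. \<forall>j. periodic_in j u})"
    by (rule bdd_below_mono) (auto simp: S_loc_def)
  then have "c0 r s \<le> S_loc r s 0 (\<lambda>_. t)"
    unfolding c0_def by (rule cINF_lower) (simp add: periodic_in_def)
  then show ?thesis by (simp add: S_loc_def)
qed

text \<open>At a constant the sum of all partial derivatives is the derivative of \<open>s\<close>
  along the diagonal, where \<open>s\<close> attains its minimum \<open>c0\<close>.\<close>

lemma EL_term_const:
  fixes s :: "'n::finite config \<Rightarrow> real"
  assumes "C1_RB (l1ball r) s" "S2 r s" and t: "s (\<lambda>k\<in>l1ball r. t) = c0 r s"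
  shows "EL_term r d s (\<lambda>_. t) i = 0"
proof -
  have "((\<lambda>h. s (\<lambda>k\<in>l1ball r. t + h * 1)) has_real_derivative
      (\<Sum>k\<in>l1ball r. 1 * partial_deriv k s (\<lambda>k\<in>l1ball r. t + 0 * 1))) (at 0)"
    by (rule C1_RB_chain[OF assms(1) finite_l1ball])
  then have "(\<Sum>k\<in>l1ball r. 1 * partial_deriv k s (\<lambda>k\<in>l1ball r. t + 0 * 1)) = 0"
    by (rule DERIV_local_min[OF _ zero_less_one]) (use c0_le_const[OF assms(2)] t in simp)
  then show ?thesis by (simp add: EL_term_def)
qed

lemma M0_imp_const:
  assumes "v \<in> M0 r s"
  obtains a where "v = (\<lambda>_. a)" "s (\<lambda>k\<in>l1ball r. a) = c0 r s"
proof -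
  have "v = (\<lambda>_. v 0)" using assms by (intro periodic_imp_const) (simp add: M0_def)
  moreover have "S_loc r s 0 (\<lambda>_. v 0) = c0 r s"
    using assms calculation by (simp add: M0_def)
  ultimately show ?thesis
    using that[of "v 0"] by (simp add: S_loc_def)
qed

text \<open>A constant of zero energy strictly between \<open>a\<close> and \<open>b\<close> would
  lie in \<open>M0\<close>, against adjacency; this is \<open>f_pos\<close>. The remaining constants
  come from compactness of the box of values in [a, b].\<close>

lemma chain_site_energy:
  fixes s :: "'n::finite config \<Rightarrow> real"
  assumes "r \<ge> 1" and s: "C2_RB (l1ball r) s" and S2: "S2 r s" and S3: "S3 r s"
    and adj: "adjacent (M0 r s) (\<lambda>_. a) (\<lambda>_. b)"
  obtains \<Lambda> \<kappa> where "chain (site_energy r d s) r a b \<Lambda> \<kappa>"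
proof -
  let ?B = "l1ball r :: (int ^ 'n) set" and ?f = "site_energy r d s"
  have C1: "C1_RB ?B s" using s by (simp add: C2_RB_def)
  have ab: "a < b" using adj by (auto simp: adjacent_def pless_def)
  have const: "?f (\<lambda>_. t) = s (\<lambda>k\<in>?B. t) - c0 r s" for t by (simp add: site_energy_def)
  have M0_iff: "(\<lambda>_. t) \<in> M0 r s \<longleftrightarrow> s (\<lambda>k\<in>?B. t) = c0 r s" for t
    by (simp add: M0_def periodic_in_def S_loc_def)
  obtain G where G: "0 \<le> G"
    "\<And>u v. (\<And>k. k \<in> ?B \<Longrightarrow> u k \<in> {a..b}) \<Longrightarrow> (\<And>k. k \<in> ?B \<Longrightarrow> v k \<in> {a..b}) \<Longrightarrow>
      \<bar>s (restrict v ?B) - s (restrict u ?B)\<bar> \<le> G * (\<Sum>k\<in>?B. \<bar>v k - u k\<bar>)"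
    using C1_RB_Lipschitz[OF C1 finite_l1ball, of a b] by blast
  have e_in: "axis d \<sigma> \<in> ?B" "axis d \<sigma> \<noteq> 0" "l1norm (axis d \<sigma> :: int ^ 'n) = 1" "axis d \<sigma> $ d = \<sigma>"
    if "\<sigma> \<in> {1, -1}" for \<sigma> :: int
  proof -
    show "axis d \<sigma> \<in> ?B" "l1norm (axis d \<sigma> :: int ^ 'n) = 1"
      using that \<open>r \<ge> 1\<close> by (auto simp only: l1ball_def l1norm_axis mem_Collect_eq)
    show "axis d \<sigma> \<noteq> 0" "axis d \<sigma> $ d = \<sigma>"
      using that by (auto simp: axis_def vec_eq_iff)
  qed
  have zero_in: "0 \<in> ?B" by (simp add: l1ball_def l1norm_def)
  have neg: "partial_deriv k (partial_deriv j s) u \<le> 0"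
    if "u \<in> RB ?B" "k \<in> ?B" "j \<in> ?B" "k \<noteq> j" for u k j
    using bspec[OF S3[unfolded S3_def] that(1), THEN conjunct1] that(2-) by simp
  let ?X = "{u \<in> RB ?B. \<forall>k\<in>?B. u k \<in> {a..b}}"
  \<comment> \<open>A continuous negative function on a compact set attains a negative
    maximum.\<close>
  have "\<exists>\<kappa>>0. \<forall>u\<in>?X. partial_deriv 0 (partial_deriv (axis d \<sigma>) s) u \<le> - \<kappa>"
    if \<sigma>: "\<sigma> \<in> {1, -1}" for \<sigma>
  proof -
    have "C1_RB ?B (partial_deriv (axis d \<sigma>) s)"
      using s e_in(1)[OF \<sigma>] by (simp add: C2_RB_def)
    then have "continuous_on (RB ?B) (partial_deriv 0 (partial_deriv (axis d \<sigma>) s))"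
      using zero_in unfolding C1_RB_def by blast
    then have cont: "continuous_on ?X (partial_deriv 0 (partial_deriv (axis d \<sigma>) s))"
      by (rule continuous_on_subset) blast
    have "(\<lambda>k\<in>?B. a) \<in> ?X" using ab by simp
    then have "?X \<noteq> {}" by blast
    from continuous_attains_sup[OF compact_box_RB this cont] obtain u where u: "u \<in> ?X"
      "\<forall>v\<in>?X. partial_deriv 0 (partial_deriv (axis d \<sigma>) s) v \<le> partial_deriv 0 (partial_deriv (axis d \<sigma>) s) u"
      by blast
    have "u \<in> RB ?B" using u(1) by simp
    from bspec[OF S3[unfolded S3_def] this, THEN conjunct2]
    have "partial_deriv 0 (partial_deriv (axis d \<sigma>) s) u < 0"
      using e_in(3)[OF \<sigma>] by simp
    then show ?thesis
      using u(2) by (intro exI[of _ "- partial_deriv 0 (partial_deriv (axis d \<sigma>) s) u"]) simp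
  qed
  note \<kappa>_ex = this
  obtain \<kappa>1 where \<kappa>1: "0 < \<kappa>1" "\<forall>u\<in>?X. partial_deriv 0 (partial_deriv (axis d 1) s) u \<le> - \<kappa>1"
    using \<kappa>_ex[of 1] by blast
  obtain \<kappa>2 where \<kappa>2: "0 < \<kappa>2" "\<forall>u\<in>?X. partial_deriv 0 (partial_deriv (axis d (- 1)) s) u \<le> - \<kappa>2"
    using \<kappa>_ex[of "-1"] by blast
  define \<kappa> where "\<kappa> = min \<kappa>1 \<kappa>2"
  have \<kappa>: "0 < \<kappa>" using \<kappa>1(1) \<kappa>2(1) by (simp add: \<kappa>_def)
  have \<kappa>_le: "partial_deriv 0 (partial_deriv (axis d \<sigma>) s) u \<le> - \<kappa>"
    if "\<sigma> \<in> {1, -1}" "u \<in> ?X" for \<sigma> u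
  proof -
    have "\<sigma> = 1 \<or> \<sigma> = - 1" using that(1) by simp
    then show ?thesis
    proof
      assume "\<sigma> = 1"
      then show ?thesis using bspec[OF \<kappa>1(2) that(2)] by (simp add: \<kappa>_def)
    next
      assume "\<sigma> = - 1"
      then show ?thesis using bspec[OF \<kappa>2(2) that(2)] by (simp add: \<kappa>_def)
    qed
  qed
  have strict: "?f (\<lambda>i. min (x i) (y i)) + ?f (\<lambda>i. max (x i) (y i)) + \<kappa> * (y 0 - x 0) * (x \<sigma> - y \<sigma>)
      \<le> ?f x + ?f y"
    if xy: "inbox a b x" "inbox a b y" and \<sigma>: "\<sigma> \<in> {1, -1}" and le: "x 0 \<le> y 0" "y \<sigma> \<le> x \<sigma>" for x y \<sigma>
  proof -
    have "s (\<lambda>k\<in>?B. min (x (k $ d)) (y (k $ d))) + s (\<lambda>k\<in>?B. max (x (k $ d)) (y (k $ d)))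
        + \<kappa> * (y (0 $ d) - x (0 $ d)) * (x (axis d \<sigma> $ d) - y (axis d \<sigma> $ d))
        \<le> s (restrict (\<lambda>k. x (k $ d)) ?B) + s (restrict (\<lambda>k. y (k $ d)) ?B)"
    proof (rule C2_RB_submodular[OF s finite_l1ball neg, where a = a and b = b])
      show "partial_deriv 0 (partial_deriv (axis d \<sigma>) s) u \<le> - \<kappa>"
        if "u \<in> RB ?B" "\<And>k. k \<in> ?B \<Longrightarrow> u k \<in> {a..b}" for u
        using \<kappa>_le[OF \<sigma>] that by blast
    qed (use xy le e_in[OF \<sigma>] zero_in in \<open>auto simp: inbox_def\<close>)
    then show ?thesis
      using e_in(4)[OF \<sigma>] by (simp add: site_energy_def)
  qed
  have "chain ?f r a b (G * card ?B) \<kappa>"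
  proof
    show "a < b" "0 < \<kappa>" by fact+
    show "0 \<le> G * card ?B" using G(1) by simp
    show "?f (\<lambda>_. a) = 0" "?f (\<lambda>_. b) = 0"
      using adj M0_iff by (auto simp: adjacent_def const)
    show "0 < ?f (\<lambda>_. t)" if "a < t" "t < b" for t
    proof -
      have "(\<lambda>_. t) \<notin> M0 r s"
      proof
        assume "(\<lambda>_. t) \<in> M0 r s"
        moreover have "pless (\<lambda>_. a) (\<lambda>_ :: int ^ 'n. t)" "pless (\<lambda>_ :: int ^ 'n. t) (\<lambda>_. b)"
          using that by (simp_all add: pless_def)
        ultimately show False
          using adj unfolding adjacent_def by blast
      qed
      then show ?thesis
        using c0_le_const[OF S2, of t] by (simp add: const M0_iff)
    qed
    fix x y :: "int \<Rightarrow> real"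
    assume xy: "inbox a b x" "inbox a b y"
    have "\<bar>?f x - ?f y\<bar> \<le> G * (\<Sum>k\<in>?B. \<bar>x (k $ d) - y (k $ d)\<bar>)"
      using G(2)[of "\<lambda>k. y (k $ d)" "\<lambda>k. x (k $ d)"] xy by (simp add: site_energy_def inbox_def)
    also have "\<dots> \<le> G * (\<Sum>k\<in>?B. \<Sum>i=-int r..int r. \<bar>x i - y i\<bar>)"
    proof (intro mult_left_mono sum_mono G(1))
      fix k assume "k \<in> ?B"
      then show "\<bar>x (k $ d) - y (k $ d)\<bar> \<le> (\<Sum>i=-int r..int r. \<bar>x i - y i\<bar>)"
        using l1ball_component[of k r d] by (intro member_le_sum) auto
    qed
    finally show "\<bar>?f x - ?f y\<bar> \<le> G * card ?B * (\<Sum>i=-int r..int r. \<bar>x i - y i\<bar>)"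
      by simp
    show "?f (\<lambda>i. min (x i) (y i)) + ?f (\<lambda>i. max (x i) (y i)) \<le> ?f x + ?f y"
    proof -
      \<comment> \<open>The case \<kappa> = 0, with an arbitrary pair of neighbours as the
        distinguished coordinates.\<close>
      have "s (\<lambda>k\<in>?B. min (x (k $ d)) (y (k $ d))) + s (\<lambda>k\<in>?B. max (x (k $ d)) (y (k $ d)))
          + 0 * (y (0 $ d) - x (0 $ d)) * (x (axis d 1 $ d) - y (axis d 1 $ d))
          \<le> s (restrict (\<lambda>k. x (k $ d)) ?B) + s (restrict (\<lambda>k. y (k $ d)) ?B)"
        by (rule C2_RB_submodular[OF s finite_l1ball neg zero_in, where a = a and b = b])
           (use xy neg e_in[of 1] zero_in in \<open>auto simp: inbox_def\<close>)
      then show ?thesis by (simp add: site_energy_def)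
    qed
    show "?f (\<lambda>i. min (x i) (y i)) + ?f (\<lambda>i. max (x i) (y i)) + \<kappa> * (y 0 - x 0) * (x \<sigma> - y \<sigma>)
        \<le> ?f x + ?f y" if "\<sigma> \<in> {1, -1}" "x 0 \<le> y 0" "y \<sigma> \<le> x \<sigma>" for \<sigma>
      by (rule strict[OF xy that])
  qed
  then show ?thesis by (rule that)
qed

theorem theorem2p8:
  fixes r :: nat and d :: "'n::finite" and s :: "'n config \<Rightarrow> real"
    and v0 w0 :: "'n config" and \<rho>1 \<rho>2 \<rho>3 \<rho>4 :: real
  assumes "CARD('n) \<ge> 2" and "r \<ge> 1"
    and "C2_RB (l1ball r) s" and "S1 r s" and "S2 r s" and "S3 r s"
    and gap0: "adjacent (M0 r s) v0 w0"
    and gap1: "\<exists>v1 w1. adjacent (M1 r d s v0 w0 v0 w0) v1 w1"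
      "\<exists>v1 w1. adjacent (M1 r d s v0 w0 w0 v0) v1 w1"
    and "\<rho>1 \<in> {0<..<rho_bar d v0 w0}" and "\<rho>1 \<notin> rho_minus d v0 ` M1 r d s v0 w0 v0 w0"
    and "\<rho>2 \<in> {0<..<rho_bar d v0 w0}" and "\<rho>2 \<notin> rho_plus d w0 ` M1 r d s v0 w0 v0 w0"
    and "\<rho>3 \<in> {0<..<rho_bar d v0 w0}" and "\<rho>3 \<notin> rho_plus d w0 ` M1 r d s v0 w0 w0 v0"
    and "\<rho>4 \<in> {0<..<rho_bar d v0 w0}" and "\<rho>4 \<notin> rho_minus d v0 ` M1 r d s v0 w0 w0 v0"
  shows "\<exists>l0::nat. \<forall>l\<ge>l0. \<exists>N::int. \<forall>m1 m2 m3 m4 :: int.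
    m1 < m2 \<and> m2 < m2 + 2 * int l \<and> m2 + 2 * int l < m3 \<and> m3 < m4 \<longrightarrow>
    (\<exists>U \<in> Y d v0 w0 \<rho>1 \<rho>2 \<rho>3 \<rho>4 m1 m2 m3 m4 l.
       J1 r d s U = (INF u\<in>Y d v0 w0 \<rho>1 \<rho>2 \<rho>3 \<rho>4 m1 m2 m3 m4 l. J1 r d s u) \<and>
       (m2 - m1 \<ge> N \<and> m4 - m3 \<ge> N \<longrightarrow> EL_solution r s U))"
proof -
  have C1: "C1_RB (l1ball r) s" using assms(3) by (simp add: C2_RB_def)
  have "v0 \<in> M0 r s" "w0 \<in> M0 r s" using gap0 by (auto simp: adjacent_def)
  then obtain a b where v0: "v0 = (\<lambda>_. a)" and a: "s (\<lambda>k\<in>l1ball r. a) = c0 r s"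
    and w0: "w0 = (\<lambda>_. b)" and b: "s (\<lambda>k\<in>l1ball r. b) = c0 r s"
    by (metis M0_imp_const)
  note vw = v0 w0
  have ab: "a < b" using gap0 by (auto simp: adjacent_def pless_def vw)
  obtain \<Lambda> \<kappa> where "chain (site_energy r d s) r a b \<Lambda> \<kappa>"
    using chain_site_energy[OF assms(2,3,5,6) gap0[unfolded vw]] by blast
  then interpret chain "site_energy r d s" r a b \<Lambda> \<kappa> .
  have \<rho>: "\<rho>1 \<in> {0<..<b - a}" "\<rho>2 \<in> {0<..<b - a}" "\<rho>3 \<in> {0<..<b - a}" "\<rho>4 \<in> {0<..<b - a}"
    using assms(10,12,14,16) ab by (auto simp: rho_bar_def dist_T_def vw)
  \<comment> \<open>\<open>minval\<close> bounds \<open>J1\<close> from below on all of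
    \<open>Gamma1\<close>, since its elements are lifts of asymptotic sequences; a lift whose upper
    limit is at most \<open>minval\<close> therefore attains \<open>c1\<close>.\<close>
  have M1I: "lift d x \<in> M1 r d s v0 w0 (\<lambda>_. \<alpha>) (\<lambda>_. \<beta>)"
    if x: "inbox a b x" "(x \<longlongrightarrow> \<alpha>) at_bot" "(x \<longlongrightarrow> \<beta>) at_top" and ends: "\<alpha> \<in> {a, b}" "\<beta> \<in> {a, b}"
      and le: "J_le_at_ends (site_energy r d s) (minval (site_energy r d s) r \<alpha> \<beta> (\<lambda>_. a) (\<lambda>_. b)) x"
    for x \<alpha> \<beta>
  proof -
    let ?c = "minval (site_energy r d s) r \<alpha> \<beta> (\<lambda>_. a) (\<lambda>_. b)"
    have \<Gamma>: "lift d x \<in> Gamma1 d v0 w0 (\<lambda>_. \<alpha>) (\<lambda>_. \<beta>)"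
      using x by (simp add: vw lift_in_Gamma1_iff)
    have "ereal ?c \<le> J1 r d s u" if u: "u \<in> Gamma1 d v0 w0 (\<lambda>_. \<alpha>) (\<lambda>_. \<beta>)" for u
    proof -
      obtain y where y: "u = lift d y" using Gamma1_imp_lift[OF u] by blast
      have y': "inbox a b y" "(y \<longlongrightarrow> \<alpha>) at_bot" "(y \<longlongrightarrow> \<beta>) at_top"
        using u by (simp_all add: y vw lift_in_Gamma1_iff)
      have "J_ge_at_ends (site_energy r d s) ?c y"
        by (rule J_ge_at_ends_minval[where m = 0 and m' = 0]) (use y' ends ab in \<open>auto simp: between_const_iff\<close>)
      then show ?thesis unfolding y by (rule J1_lift_ge)
    qed
    then have "ereal ?c \<le> c1 r d s v0 w0 (\<lambda>_. \<alpha>) (\<lambda>_. \<beta>)"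
      unfolding c1_def by (rule INF_greatest)
    moreover have "c1 r d s v0 w0 (\<lambda>_. \<alpha>) (\<lambda>_. \<beta>) \<le> J1 r d s (lift d x)"
      unfolding c1_def by (rule INF_lower[OF \<Gamma>])
    ultimately show ?thesis
      using \<Gamma> J1_lift_le[OF le] by (simp add: M1_def)
  qed
  have rho: "rho_minus d v0 (lift d x) = x 0 - a" "rho_plus d w0 (lift d x) = b - x 0" if "inbox a b x" for x
    using inboxD[OF that, of 0] by (simp_all add: rho_minus_def rho_plus_def dist_T_def vw)
  \<comment> \<open>A minimal heteroclinic with such a value at 0 would be an element of
    \<open>M1\<close> at the excluded distance.\<close>
  have up: "no_minimal_heteroclinic (site_energy r d s) r a b a b (a + \<rho>1)"
    "no_minimal_heteroclinic (site_energy r d s) r a b a b (b - \<rho>2)"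
    unfolding no_minimal_heteroclinic_def
    using M1I[of _ a b, folded vw] rho assms(11,13) by (force simp: image_iff)+
  have down: "no_minimal_heteroclinic (site_energy r d s) r a b b a (b - \<rho>3)"
    "no_minimal_heteroclinic (site_energy r d s) r a b b a (a + \<rho>4)"
    unfolding no_minimal_heteroclinic_def
    using M1I[of _ b a, folded vw] rho assms(15,17) by (force simp: image_iff)+
  let ?lo = "\<lambda>m2 m3 l. lower_bound a b \<rho>2 \<rho>3 m2 m3 l" and ?hi = "\<lambda>m1 m4 l. upper_bound a b \<rho>1 \<rho>4 m1 m4 l"
  obtain l0 :: nat and N :: int where main:
    "\<And>l m1 m2 m3 m4. l0 \<le> l \<Longrightarrow> m1 < m2 \<Longrightarrow> m2 + 2 * int l < m3 \<Longrightarrow> m3 < m4 \<Longrightarrow>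
      \<exists>U. homoclinic_minimizer (site_energy r d s) r a (?lo m2 m3 l) (?hi m1 m4 l) U \<and>
        (N \<le> m2 - m1 \<and> N \<le> m4 - m3 \<longrightarrow>
          inactive a b (?lo m2 m3 l) (?hi m1 m4 l) U)"
    by (fact constrained_minimizer[OF \<rho> up down])
  have "\<exists>U \<in> Y d v0 w0 \<rho>1 \<rho>2 \<rho>3 \<rho>4 m1 m2 m3 m4 l.
       J1 r d s U = (INF u\<in>Y d v0 w0 \<rho>1 \<rho>2 \<rho>3 \<rho>4 m1 m2 m3 m4 l. J1 r d s u) \<and>
       (m2 - m1 \<ge> N \<and> m4 - m3 \<ge> N \<longrightarrow> EL_solution r s U)"
    if l: "l0 \<le> l" and m: "m1 < m2" "m2 + 2 * int l < m3" "m3 < m4" for l m1 m2 m3 m4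
  proof -
    define lo hi where "lo = ?lo m2 m3 l" and "hi = ?hi m1 m4 l"
    let ?B = "minval (site_energy r d s) r a a lo hi"
    note defs = lo_def hi_def lower_bound_def upper_bound_def
    have box: "\<forall>i. a \<le> lo i \<and> lo i \<le> hi i \<and> hi i \<le> b"
      using \<rho> ab m by (auto simp: defs)
    have far: "\<forall>i\<le>m2 - 1. lo i = a" "\<forall>i\<ge>m3. lo i = a"
      using m by (auto simp: defs)
    \<comment> \<open>With values in [a, b] each distance condition is a one-sided bound, so the
      four conditions become the two barriers.\<close>
    have Y_iff: "lift d x \<in> Y d v0 w0 \<rho>1 \<rho>2 \<rho>3 \<rho>4 m1 m2 m3 m4 l \<longleftrightarrow>
        between lo hi x \<and> (x \<longlongrightarrow> a) at_bot \<and> (x \<longlongrightarrow> a) at_top" for x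
    proof -
      have sh: "shift1 d i (lift d x) (T d 0) = x i" for i
        by (simp add: shift1_def lift_def T_def axis_def)
      have "(\<forall>i\<in>{m1 - int l..m1 - 1}. \<bar>x i - a\<bar> \<le> \<rho>1) \<and> (\<forall>i\<in>{m2..m2 + int l - 1}. \<bar>x i - b\<bar> \<le> \<rho>2) \<and>
          (\<forall>i\<in>{m3 - int l..m3 - 1}. \<bar>x i - b\<bar> \<le> \<rho>3) \<and> (\<forall>i\<in>{m4..m4 + int l - 1}. \<bar>x i - a\<bar> \<le> \<rho>4) \<longleftrightarrow>
          between lo hi x" (is "?L \<longleftrightarrow> _") if x: "inbox a b x"
      proof
        assume ?L
        then show "between lo hi x"
          unfolding between_def defs using inboxD[OF x] by (auto simp: abs_le_iff algebra_simps)
      next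
        assume bt: "between lo hi x"
        have "lo i \<le> x i" "x i \<le> hi i" "a \<le> x i" "x i \<le> b" for i
          using bt inboxD[OF x] by (auto simp: between_def)
        moreover have "hi i = a + \<rho>1" if "i \<in> {m1 - int l..m1 - 1}" for i
          using that by (simp add: defs)
        moreover have "hi i = a + \<rho>4" if "i \<in> {m4..m4 + int l - 1}" for i
          using that m by (simp add: defs)
        moreover have "lo i = b - \<rho>2" if "i \<in> {m2..m2 + int l - 1}" for i
          using that by (simp add: defs)
        moreover have "lo i = b - \<rho>3" if "i \<in> {m3 - int l..m3 - 1}" for i
          using that m by (simp add: defs)
        ultimately show ?L
          by (smt (verit))
      qed
      moreover have "inbox a b x" if "between lo hi x"
        using between_inbox[OF that] box by blast
      ultimately show ?thesis
        unfolding Y_def rho_minus_def rho_plus_def dist_T_def sh vw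
        by (auto simp: sh lift_in_Gamma1_iff[of d x a b a a] simp del: atLeastAtMost_iff)
    qed
    obtain U where U: "between lo hi U" "(U \<longlongrightarrow> a) at_bot" "(U \<longlongrightarrow> a) at_top"
      "J_le_at_ends (site_energy r d s) ?B U"
      "N \<le> m2 - m1 \<and> N \<le> m4 - m3 \<longrightarrow> inactive a b lo hi U"
      using main[OF l m] unfolding lo_def hi_def by blast
    have ge: "ereal ?B \<le> J1 r d s u" if u: "u \<in> Y d v0 w0 \<rho>1 \<rho>2 \<rho>3 \<rho>4 m1 m2 m3 m4 l" for u
    proof -
      obtain y where y: "u = lift d y"
        using u Gamma1_imp_lift unfolding Y_def by blast
      have y': "between lo hi y" "(y \<longlongrightarrow> a) at_bot" "(y \<longlongrightarrow> a) at_top"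
        using u unfolding y Y_iff by auto
      have "J_ge_at_ends (site_energy r d s) ?B y"
        by (rule J_ge_at_ends_minval[OF _ y'(1) _ _ _ _ y'(2,3), of "m2 - 1" m3])
           (use box far in \<open>auto intro: order_trans\<close>)
      then show ?thesis unfolding y by (rule J1_lift_ge)
    qed
    have UY: "lift d U \<in> Y d v0 w0 \<rho>1 \<rho>2 \<rho>3 \<rho>4 m1 m2 m3 m4 l"
      using U by (simp add: Y_iff)
    have "J1 r d s (lift d U) = (INF u\<in>Y d v0 w0 \<rho>1 \<rho>2 \<rho>3 \<rho>4 m1 m2 m3 m4 l. J1 r d s u)"
    proof (rule antisym)
      have "ereal ?B \<le> (INF u\<in>Y d v0 w0 \<rho>1 \<rho>2 \<rho>3 \<rho>4 m1 m2 m3 m4 l. J1 r d s u)"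
        by (rule INF_greatest) (rule ge)
      with J1_lift_le[OF U(4)]
      show "J1 r d s (lift d U) \<le> (INF u\<in>Y d v0 w0 \<rho>1 \<rho>2 \<rho>3 \<rho>4 m1 m2 m3 m4 l. J1 r d s u)"
        by (rule order_trans)
    qed (rule INF_lower[OF UY])
    moreover have "EL_solution r s (lift d U)" if N: "N \<le> m2 - m1" "N \<le> m4 - m3"
    proof (rule EL_solution_lift)
      fix i
      \<comment> \<open>The constants \<open>a\<close> and \<open>b\<close> satisfy the equation;
        this is what \<open>stationary\<close> needs where \<open>U\<close> touches them.\<close>
      have a': "((\<lambda>h. J (site_energy r d s) (i - int r) (i + int r) ((\<lambda>_. a)(i := a + h))) has_real_derivative 0) (at 0)"
        and b': "((\<lambda>h. J (site_energy r d s) (i - int r) (i + int r) ((\<lambda>_. b)(i := b + h))) has_real_derivative 0) (at 0)"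
        using EL_term_derivative[OF C1, of d i "\<lambda>_. a"] EL_term_derivative[OF C1, of d i "\<lambda>_. b"]
          EL_term_const[OF C1 assms(5) a, of d i] EL_term_const[OF C1 assms(5) b, of d i] by simp_all
      show "EL_term r d s U i = 0"
        by (rule stationary[OF box U(1-4) far _ _ EL_term_derivative[OF C1] a' b']) (use U(5) N in auto)
    qed
    ultimately show ?thesis
      using UY by blast
  qed
  then show ?thesis
    by (intro exI[of _ l0] allI impI exI[of _ N]) auto
qed


end
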